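(* Let $n\ge 3$, $k\ge 1$, and let $P_1,\dots,P_k$ be hyperbolic $n$-gons with fixed total area $\sum_{i=1}^k \mathrm{Area}(P_i)=T$, satisfying $$\mathrm{Area}(P_i) > (n-2)\pi - 2n\,\sin^{-1}\!\left(\sqrt{1-\sin(\pi/n)}\right)\qquad\text{for } i=1,\dots,k.$$ Then $$\sum_{i=1}^k \mathrm{Peri}(P_i)\;\geq\; 2nk\,\cosh^{-1}\!\left(\frac{\cos(\pi/n)}{\sin\!\left(\dfrac{(n-2)\pi - T/k}{2n}\right)}\right),$$ with equality if and only if all $P_i$ are isometric to a regular polygon of area $T/k$.
   Context: A hyperbolic $n$-gon is a polygon with $n$ geodesic sides in the hyperbolic plane of constant curvature $-1$; all of its vertices are assumed to lie in the hyperbolic plane (no ideal vertices). $\mathrm{Area}(P)$ is the hyperbolic area of $P$ and $\mathrm{Peri}(P)$ is the sum of the hyperbolic lengths of its sides. A polygon is regular if all its sides are equal and all its interior angles are equal. Here $\cosh^{-1}$ takes values in $[0,\infty)$. *)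

theory Defs
  imports "HOL-Analysis.Analysis"
begin

text \<open>
  The hyperbolic plane of curvature -1 is the Beltrami--Klein model: the open unit disc with
  \<open>ds\<^sup>2 = \<bar>dx\<bar>\<^sup>2 / (1 - \<bar>x\<bar>\<^sup>2) + (x \<bullet> dx)\<^sup>2 / (1 - \<bar>x\<bar>\<^sup>2)\<^sup>2\<close>.  Its geodesics are the Euclidean line segments
  in the disc, so geodesic sides are closed segments; the model is not conformal, so
  angles and areas are taken with respect to the metric tensor.
\<close>

definition hyp_plane :: "(real^2) set" where
  "hyp_plane = ball 0 1"

definition hyp_dist :: "real^2 \<Rightarrow> real^2 \<Rightarrow> real" where
  "hyp_dist x y = arcosh ((1 - x \<bullet> y) / sqrt ((1 - (norm x)\<^sup>2) * (1 - (norm y)\<^sup>2)))"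

definition hyp_metric :: "real^2 \<Rightarrow> real^2 \<Rightarrow> real^2 \<Rightarrow> real" where
  "hyp_metric x u v =
     (u \<bullet> v) / (1 - (norm x)\<^sup>2) + (x \<bullet> u) * (x \<bullet> v) / (1 - (norm x)\<^sup>2)\<^sup>2"

definition hyp_angle :: "real^2 \<Rightarrow> real^2 \<Rightarrow> real^2 \<Rightarrow> real" where
  "hyp_angle x u v =
     arccos (hyp_metric x u v / sqrt (hyp_metric x u u * hyp_metric x v v))"

text \<open>The Riemannian area density is the square root of the Gram determinant.\<close>

definition hyp_density :: "real^2 \<Rightarrow> real" where
  "hyp_density x =
     sqrt (hyp_metric x (axis 1 1) (axis 1 1) * hyp_metric x (axis 2 1) (axis 2 1)
           - (hyp_metric x (axis 1 1) (axis 2 1))\<^sup>2)"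

lemma hyp_density_eq:
  assumes "x \<in> hyp_plane"
  shows "hyp_density x = 1 / sqrt ((1 - (norm x)\<^sup>2) ^ 3)"
proof -
  define s where "s = 1 - (norm x)\<^sup>2"
  have n: "(norm x)\<^sup>2 = (x $ 1)\<^sup>2 + (x $ 2)\<^sup>2"
    by (simp only: power2_norm_eq_inner) (simp add: inner_vec_def sum_2 power2_eq_square)
  have "norm x < 1"
    using assms by (simp add: hyp_plane_def)
  then have s: "s > 0"
    unfolding s_def by (simp add: power_less_one_iff)
  have m: "hyp_metric x (axis 1 1) (axis 1 1) = 1 / s + (x $ 1)\<^sup>2 / s\<^sup>2"
    "hyp_metric x (axis 2 1) (axis 2 1) = 1 / s + (x $ 2)\<^sup>2 / s\<^sup>2"
    "hyp_metric x (axis 1 1) (axis 2 1) = (x $ 1) * (x $ 2) / s\<^sup>2"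
    by (simp_all add: hyp_metric_def s_def inner_vec_def sum_2 axis_def power2_eq_square)
  have "(1 / s + (x $ 1)\<^sup>2 / s\<^sup>2) * (1 / s + (x $ 2)\<^sup>2 / s\<^sup>2) - ((x $ 1) * (x $ 2) / s\<^sup>2)\<^sup>2
      = (s + ((x $ 1)\<^sup>2 + (x $ 2)\<^sup>2)) / s ^ 3"
    using s by (simp add: field_simps power2_eq_square power3_eq_cube)
  also have "s + ((x $ 1)\<^sup>2 + (x $ 2)\<^sup>2) = 1"
    by (simp add: s_def n)
  finally show ?thesis
    by (simp add: hyp_density_def m real_sqrt_divide flip: s_def)
qed

text \<open>A polygon is given by the cyclic list of its vertices.\<close>

definition poly_side :: "(real^2) list \<Rightarrow> nat \<Rightarrow> (real^2) set" where
  "poly_side P i = closed_segment (P ! i) (P ! (Suc i mod length P))"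

definition poly_boundary :: "(real^2) list \<Rightarrow> (real^2) set" where
  "poly_boundary P = (\<Union>i<length P. poly_side P i)"

definition poly_region :: "(real^2) list \<Rightarrow> (real^2) set" where
  "poly_region P = poly_boundary P \<union> inside (poly_boundary P)"

text \<open>
  The last condition says that the polygon is simple: two different sides meet at most in a
  common vertex.  Convexity is not required, and a straight angle is allowed.
\<close>

definition hyp_ngon :: "nat \<Rightarrow> (real^2) list \<Rightarrow> bool" where
  "hyp_ngon n P \<longleftrightarrow>
     n \<ge> 3 \<and> length P = n \<and> set P \<subseteq> hyp_plane \<and> distinct P \<and>
     (\<forall>i<n. \<forall>j<n. i \<noteq> j \<longrightarrow>
        poly_side P i \<inter> poly_side P j
          = {P ! i, P ! (Suc i mod n)} \<inter> {P ! j, P ! (Suc j mod n)})"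

definition hyp_area :: "(real^2) list \<Rightarrow> real" where
  "hyp_area P = integral (poly_region P) hyp_density"

definition side_length :: "(real^2) list \<Rightarrow> nat \<Rightarrow> real" where
  "side_length P i = hyp_dist (P ! i) (P ! (Suc i mod length P))"

definition hyp_peri :: "(real^2) list \<Rightarrow> real" where
  "hyp_peri P = (\<Sum>i<length P. side_length P i)"

text \<open>
  At the vertex \<open>v\<close> with side directions \<open>a\<close> and \<open>b\<close>, the direction \<open>a + b\<close> points into the
  sector with angle at most \<open>pi\<close>; the interior angle is that angle if this sector
  is locally inside the polygon, and its complement to \<open>2 * pi\<close> (a reflex angle) otherwise.
  For a straight angle both cases give \<open>pi\<close>.
\<close>

definition interior_angle :: "(real^2) list \<Rightarrow> nat \<Rightarrow> real" where
  "interior_angle P i =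
     (let n = length P; v = P ! i; a = P ! ((i + n - 1) mod n) - v; b = P ! (Suc i mod n) - v in
      if \<forall>\<^sub>F t in at_right 0. v + t *\<^sub>R (a + b) \<in> inside (poly_boundary P)
      then hyp_angle v a b else 2 * pi - hyp_angle v a b)"

definition regular_ngon :: "nat \<Rightarrow> (real^2) list \<Rightarrow> bool" where
  "regular_ngon n P \<longleftrightarrow>
     hyp_ngon n P \<and>
     (\<forall>i<n. \<forall>j<n. side_length P i = side_length P j) \<and>
     (\<forall>i<n. \<forall>j<n. interior_angle P i = interior_angle P j)"

definition hyp_isometry :: "(real^2 \<Rightarrow> real^2) \<Rightarrow> bool" where
  "hyp_isometry f \<longleftrightarrow>
     f ` hyp_plane = hyp_plane \<and>
     (\<forall>x\<in>hyp_plane. \<forall>y\<in>hyp_plane. hyp_dist (f x) (f y) = hyp_dist x y)"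

definition isometric :: "(real^2) list \<Rightarrow> (real^2) list \<Rightarrow> bool" where
  "isometric P Q \<longleftrightarrow> (\<exists>f. hyp_isometry f \<and> f ` poly_region P = poly_region Q)"

end

theory Submission
  imports Defs "HOL-Complex_Analysis.Complex_Analysis"
begin

text \<open>
  In the Poincare disc write \<open>q = 1 - cnj a * b\<close>.  The side \<open>a, b\<close> contributes minus twice the argument of \<open>q\<close>
  to the signed area of a polygon, and \<open>cosh (d/2)\<close> is the modulus of \<open>q\<close> up to normalisation, so area \<open>S\<close> and
  perimeter \<open>L\<close> are elementary functions of the vertices.  To see that \<open>S \<le> g(L)\<close>, where \<open>g\<close> is the area of the
  regular n-gon as a function of its perimeter, suppose it fails and maximize \<open>S - g(L) - \<eta> L\<close> for a small
  \<open>\<eta> > 0\<close>; the maximum exists, because \<open>S\<close> is bounded.  With a vertex moved to the origin and neighbours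
  \<open>a, b\<close>, criticality reads \<open>\<i> (b - a) = \<lambda> (sgn a + sgn b)\<close> with the same \<open>\<lambda>\<close> at all vertices, which
  forces equal sides and equal oriented angles.  Hence a single automorphism permutes the vertices cyclically; it
  fixes their hyperbolic barycentre, and the vertices become \<open>r \<omega>^i\<close> with \<open>\<omega>^n = 1\<close>, where the inequality
  is a computation.  In the case of equality the same argument applies to the polygon itself, with \<open>\<eta> = 0\<close>.

  For a simple polygon the Riemannian area is the absolute value of \<open>S\<close>, by adding up winding numbers of triangles.
  That a polygon with equal sides and equal interior angles is extremal follows by the same orbit argument: the
  interior angles determine the orientation at each vertex, since the winding number jumps there by that orientation,
  and simplicity forces \<open>\<omega>\<close> to be a primitive root closest to \<open>1\<close>.

  Finally the perimeter of the regular n-gon is a strictly convex function of its area exactly above the stated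
  threshold, and Jensen's inequality gives the theorem.
\<close>

section \<open>The Poincare disc\<close>

text \<open>The penalty \<open>\<eta> L\<close> is there because \<open>S\<close> and
  \<open>g\<close> are both bounded: without it a maximizing sequence may run to the ideal boundary.
  Admitting repetitions has a price: the length is not differentiable at a vertex that coincides
  with a neighbour, and a vertex coinciding with exactly one neighbour is excluded by a one-sided
  variation. Two models are carried along: the Klein disc, where sides are segments and the topology
  of plane polygons applies, and the Poincare disc, where automorphisms and area are
  complex-analytic. The threshold comes from the side length as a function of the half angle
  \<open>x\<close>: its derivative increases as long as \<open>(sin x)^2 < 1 - sin (pi / n)\<close>,
  and a smaller half angle means a larger area.\<close>

text \<open>Twice the argument of \<open>1 - cnj a * b\<close> is minus the signed area of the triangle \<open>0, a, b\<close> in the Poincare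
  disc; summed around a polygon it gives the signed area, whatever the position of the origin.\<close>

definition parea :: "complex \<Rightarrow> complex \<Rightarrow> real" where
  "parea a b = - 2 * Im (Ln (1 - cnj a * b))"

text \<open>The pseudo-hyperbolic distance, that is, \<open>tanh\<close> of half the hyperbolic
  distance; it equals the modulus of \<open>pinv a b\<close>.\<close>

definition pdelta :: "complex \<Rightarrow> complex \<Rightarrow> real" where
  "pdelta a b = cmod (a - b) / cmod (1 - cnj a * b)"

definition pdist :: "complex \<Rightarrow> complex \<Rightarrow> real" where
  "pdist a b = 2 * artanh (pdelta a b)"

text \<open>The half-turn exchanging \<open>0\<close> and \<open>w\<close>.\<close>

definition pinv :: "complex \<Rightarrow> complex \<Rightarrow> complex" where
  "pinv w z = (w - z) / (1 - cnj w * z)"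

text \<open>A product of two points of the disc has modulus below 1. The kernel therefore stays in
  the right half-plane, where the principal \<open>Ln\<close> is smooth and its imaginary part is
  below \<open>pi / 2\<close> in modulus; this keeps \<open>parea\<close> free of branch
  ambiguities.\<close>

lemma pker_Re_pos:
  assumes "cmod a < 1" "cmod b < 1"
  shows "Re (1 - cnj a * b) > 0"
proof -
  have "cmod (cnj a * b) < 1"
    using assms mult_strict_mono[of "cmod a" 1 "cmod b" 1] by (simp add: norm_mult)
  then show ?thesis using complex_Re_le_cmod[of "cnj a * b"] by simp
qed

lemma pker_nz: "cmod a < 1 \<Longrightarrow> cmod b < 1 \<Longrightarrow> 1 - cnj a * b \<noteq> 0"
  using pker_Re_pos by fastforce

lemma disc_sq: "cmod a < 1 \<Longrightarrow> (cmod a)\<^sup>2 < 1"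
  by (simp add: abs_square_less_1)

lemma pker_cmod:
  "(cmod (1 - cnj a * b))\<^sup>2 - (cmod (a - b))\<^sup>2 = (1 - (cmod a)\<^sup>2) * (1 - (cmod b)\<^sup>2)"
  unfolding cmod_power2 by (simp add: algebra_simps power2_eq_square)

lemma pdelta_sq:
  assumes "cmod a < 1" "cmod b < 1"
  shows "1 - (pdelta a b)\<^sup>2 = (1 - (cmod a)\<^sup>2) * (1 - (cmod b)\<^sup>2) / (cmod (1 - cnj a * b))\<^sup>2"
  using pker_cmod[of a b] pker_nz[OF assms]
  by (simp add: pdelta_def power_divide field_simps)

lemma pdelta_less1:
  assumes "cmod a < 1" "cmod b < 1"
  shows "pdelta a b < 1"
proof -
  have "0 < (1 - (cmod a)\<^sup>2) * (1 - (cmod b)\<^sup>2) / (cmod (1 - cnj a * b))\<^sup>2"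
    using assms pker_nz[OF assms] by (simp add: disc_sq)
  then have "(pdelta a b)\<^sup>2 < 1" using pdelta_sq[OF assms] by linarith
  then show ?thesis using abs_square_less_1[of "pdelta a b"] by linarith
qed

lemma pdelta_nonneg: "pdelta a b \<ge> 0" by (simp add: pdelta_def)

lemma pdelta_0 [simp]: "pdelta 0 b = cmod b" "pdelta b 0 = cmod b"
  by (simp_all add: pdelta_def)

lemma pdelta_self [simp]: "pdelta a a = 0" by (simp add: pdelta_def)

lemma pdelta_commute: "pdelta a b = pdelta b a"
proof -
  have "cmod (1 - cnj a * b) = cmod (cnj (1 - cnj a * b))" by (metis complex_mod_cnj)
  also have "cnj (1 - cnj a * b) = 1 - cnj b * a" by simp
  finally show ?thesis by (simp add: pdelta_def norm_minus_commute)
qed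

lemma pdelta_eq_0: "cmod a < 1 \<Longrightarrow> cmod b < 1 \<Longrightarrow> pdelta a b = 0 \<longleftrightarrow> a = b"
  using pker_nz by (auto simp: pdelta_def)

lemma artanh_less_iff:
  fixes x y :: real
  assumes "-1 < x" "x < 1" "-1 < y" "y < 1"
  shows "artanh x < artanh y \<longleftrightarrow> x < y"
proof -
  have "(1 + x) / (1 - x) < (1 + y) / (1 - y) \<longleftrightarrow> x < y"
    using assms by (simp add: divide_simps) (auto simp: algebra_simps)
  then show ?thesis using assms by (simp add: artanh_def)
qed

lemma tanh_artanh_real:
  fixes x :: real assumes "-1 < x" "x < 1" shows "tanh (artanh x) = x"
proof -
  have "artanh (tanh (artanh x)) = artanh x" by (rule artanh_tanh_real)
  moreover have "-1 < tanh (artanh x)" "tanh (artanh x) < 1"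
    using tanh_real_bounds[of "artanh x"] by auto
  ultimately show ?thesis using assms artanh_less_iff
    by (metis less_irrefl linorder_neqE_linordered_idom)
qed

lemma pdist_nonneg: "cmod a < 1 \<Longrightarrow> cmod b < 1 \<Longrightarrow> pdist a b \<ge> 0"
  using artanh_less_iff[of "pdelta a b" 0] pdelta_less1[of a b] pdelta_nonneg[of a b]
  by (simp add: pdist_def)

lemma tanh_pdist: "cmod a < 1 \<Longrightarrow> cmod b < 1 \<Longrightarrow> tanh (pdist a b / 2) = pdelta a b"
  using pdelta_less1[of a b] pdelta_nonneg[of a b] by (simp add: pdist_def tanh_artanh_real)

lemma pdist_eq_0: "cmod a < 1 \<Longrightarrow> cmod b < 1 \<Longrightarrow> pdist a b = 0 \<longleftrightarrow> a = b"
  by (metis artanh_0 divide_eq_0_iff mult_zero_right pdelta_eq_0 pdist_def tanh_0 tanh_pdist)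

lemma pdist_self [simp]: "pdist a a = 0" by (simp add: pdist_def)

lemma pdist_commute: "pdist a b = pdist b a"
  by (simp add: pdist_def pdelta_commute)

lemma cosh_pdist_half:
  assumes "cmod a < 1" "cmod b < 1"
  shows "cosh (pdist a b / 2) = cmod (1 - cnj a * b) / sqrt ((1 - (cmod a)\<^sup>2) * (1 - (cmod b)\<^sup>2))"
proof -
  let ?d = "pdist a b / 2"
  have c: "cosh ?d > 0" by simp
  have "1 - (tanh ?d)\<^sup>2 = 1 / (cosh ?d)\<^sup>2"
    using c cosh_square_eq[of ?d] by (simp add: tanh_def power_divide divide_simps add_nonneg_eq_0_iff)
  then have "(cosh ?d)\<^sup>2 = 1 / (1 - (tanh ?d)\<^sup>2)" by simp
  also have "\<dots> = (cmod (1 - cnj a * b))\<^sup>2 / ((1 - (cmod a)\<^sup>2) * (1 - (cmod b)\<^sup>2))"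
    by (simp add: tanh_pdist[OF assms] pdelta_sq[OF assms])
  finally have "sqrt ((cosh ?d)\<^sup>2) = sqrt ((cmod (1 - cnj a * b))\<^sup>2 / ((1 - (cmod a)\<^sup>2) * (1 - (cmod b)\<^sup>2)))"
    by simp
  then show ?thesis using c by (simp add: real_sqrt_divide)
qed

lemma pinv_self [simp]: "pinv w w = 0" by (simp add: pinv_def)
lemma pinv_0 [simp]: "pinv w 0 = w" by (simp add: pinv_def)

lemma pinv_bound:
  assumes "cmod w < 1" "cmod z < 1"
  shows "cmod (pinv w z) < 1"
  using pdelta_less1[OF assms] by (simp add: pinv_def pdelta_def norm_divide)

lemma pinv_pinv [simp]:
  assumes "cmod w < 1" "cmod z < 1"
  shows "pinv w (pinv w z) = z"
proof -
  have a: "1 - cnj w * z \<noteq> 0" by (rule pker_nz[OF assms])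
  have b: "1 - cnj w * w \<noteq> 0" by (rule pker_nz[OF assms(1) assms(1)])
  have "pinv w z * (1 - cnj w * z) = w - z" using a by (simp add: pinv_def)
  then have "(w - pinv w z) * (1 - cnj w * z) = z * (1 - cnj w * w)"
    "(1 - cnj w * pinv w z) * (1 - cnj w * z) = 1 - cnj w * w"
    by (algebra)+
  then have "(w - pinv w z) * (1 - cnj w * z) = (z * (1 - cnj w * pinv w z)) * (1 - cnj w * z)"
    by (simp only: mult.assoc)
  then have "w - pinv w z = z * (1 - cnj w * pinv w z)" using mult_right_cancel[OF a] by blast
  moreover have "1 - cnj w * pinv w z \<noteq> 0"
    using pker_nz[OF assms(1) pinv_bound[OF assms]] .
  ultimately show ?thesis by (simp add: pinv_def[of w "pinv w z"])
qed

text \<open>The kernel is multiplied by a positive constant and by two factors, each depending on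
  one of the points only. The moduli of these factors cancel in \<open>pdelta\<close>; their
  arguments become the boundary terms of \<open>parea_pinv\<close>.\<close>

lemma pker_pinv:
  assumes "cmod w < 1" "cmod a < 1" "cmod b < 1"
  shows "1 - cnj (pinv w a) * pinv w b
     = (1 - cnj w * w) * (1 - cnj a * b) / ((1 - cnj a * w) * (1 - cnj w * b))"
proof -
  have "1 - cnj w * b \<noteq> 0" "1 - w * cnj a \<noteq> 0"
    using pker_nz[of w b] pker_nz[of a w] assms by (auto simp: mult.commute)
  then show ?thesis unfolding pinv_def
    by (simp add: divide_simps mult.commute) (simp add: algebra_simps)
qed

lemma pdelta_pinv [simp]:
  assumes "cmod w < 1" "cmod a < 1" "cmod b < 1"
  shows "pdelta (pinv w a) (pinv w b) = pdelta a b"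
proof -
  have n: "1 - cnj w * b \<noteq> 0" "1 - cnj w * a \<noteq> 0" "1 - cnj w * w \<noteq> 0" "1 - cnj a * w \<noteq> 0" "1 - cnj a * b \<noteq> 0"
    using pker_nz assms by auto
  have e: "pinv w a - pinv w b = (b - a) * (1 - cnj w * w) / ((1 - cnj w * a) * (1 - cnj w * b))"
    using n unfolding pinv_def by (simp add: divide_simps) algebra
  have "cmod (1 - cnj w * a) = cmod (cnj (1 - cnj w * a))" by (metis complex_mod_cnj)
  also have "cnj (1 - cnj w * a) = 1 - cnj a * w" by simp
  finally have s: "cmod (1 - cnj w * a) = cmod (1 - cnj a * w)" .
  show ?thesis using n unfolding pdelta_def pker_pinv[OF assms] e
    by (simp add: norm_mult norm_divide s norm_minus_commute)
qed

lemma pdist_pinv [simp]: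
  "cmod w < 1 \<Longrightarrow> cmod a < 1 \<Longrightarrow> cmod b < 1 \<Longrightarrow> pdist (pinv w a) (pinv w b) = pdist a b"
  by (simp add: pdist_def)

lemma parea_0 [simp]: "parea 0 b = 0" "parea b 0 = 0"
  by (simp_all add: parea_def)

lemma Ln_cnj_pos: "Re z > 0 \<Longrightarrow> Im (Ln (cnj z)) = - Im (Ln z)"
  by (subst cnj_Ln[symmetric]) (auto simp: complex_nonpos_Reals_iff)

lemma parea_swap:
  assumes "cmod a < 1" "cmod b < 1"
  shows "parea b a = - parea a b"
  using Ln_cnj_pos[OF pker_Re_pos[OF assms]] by (simp add: parea_def mult.commute)

lemma parea_self:
  assumes "cmod a < 1" shows "parea a a = 0"
  using parea_swap[OF assms assms] by simp

lemma parea_bound: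
  assumes "cmod a < 1" "cmod b < 1"
  shows "\<bar>parea a b\<bar> < pi"
  using Re_Ln_pos_lt_imp[OF pker_Re_pos[OF assms]] by (simp add: parea_def abs_mult)

lemma exp_i_Im_Ln: "z \<noteq> 0 \<Longrightarrow> exp (\<i> * of_real (Im (Ln z))) = z / of_real (cmod z)"
  by (metis Arg_eq_Im_Ln Arg_eq nonzero_mult_div_cancel_left norm_eq_zero of_real_eq_0_iff)

lemma exp_i_diff:
  "exp (\<i> * of_real (x - y)) = exp (\<i> * of_real x) / exp (\<i> * of_real y)"
  by (simp add: exp_diff[symmetric] algebra_simps)

lemma sgn_quotient:
  fixes u v t :: complex
  assumes "k > 0" "u \<noteq> 0" "v \<noteq> 0" "t \<noteq> 0"
  shows "(of_real k * u / (v * t)) / of_real (cmod (of_real k * u / (v * t)))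
     = u / of_real (cmod u) / (v / of_real (cmod v)) / (t / of_real (cmod t))"
  using assms by (simp add: norm_mult norm_divide mult_ac)

lemma exp_i_diff2:
  "exp (\<i> * of_real (x - y - z)) = exp (\<i> * of_real x) / exp (\<i> * of_real y) / exp (\<i> * of_real z)"
  by (simp add: exp_diff[symmetric] algebra_simps)

lemma one_minus_cnj_self: "1 - cnj w * w = of_real (1 - (cmod w)\<^sup>2)"
  by (metis complex_norm_square mult.commute of_real_1 of_real_diff of_real_power)

text \<open>Taking arguments in \<open>pker_pinv\<close> gives the equation for the arguments modulo
  \<open>2 * pi\<close>. All four of them are below \<open>pi / 2\<close> in modulus, so the
  multiple of \<open>2 * pi\<close> is zero. The two extra terms involve one vertex each and
  telescope around a closed polygon.\<close>

lemma parea_pinv: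
  assumes "cmod w < 1" "cmod a < 1" "cmod b < 1"
  shows "parea (pinv w a) (pinv w b) = parea a b - parea a w + parea b w"
proof -
  let ?t = "\<lambda>a b. Im (Ln (1 - cnj a * b))"
  let ?A = "pinv w a" and ?B = "pinv w b"
  have AB: "cmod ?A < 1" "cmod ?B < 1" using assms by (auto intro: pinv_bound)
  have bd: "\<bar>?t x y\<bar> < pi / 2" if "cmod x < 1" "cmod y < 1" for x y
    by (rule Re_Ln_pos_lt_imp[OF pker_Re_pos[OF that]])
  have n: "1 - cnj w * b \<noteq> 0" "1 - cnj w * w \<noteq> 0" "1 - cnj a * w \<noteq> 0" "1 - cnj a * b \<noteq> 0" "1 - cnj ?A * ?B \<noteq> 0"
    using pker_nz assms AB by auto
  define D where "D = ?t ?A ?B - (?t a b - ?t a w - ?t w b)"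
  have "exp (\<i> * of_real (?t a b - ?t a w - ?t w b)) =
      exp (\<i> * of_real (?t a b)) / exp (\<i> * of_real (?t a w)) / exp (\<i> * of_real (?t w b))"
    by (rule exp_i_diff2)
  also have "\<dots> = (1 - cnj a * b) / of_real (cmod (1 - cnj a * b)) / ((1 - cnj a * w) / of_real (cmod (1 - cnj a * w)))
        / ((1 - cnj w * b) / of_real (cmod (1 - cnj w * b)))"
    using n by (simp add: exp_i_Im_Ln)
  also have "\<dots> = (1 - cnj ?A * ?B) / of_real (cmod (1 - cnj ?A * ?B))"
    unfolding pker_pinv[OF assms] one_minus_cnj_self[of w] using n disc_sq[OF assms(1)]
    by (subst sgn_quotient) auto
  also have "\<dots> = exp (\<i> * of_real (?t ?A ?B))"
    using n by (simp add: exp_i_Im_Ln)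
  finally have "exp (\<i> * of_real D) = 1"
    unfolding D_def exp_i_diff[of "?t ?A ?B"] by simp
  then obtain k :: int where k: "D = of_int (2 * k) * pi"
    by (auto simp: exp_eq_1)
  have "\<bar>D\<bar> < 2 * pi"
    using bd[OF AB] bd[OF assms(2,3)] bd[OF assms(2,1)] bd[OF assms(1,3)] unfolding D_def by linarith
  then have "\<bar>of_int (2 * k) :: real\<bar> < 2" unfolding k by (simp add: abs_mult)
  then have "k = 0" by linarith
  then have "?t ?A ?B = ?t a b - ?t a w - ?t w b" using k D_def by simp
  then show ?thesis using parea_swap[OF assms(1,3)] unfolding parea_def by linarith
qed

section \<open>First variation of area and length at a vertex\<close>

lemma pker_path_deriv:
  "((\<lambda>t. Im (Ln (1 - of_real t * c))) has_real_derivative - Im c) (at 0)"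
proof -
  have "((\<lambda>z. Ln (1 - z * c)) has_field_derivative - c) (at 0)"
    by (auto intro!: derivative_eq_intros)
  then have "((\<lambda>t. Ln (1 - of_real t * c)) has_vector_derivative - c) (at 0)"
    using has_vector_derivative_real_field[of "\<lambda>z. Ln (1 - z * c)" "-c" 0] by simp
  then have "((\<lambda>t. Im (Ln (1 - of_real t * c))) has_vector_derivative Im (- c)) (at 0)"
    by (rule bounded_linear.has_vector_derivative[OF bounded_linear_Im])
  then show ?thesis by (simp add: has_real_derivative_iff_has_vector_derivative)
qed

lemma parea_path_deriv:
  "((\<lambda>t. parea a (of_real t * e)) has_real_derivative 2 * Im (cnj a * e)) (at 0)"
  "((\<lambda>t. parea (of_real t * e) b) has_real_derivative 2 * Im (cnj e * b)) (at 0)"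
  using DERIV_cmult[OF pker_path_deriv[of "cnj a * e"], of "-2"]
    DERIV_cmult[OF pker_path_deriv[of "cnj e * b"], of "-2"]
  by (simp_all add: parea_def mult.left_commute mult.assoc)

lemma pdist_path_deriv:
  assumes "a \<noteq> 0" "cmod a < 1"
  shows "((\<lambda>t. pdist a (of_real t * e)) has_real_derivative - 2 * Re (cnj a * e) / cmod a) (at 0)"
proof -
  define r q where "r = Re (cnj a * e)" and "q = (cmod e)\<^sup>2"
  let ?N = "\<lambda>t. (cmod a)\<^sup>2 - 2 * t * r + t\<^sup>2 * q"
  let ?D = "\<lambda>t. 1 - 2 * t * r + t\<^sup>2 * (cmod a)\<^sup>2 * q"
  have N: "cmod (a - of_real t * e) = sqrt (?N t)" for t
  proof -
    have "(cmod (a - of_real t * e))\<^sup>2 = ?N t"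
      unfolding r_def q_def cmod_power2 by (simp add: power2_eq_square algebra_simps)
    then show ?thesis by (metis norm_ge_zero real_sqrt_unique)
  qed
  have D: "cmod (1 - cnj a * (of_real t * e)) = sqrt (?D t)" for t
  proof -
    have "(cmod (1 - cnj a * (of_real t * e)))\<^sup>2 = ?D t"
      unfolding r_def q_def cmod_power2 by (simp add: power2_eq_square algebra_simps)
    then show ?thesis by (metis norm_ge_zero real_sqrt_unique)
  qed
  have eq: "(\<lambda>t. pdist a (of_real t * e)) = (\<lambda>t. 2 * artanh (sqrt (?N t / ?D t)))"
    unfolding pdist_def pdelta_def N D real_sqrt_divide ..
  have a2: "(cmod a)\<^sup>2 < 1" "(cmod a) > 0" "1 - (cmod a)\<^sup>2 \<noteq> 0" using assms disc_sq[of a] by auto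
  have 1: "((\<lambda>t. ?N t / ?D t) has_real_derivative - 2 * r * (1 - (cmod a)\<^sup>2)) (at 0)"
    by (auto intro!: derivative_eq_intros simp: algebra_simps)
  have 2: "((\<lambda>t. sqrt (?N t / ?D t)) has_real_derivative (inverse (sqrt ((cmod a)\<^sup>2)) / 2) * (- 2 * r * (1 - (cmod a)\<^sup>2))) (at 0)"
    by (rule DERIV_chain2[OF _ 1]) (use a2 DERIV_real_sqrt[of "(cmod a)\<^sup>2"] in auto)
  have 3: "((\<lambda>t. artanh (sqrt (?N t / ?D t))) has_real_derivative (1 / (1 - (sqrt ((cmod a)\<^sup>2))\<^sup>2)) * ((inverse (sqrt ((cmod a)\<^sup>2)) / 2) * (- 2 * r * (1 - (cmod a)\<^sup>2)))) (at 0)"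
    by (rule DERIV_chain2[OF _ 2]) (use assms a2 in \<open>auto intro!: artanh_real_has_field_derivative\<close>)
  show ?thesis unfolding eq
    by (rule DERIV_cong[OF DERIV_cmult[OF 3, of 2]]) (use a2 in \<open>simp add: r_def divide_simps\<close>)
qed

lemma eventually_small: "\<forall>\<^sub>F t::real in at 0. cmod (of_real t * e) < 1"
proof -
  have "((\<lambda>t. cmod (of_real t * e)) \<longlongrightarrow> cmod (of_real 0 * e)) (at 0)"
    by (intro tendsto_intros)
  then show ?thesis by (auto dest!: order_tendstoD(2)[of _ _ _ 1])
qed

text \<open>The vertex sits at the origin, its neighbours are \<open>a\<close> and \<open>b\<close>,
  and \<open>K\<close> stands for the total length of the other sides. The derivative of the
  objective in direction \<open>e\<close> must vanish, and it is real-linear in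
  \<open>e\<close>.\<close>

lemma critical_pair:
  assumes ab: "cmod a < 1" "cmod b < 1" "a \<noteq> 0" "b \<noteq> 0"
    and G: "(G has_real_derivative l) (at (K + pdist a 0 + pdist 0 b))"
    and max: "\<And>e. cmod e < 1 \<Longrightarrow>
      parea a e + parea e b - G (K + pdist a e + pdist e b) \<le> - G (K + pdist a 0 + pdist 0 b)"
  shows "\<i> * (b - a) = of_real l * (sgn a + sgn b)"
proof -
  have *: "2 * Im (cnj a * e) + 2 * Im (cnj e * b)
      - l * (- 2 * Re (cnj a * e) / cmod a - 2 * Re (cnj b * e) / cmod b) = 0" for e
  proof -
    define F where "F t = parea a (of_real t * e) + parea (of_real t * e) b
       - G (K + pdist a (of_real t * e) + pdist b (of_real t * e))" for t
    have L: "((\<lambda>t. K + pdist a (of_real t * e) + pdist b (of_real t * e)) has_real_derivative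
        (- 2 * Re (cnj a * e) / cmod a - 2 * Re (cnj b * e) / cmod b)) (at 0)"
      by (rule DERIV_cong[OF DERIV_add[OF DERIV_add[OF DERIV_const pdist_path_deriv] pdist_path_deriv]]) (use ab in \<open>auto simp: diff_divide_distrib add_divide_distrib\<close>)
    have GL: "((\<lambda>t. G (K + pdist a (of_real t * e) + pdist b (of_real t * e))) has_real_derivative
        l * (- 2 * Re (cnj a * e) / cmod a - 2 * Re (cnj b * e) / cmod b)) (at 0)"
      by (rule DERIV_chain2[OF _ L]) (use G in \<open>simp add: pdist_commute\<close>)
    have "(F has_real_derivative 2 * Im (cnj a * e) + 2 * Im (cnj e * b)
      - l * (- 2 * Re (cnj a * e) / cmod a - 2 * Re (cnj b * e) / cmod b)) (at 0)"
      unfolding F_def by (intro DERIV_diff DERIV_add parea_path_deriv GL)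
    moreover have "\<forall>\<^sub>F t in at 0. F t \<le> F 0"
      using eventually_small[of e]
    proof eventually_elim
      case (elim t)
      show ?case using max[OF elim] by (simp add: F_def pdist_commute)
    qed
    then obtain d where "d > 0" "\<And>t. t \<noteq> 0 \<Longrightarrow> dist t 0 < d \<Longrightarrow> F t \<le> F 0"
      unfolding eventually_at by auto
    then have "\<forall>y. \<bar>0 - y\<bar> < d \<longrightarrow> F y \<le> F 0" by (metis abs_minus_commute diff_0_right dist_real_def order_refl)
    ultimately show ?thesis using DERIV_local_max \<open>d > 0\<close> by blast
  qed
  have "Im (cnj a * e) + Im (cnj e * b) + l * (Re (cnj a * e) / cmod a + Re (cnj b * e) / cmod b) = 0" for e
    using *[of e] ab by (simp add: field_simps)
  \<comment> \<open>A real-linear functional of \<open>e\<close> is determined by its values at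
    \<open>1\<close> and \<open>\<i>\<close>; their vanishing gives the real and the imaginary part
    of the claim.\<close>
  from this[of 1] this[of \<i>] show ?thesis
    by (simp add: complex_eq_iff sgn_eq algebra_simps)
qed

text \<open>The vertex coincides with one neighbour, at the origin, and \<open>b\<close> is the
  other neighbour. If \<open>b\<close> were not \<open>0\<close>, moving the vertex towards
  \<open>b\<close> with a sideways slope \<open>y\<close> would gain area at a rate proportional to
  \<open>y\<close>, while the broken line from \<open>0\<close> to \<open>b\<close> lengthens only
  at a rate of order \<open>y^2\<close>.\<close>

lemma critical_zero:
  assumes b: "cmod b < 1" 
    and G: "(G has_real_derivative l) (at (K + pdist 0 b))"
    and max: "\<And>e. cmod e < 1 \<Longrightarrow>
      parea e b - G (K + pdist 0 e + pdist e b) \<le> - G (K + pdist 0 b)"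
  shows "b = 0"
proof (rule ccontr)
  assume b0: "b \<noteq> 0"
  \<comment> \<open>The slope is small enough for
    \<open>\<bar>l\<bar> * (y^2 / 2) < cmod b * y\<close>, because
    \<open>cmod b = y * (\<bar>l\<bar> + 1)\<close>.\<close>
  define y where "y = cmod b / (\<bar>l\<bar> + 1)"
  have y: "y > 0" using b0 by (simp add: y_def)
  define u where "u = Complex 1 (- y)"
  define e where "e = sgn b * u"
  define q where "q = cmod e"
  have q: "q = sqrt (1 + y\<^sup>2)" using b0 by (simp add: q_def e_def u_def norm_mult norm_sgn complex_norm)
  have bb: "cnj b * sgn b = of_real (cmod b)"
    using b0 by (simp add: sgn_eq) (metis complex_norm_square mult.commute nonzero_mult_div_cancel_left norm_eq_zero of_real_eq_0_iff power2_eq_square times_divide_eq_right of_real_power)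
  have be: "cnj b * e = of_real (cmod b) * u" using bb by (simp add: e_def mult.assoc[symmetric])
  have eb: "cnj e * b = of_real (cmod b) * cnj u"
    using arg_cong[OF be, of cnj] by (simp add: mult.commute)
  \<comment> \<open>\<open>2 * artanh (t * q)\<close> agrees with the distance from \<open>0\<close>
    to \<open>t * e\<close> for \<open>t \<ge> 0\<close> only, but it is differentiable at
    \<open>0\<close>. An increase of \<open>F\<close> to the right of \<open>0\<close> already
    contradicts maximality.\<close>
  define F where "F t = parea (of_real t * e) b
       - G (K + 2 * artanh (t * q) + pdist b (of_real t * e))" for t
  have A: "((\<lambda>t. artanh (t * q)) has_real_derivative (1 / (1 - 0\<^sup>2)) * q) (at 0)"
    by (rule DERIV_chain2[where g = "\<lambda>t. t * q"])
      (auto intro!: artanh_real_has_field_derivative derivative_eq_intros)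
  have L: "((\<lambda>t. K + 2 * artanh (t * q) + pdist b (of_real t * e)) has_real_derivative
      (2 * q - 2 * Re (cnj b * e) / cmod b)) (at 0)"
    by (rule DERIV_cong[OF DERIV_add[OF DERIV_add[OF DERIV_const DERIV_cmult[OF A]] pdist_path_deriv]])
      (use b b0 in \<open>auto simp: diff_divide_distrib add_divide_distrib\<close>)
  have GL: "((\<lambda>t. G (K + 2 * artanh (t * q) + pdist b (of_real t * e))) has_real_derivative
      l * (2 * q - 2 * Re (cnj b * e) / cmod b)) (at 0)"
    by (rule DERIV_chain2[OF _ L]) (use G in \<open>simp add: pdist_commute\<close>)
  have F': "(F has_real_derivative 2 * Im (cnj e * b) - l * (2 * q - 2 * Re (cnj b * e) / cmod b)) (at 0)"
    unfolding F_def by (intro DERIV_diff parea_path_deriv GL)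
  have v: "2 * Im (cnj e * b) - l * (2 * q - 2 * Re (cnj b * e) / cmod b) = 2 * (cmod b * y - l * (q - 1))"
    using b0 unfolding be eb by (simp add: u_def algebra_simps)
  have "q - 1 \<le> y\<^sup>2 / 2" 
  proof -
    have "1 + y\<^sup>2 \<le> (1 + y\<^sup>2 / 2)\<^sup>2" by (simp add: power2_sum)
    then have "sqrt (1 + y\<^sup>2) \<le> 1 + y\<^sup>2 / 2" by (intro real_le_lsqrt) auto
    then show ?thesis using q by simp
  qed
  moreover have "q \<ge> 1" using q by simp
  ultimately have "l * (q - 1) \<le> \<bar>l\<bar> * (y\<^sup>2 / 2)"
    by (smt (verit, best) mult_left_mono mult_right_mono)
  also have "\<dots> < cmod b * y"
  proof -
    have "cmod b = y * (\<bar>l\<bar> + 1)" by (simp add: y_def)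
    then have "cmod b * y = y\<^sup>2 * (\<bar>l\<bar> + 1)" by (simp add: power2_eq_square)
    moreover have "y\<^sup>2 * (\<bar>l\<bar> + 1) > \<bar>l\<bar> * (y\<^sup>2 / 2)"
      using y by (simp add: algebra_simps add_nonneg_pos)
    ultimately show ?thesis by simp
  qed
  finally have pos: "0 < 2 * Im (cnj e * b) - l * (2 * q - 2 * Re (cnj b * e) / cmod b)"
    unfolding v by simp
  obtain d where d: "d > 0" "\<And>h. h > 0 \<Longrightarrow> h < d \<Longrightarrow> F 0 < F (0 + h)"
    using DERIV_pos_inc_right[OF F' pos] by auto
  have qp: "q > 0" using q \<open>q \<ge> 1\<close> by linarith
  define h where "h = min (d / 2) (1 / (2 * q))"
  have h: "h > 0" "h < d" "h * q < 1" using d(1) qp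
    by (auto simp: h_def min_def field_simps)
  have ch: "cmod (of_real h * e) = h * q" using h by (simp add: norm_mult q_def)
  have "F h \<le> F 0" using max[of "of_real h * e"] h ch
    by (simp add: F_def pdist_commute[of b]) (simp add: pdist_def ch)
  then show False using d(2)[OF h(1,2)] by simp
qed

lemma cmod_one_minus_cnj [simp]: "cmod (1 - a * cnj b) = cmod (1 - cnj a * b)"
  by (metis complex_cnj_cnj complex_cnj_diff complex_cnj_mult complex_cnj_one complex_mod_cnj)

lemma pdist_cnj [simp]: "pdist (cnj a) (cnj b) = pdist a b"
proof -
  have "cmod (cnj a - cnj b) = cmod (a - b)" by (metis complex_cnj_diff complex_mod_cnj)
  then show ?thesis by (simp add: pdist_def pdelta_def)
qed

lemma parea_cnj:
  assumes "cmod a < 1" "cmod b < 1" shows "parea (cnj a) (cnj b) = parea b a"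
  by (simp add: parea_def mult.commute)

text \<open>Separating \<open>a\<close> and \<open>b\<close> gives
  \<open>sgn b * (\<i> * cmod b - l) = sgn a * (l + \<i> * cmod a)\<close>. Moduli give
  \<open>(cmod b)^2 = (cmod a)^2\<close>; then \<open>b / a\<close> is determined by
  \<open>l\<close> and the common modulus, so the oriented angle is known and not just its
  cosine.\<close>

lemma critical_eq_norm:
  assumes "a \<noteq> 0" "b \<noteq> 0" "\<i> * (b - a) = of_real l * (sgn a + sgn b)"
  shows "cmod a = cmod b"
    and "b = (of_real l + \<i> * of_real (cmod a)) / (\<i> * of_real (cmod a) - of_real l) * a"
proof -
  have a: "a = of_real (cmod a) * sgn a" and b: "b = of_real (cmod b) * sgn b"
    using assms by (auto simp: sgn_eq)
  have e: "sgn b * (\<i> * of_real (cmod b) - of_real l) = sgn a * (of_real l + \<i> * of_real (cmod a))"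
  proof -
    have "\<i> * (of_real (cmod b) * sgn b - of_real (cmod a) * sgn a) = of_real l * (sgn a + sgn b)"
      unfolding a[symmetric] b[symmetric] by (rule assms(3))
    then show ?thesis by (simp add: algebra_simps)
  qed
  then have "cmod (sgn b) * cmod (\<i> * of_real (cmod b) - of_real l)
      = cmod (sgn a) * cmod (of_real l + \<i> * of_real (cmod a))"
    by (simp only: norm_mult[symmetric])
  then have "cmod (\<i> * of_real (cmod b) - of_real l) = cmod (of_real l + \<i> * of_real (cmod a))"
    using assms(1,2) by (simp add: norm_sgn)
  then have "(cmod (\<i> * of_real (cmod b) - of_real l))\<^sup>2 = (cmod (of_real l + \<i> * of_real (cmod a)))\<^sup>2"
    by simp
  then have "(cmod b)\<^sup>2 = (cmod a)\<^sup>2" by (simp add: cmod_def)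
  then show eq: "cmod a = cmod b" by simp
  have nz: "\<i> * of_real (cmod a) - of_real l \<noteq> 0" using assms by (simp add: complex_eq_iff)
  have "b * (\<i> * of_real (cmod a) - of_real l) = of_real (cmod b) * (sgn b * (\<i> * of_real (cmod b) - of_real l))"
    by (subst b) (simp add: eq)
  also have "\<dots> = a * (of_real l + \<i> * of_real (cmod a))"
    unfolding e by (subst (3) a) (simp add: eq)
  finally show "b = (of_real l + \<i> * of_real (cmod a)) / (\<i> * of_real (cmod a) - of_real l) * a"
    using nz by (simp add: field_simps)
qed

section \<open>Maximizing the area of a closed polygon\<close>

definition cyc_sum :: "nat \<Rightarrow> ('a \<Rightarrow> 'a \<Rightarrow> real) \<Rightarrow> (nat \<Rightarrow> 'a) \<Rightarrow> real" where
  "cyc_sum n F v = (\<Sum>i<n. F (v i) (v (Suc i mod n)))"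

lemma cyc_pred:
  fixes n j :: nat
  assumes "n \<ge> 3" "j < n"
  shows "Suc ((j + n - 1) mod n) mod n = j" "(j + n - 1) mod n \<noteq> j" "(j + n - 1) mod n < n"
    "Suc j mod n \<noteq> j" "Suc j mod n < n" "Suc j mod n \<noteq> (j + n - 1) mod n"
proof -
  have p: "(j + n - 1) mod n = (if j = 0 then n - 1 else j - 1)"
    using assms by (cases j) (auto simp: )
  have s: "Suc j mod n = (if j = n - 1 then 0 else Suc j)"
    using assms by (auto simp: mod_Suc)
  show "Suc ((j + n - 1) mod n) mod n = j" "(j + n - 1) mod n \<noteq> j" "(j + n - 1) mod n < n"
    "Suc j mod n \<noteq> j" "Suc j mod n < n" "Suc j mod n \<noteq> (j + n - 1) mod n"
    unfolding p s using assms by auto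
qed

lemma cyc_succ_eq_iff:
  fixes n j i :: nat
  assumes "n \<ge> 3" "j < n" "i < n"
  shows "Suc i mod n = j \<longleftrightarrow> i = (j + n - 1) mod n"
proof
  assume "Suc i mod n = j"
  then show "i = (j + n - 1) mod n"
    using assms by (cases "Suc i = n") (auto simp: mod_if)
next
  assume "i = (j + n - 1) mod n"
  then show "Suc i mod n = j" using cyc_pred[OF assms(1,2)] by simp
qed

text \<open>For \<open>n \<ge> 3\<close> a vertex, its predecessor and its successor are pairwise
  distinct, so exactly two summands refer to the vertex and each refers to it once.\<close>

lemma cyc_sum_update:
  assumes "n \<ge> 3" "j < n"
  shows "cyc_sum n F (v(j := e)) = F (v ((j + n - 1) mod n)) e + F e (v (Suc j mod n))
     + (\<Sum>i\<in>{..<n} - {j, (j + n - 1) mod n}. F (v i) (v (Suc i mod n)))"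
proof -
  let ?p = "(j + n - 1) mod n" and ?u = "v(j := e)"
  note c = cyc_pred[OF assms]
  have "cyc_sum n F ?u = (\<Sum>i\<in>{..<n} - {j, ?p}. F (?u i) (?u (Suc i mod n)))
      + (\<Sum>i\<in>{j, ?p}. F (?u i) (?u (Suc i mod n)))"
    unfolding cyc_sum_def using assms c by (intro sum.subset_diff) auto
  also have "(\<Sum>i\<in>{j, ?p}. F (?u i) (?u (Suc i mod n))) = F e (v (Suc j mod n)) + F (v ?p) e"
    using c by (simp add: eq_commute[of j])
  also have "(\<Sum>i\<in>{..<n} - {j, ?p}. F (?u i) (?u (Suc i mod n)))
     = (\<Sum>i\<in>{..<n} - {j, ?p}. F (v i) (v (Suc i mod n)))"
    by (rule sum.cong) (use cyc_succ_eq_iff[OF assms] in auto)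
  finally show ?thesis by (simp only: ac_simps)
qed

lemma sum_cyc_shift: "n > 0 \<Longrightarrow> (\<Sum>i<n. f (Suc i mod n)) = (\<Sum>i<n. f i :: 'a :: comm_monoid_add)"
proof -
  assume "n > 0"
  then obtain m where n: "n = Suc m" by (cases n) auto
  have "(\<Sum>i<n. f (Suc i mod n)) = (\<Sum>i<m. f (Suc i)) + f 0"
    unfolding n by simp
  also have "\<dots> = (\<Sum>i<n. f i)" unfolding n by (subst sum.lessThan_Suc_shift) (simp add: add.commute)
  finally show ?thesis .
qed

lemma cyc_sum_parea_pinv:
  assumes "n > 0" "cmod w < 1" "\<And>i. i < n \<Longrightarrow> cmod (v i) < 1"
  shows "cyc_sum n parea (\<lambda>i. pinv w (v i)) = cyc_sum n parea v"
proof -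
  have "cyc_sum n parea (\<lambda>i. pinv w (v i))
      = (\<Sum>i<n. parea (v i) (v (Suc i mod n)) - parea (v i) w + parea (v (Suc i mod n)) w)"
    unfolding cyc_sum_def by (intro sum.cong refl parea_pinv) (use assms in auto)
  also have "\<dots> = cyc_sum n parea v"
    using sum_cyc_shift[OF assms(1), of "\<lambda>i. parea (v i) w"]
    by (simp add: sum.distrib sum_subtractf cyc_sum_def)
  finally show ?thesis .
qed

lemma cyc_sum_pdist_pinv:
  assumes "cmod w < 1" "\<And>i. i < n \<Longrightarrow> cmod (v i) < 1"
  shows "cyc_sum n pdist (\<lambda>i. pinv w (v i)) = cyc_sum n pdist v"
  unfolding cyc_sum_def by (intro sum.cong refl pdist_pinv) (use assms in auto)

lemma cyc_sum_cong:
  assumes "\<And>i. i < n \<Longrightarrow> u i = v i"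
  shows "cyc_sum n F u = cyc_sum n F v"
  unfolding cyc_sum_def by (intro sum.cong refl arg_cong2[where f = F] assms) auto

section \<open>Compactness and existence of a maximizer\<close>

lemma cyc_sum_pdist_nonneg:
  "(\<And>i. i < n \<Longrightarrow> cmod (v i) < 1) \<Longrightarrow> cyc_sum n pdist v \<ge> 0"
  unfolding cyc_sum_def by (intro sum_nonneg pdist_nonneg) auto

text \<open>Induction along the chain: a point at hyperbolic distance at most \<open>B\<close> from
  the disc of radius \<open>r\<close> has modulus at most some \<open>s < 1\<close>. What matters is
  that the final radius is uniform over all chains.\<close>

lemma sides_bounded_imp_bounded:
  fixes B :: real and m :: nat
  shows "\<exists>r. 0 \<le> r \<and> r < 1 \<and> (\<forall>v. (\<forall>i\<le>m. cmod (v i) < 1) \<longrightarrow> v 0 = 0 \<longrightarrow>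
     (\<forall>i<m. pdist (v i) (v (Suc i)) \<le> B) \<longrightarrow> (\<forall>i\<le>m. cmod (v i) \<le> r))"
proof (induction m)
  case 0
  show ?case by (rule exI[of _ 0]) auto
next
  case (Suc m)
  then obtain r where r: "0 \<le> r" "r < 1" and IH: "\<And>v. (\<forall>i\<le>m. cmod (v i) < 1) \<Longrightarrow> v 0 = 0 \<Longrightarrow>
     (\<forall>i<m. pdist (v i) (v (Suc i)) \<le> B) \<Longrightarrow> (\<forall>i\<le>m. cmod (v i) \<le> r)" by auto
  define \<tau> where "\<tau> = tanh (max B 0 / 2)"
  have \<tau>: "0 \<le> \<tau>" "\<tau> < 1" by (auto simp: \<tau>_def tanh_real_lt_1)
  \<comment> \<open>From \<open>pdelta_sq\<close> with \<open>pdelta \<le> \<tau>\<close> and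
    \<open>cmod (1 - cnj a * b) \<ge> 1 - r\<close> one gets
    \<open>1 - (cmod b)^2 \<ge> (1 - \<tau>^2) * (1 - r)^2\<close>.\<close>
  define s where "s = sqrt (1 - (1 - \<tau>\<^sup>2) * (1 - r)\<^sup>2)"
  have t2: "0 < 1 - \<tau>\<^sup>2" "1 - \<tau>\<^sup>2 \<le> 1" using \<tau> by (auto simp: abs_square_less_1)
  have r2: "0 < (1 - r)\<^sup>2" "(1 - r)\<^sup>2 \<le> 1" using r by (auto simp: power_le_one)
  have "(1 - \<tau>\<^sup>2) * (1 - r)\<^sup>2 \<le> 1" using mult_mono[OF t2(2) r2(2)] by simp
  moreover have "(1 - \<tau>\<^sup>2) * (1 - r)\<^sup>2 > 0" using t2 r2 by simp
  ultimately have s: "0 \<le> s" "s < 1" by (auto simp: s_def)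
  show ?case
  proof (rule exI[of _ "max r s"], intro conjI allI impI)
    fix v :: "nat \<Rightarrow> complex" and i
    assume v: "\<forall>i\<le>Suc m. cmod (v i) < 1" "v 0 = 0" "\<forall>i<Suc m. pdist (v i) (v (Suc i)) \<le> B" and i: "i \<le> Suc m"
    have le: "\<forall>i\<le>m. cmod (v i) \<le> r" using v by (intro IH) auto
    let ?a = "v m" and ?b = "v (Suc m)"
    have a: "cmod ?a < 1" "cmod ?b < 1" "cmod ?a \<le> r" using v le by auto
    have "pdelta ?a ?b \<le> \<tau>" unfolding tanh_pdist[OF a(1,2), symmetric] \<tau>_def
      using v(3) by (simp add: le_max_iff_disj)
    then have "(pdelta ?a ?b)\<^sup>2 \<le> \<tau>\<^sup>2" using pdelta_nonneg by (intro power_mono) auto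
    then have "1 - \<tau>\<^sup>2 \<le> (1 - (cmod ?a)\<^sup>2) * (1 - (cmod ?b)\<^sup>2) / (cmod (1 - cnj ?a * ?b))\<^sup>2"
      using pdelta_sq[OF a(1,2)] by linarith
    moreover have "(cmod (1 - cnj ?a * ?b))\<^sup>2 > 0" using pker_nz[OF a(1,2)] by simp
    ultimately have 1: "(1 - \<tau>\<^sup>2) * (cmod (1 - cnj ?a * ?b))\<^sup>2 \<le> (1 - (cmod ?a)\<^sup>2) * (1 - (cmod ?b)\<^sup>2)"
      by (simp add: pos_le_divide_eq)
    have "cmod (cnj ?a * ?b) \<le> r * 1" unfolding norm_mult using a r by (intro mult_mono) auto
    then have "1 - r \<le> cmod (1 - cnj ?a * ?b)"
      using norm_triangle_ineq2[of 1 "cnj ?a * ?b"] by simp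
    then have "(1 - r)\<^sup>2 \<le> (cmod (1 - cnj ?a * ?b))\<^sup>2" using r by (intro power_mono) auto
    then have "(1 - \<tau>\<^sup>2) * (1 - r)\<^sup>2 \<le> (1 - \<tau>\<^sup>2) * (cmod (1 - cnj ?a * ?b))\<^sup>2"
      using t2 by (intro mult_left_mono) auto
    also note 1
    also have "(1 - (cmod ?a)\<^sup>2) * (1 - (cmod ?b)\<^sup>2) \<le> 1 * (1 - (cmod ?b)\<^sup>2)"
      using disc_sq[OF a(2)] by (intro mult_right_mono) auto
    finally have "(cmod ?b)\<^sup>2 \<le> 1 - (1 - \<tau>\<^sup>2) * (1 - r)\<^sup>2" by simp
    then have "cmod ?b \<le> s" unfolding s_def by (rule real_le_rsqrt)
    then show "cmod (v i) \<le> max r s" using le i by (cases "i = Suc m") (auto simp: le_max_iff_disj)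
  qed (use r s in auto)
qed

text \<open>Tuples are functions on all of \<open>nat\<close>, so the coordinates from
  \<open>n\<close> on are frozen at \<open>0\<close>; the set is then a product of compact
  sets.\<close>

lemma compact_cball_product:
  fixes r :: real
  shows "compact {v :: nat \<Rightarrow> complex. \<forall>i. v i \<in> (if i < n then cball 0 r else {0})}"
proof -
  have "{v :: nat \<Rightarrow> complex. \<forall>i. v i \<in> (if i < n then cball 0 r else {0})}
     = PiE UNIV (\<lambda>i. if i < n then cball 0 r else {0})" by (auto simp: PiE_def Pi_def)
  moreover have "compactin (product_topology (\<lambda>i. euclidean) UNIV) (PiE UNIV (\<lambda>i::nat. if i < n then cball (0::complex) r else {0}))"
    unfolding compactin_PiE by (auto simp: compactin_euclidean_iff)
  ultimately show ?thesis by (simp add: euclidean_product_topology)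
qed

lemma continuous_on_cyc_sum:
  assumes "\<And>v i. v \<in> K \<Longrightarrow> i < n \<Longrightarrow> cmod (v i) < 1"
  shows "continuous_on K (cyc_sum n parea)" "continuous_on K (cyc_sum n pdist)"
proof -
  have c: "continuous_on K (\<lambda>v. v i)" for i :: nat
    by (rule continuous_on_product_coordinates[THEN continuous_on_subset]) auto
  have "continuous_on K (\<lambda>v. parea (v i) (v (Suc i mod n)))" if "i < n" for i
  proof -
    have "1 - cnj (v i) * v (Suc i mod n) \<notin> \<real>\<^sub>\<le>\<^sub>0" if "v \<in> K" for v
      using pker_Re_pos[of "v i" "v (Suc i mod n)"] assms[OF that] \<open>i < n\<close>
      by (auto simp: complex_nonpos_Reals_iff)
    then show ?thesis unfolding parea_def by (intro continuous_intros c) auto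
  qed
  then show "continuous_on K (cyc_sum n parea)" unfolding cyc_sum_def by (intro continuous_intros) auto
  have "continuous_on K (\<lambda>v. pdelta (v i) (v (Suc i mod n)))" if "i < n" for i
    unfolding pdelta_def using that assms pker_nz by (intro continuous_intros c) auto
  moreover have "pdelta (v i) (v (Suc i mod n)) < 1" if "i < n" "v \<in> K" for i v
    using that assms by (intro pdelta_less1) auto
  moreover have "-1 < pdelta (v i) (v (Suc i mod n))" for i and v :: "nat \<Rightarrow> complex"
    using pdelta_nonneg[of "v i"] by (smt (verit))
  ultimately have "continuous_on K (\<lambda>v. pdist (v i) (v (Suc i mod n)))" if "i < n" for i
    unfolding pdist_def using that
    by (intro continuous_on_mult continuous_on_const
        continuous_on_compose2[OF continuous_on_artanh[of "{-1<..<1}"]]) auto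
  then show "continuous_on K (cyc_sum n pdist)" unfolding cyc_sum_def by (intro continuous_intros) auto
qed

text \<open>The objective is invariant under \<open>pinv\<close>, so the first vertex may be moved
  to \<open>0\<close>. Wherever the objective is positive, the growth of \<open>G\<close> bounds the
  perimeter, and the tuple lies in a compact set; the given \<open>v\<close> shows that positive
  values occur.\<close>

lemma maximizer_exists:
  fixes G :: "real \<Rightarrow> real"
  assumes n: "n \<ge> 3" and \<eta>: "\<eta> > 0" and cG: "continuous_on {0..} G"
    and G: "\<And>x. x \<ge> 0 \<Longrightarrow> G x \<ge> \<eta> * x"
    and v: "\<And>i. i < n \<Longrightarrow> cmod (v i) < 1" "cyc_sum n parea v > G (cyc_sum n pdist v)"
  obtains z where "\<And>i. i < n \<Longrightarrow> cmod (z i) < 1"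
    "cyc_sum n parea z > G (cyc_sum n pdist z)"
    "\<And>u. (\<And>i. i < n \<Longrightarrow> cmod (u i) < 1) \<Longrightarrow>
       cyc_sum n parea u - G (cyc_sum n pdist u) \<le> cyc_sum n parea z - G (cyc_sum n pdist z)"
proof -
  define H where "H u = cyc_sum n parea u - G (cyc_sum n pdist u)" for u
  \<comment> \<open>Each side contributes at most \<open>pi\<close> to the signed area, so a
    positive objective forces \<open>\<eta> * L \<le> n * pi\<close> for the perimeter
    \<open>L\<close>.\<close>
  define B where "B = real n * pi / \<eta>"
  obtain r where r: "0 \<le> r" "r < 1" and rb: "\<And>v. (\<forall>i\<le>n-1. cmod (v i) < 1) \<Longrightarrow> v 0 = 0 \<Longrightarrow>
     (\<forall>i<n-1. pdist (v i) (v (Suc i)) \<le> B) \<Longrightarrow> (\<forall>i\<le>n-1. cmod (v i) \<le> r)"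
    using sides_bounded_imp_bounded[of "n-1" B] by auto
  define K where "K = {v :: nat \<Rightarrow> complex. \<forall>i. v i \<in> (if i < n then cball 0 r else {0})}"
  have Kd: "cmod (u i) < 1" if "u \<in> K" "i < n" for u i
    using that r by (auto simp: K_def dest!: spec[of _ i])
  have norm: "\<exists>u'\<in>K. H u' = H u" if u: "\<And>i. i < n \<Longrightarrow> cmod (u i) < 1" and pos: "H u > 0" for u
  proof -
    define w where "w i = (if i < n then pinv (u 0) (u i) else 0)" for i
    have u0: "cmod (u 0) < 1" using u n by simp
    have wd: "cmod (w i) < 1" for i using u u0 by (auto simp: w_def intro: pinv_bound)
    have e: "cyc_sum n F w = cyc_sum n F (\<lambda>i. pinv (u 0) (u i))" for F :: "complex \<Rightarrow> complex \<Rightarrow> real"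
      by (rule cyc_sum_cong) (simp add: w_def)
    have eS: "cyc_sum n parea w = cyc_sum n parea u" and eL: "cyc_sum n pdist w = cyc_sum n pdist u"
      unfolding e using u u0 n by (auto intro!: cyc_sum_parea_pinv cyc_sum_pdist_pinv)
    have Hw: "H w = H u" by (simp add: H_def eS eL)
    have L0: "cyc_sum n pdist w \<ge> 0" using wd by (intro cyc_sum_pdist_nonneg)
    have "cyc_sum n parea w \<le> (\<Sum>i<n. pi)" unfolding cyc_sum_def
      by (intro sum_mono) (use parea_bound wd in \<open>meson abs_le_D1 less_imp_le\<close>)
    then have "\<eta> * cyc_sum n pdist w \<le> real n * pi"
      using pos G[OF L0] by (simp add: H_def eS eL)
    then have LB: "cyc_sum n pdist w \<le> B" using \<eta> by (simp add: B_def field_simps)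
    have "pdist (w i) (w (Suc i)) \<le> B" if "i < n - 1" for i
    proof -
      have "pdist (w i) (w (Suc i mod n)) \<le> cyc_sum n pdist w"
        unfolding cyc_sum_def using that wd by (intro member_le_sum) (auto intro: pdist_nonneg)
      then show ?thesis using LB that by simp
    qed
    then have "\<forall>i\<le>n-1. cmod (w i) \<le> r" using wd by (intro rb) (auto simp: w_def n)
    then have "cmod (w i) \<le> r" if "i < n" for i using that n by simp
    moreover have "w i = 0" if "\<not> i < n" for i using that by (simp add: w_def)
    ultimately have "w \<in> K" by (simp add: K_def)
    with Hw show ?thesis by blast
  qed
  have "continuous_on K H" unfolding H_def
  proof (intro continuous_intros continuous_on_cyc_sum)
    show "continuous_on K (\<lambda>x. G (cyc_sum n pdist x))"
      by (rule continuous_on_compose2[OF cG continuous_on_cyc_sum(2)])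
        (use Kd in \<open>auto intro: cyc_sum_pdist_nonneg\<close>)
  qed (use Kd in auto)
  moreover obtain u0 where u0: "u0 \<in> K" "H u0 = H v" using norm[of v] v by (auto simp: H_def)
  ultimately obtain z where z: "z \<in> K" "\<And>y. y \<in> K \<Longrightarrow> H y \<le> H z"
    using continuous_attains_sup[of K H] compact_cball_product[of n r] unfolding K_def by blast
  have Hz: "H z > 0" using z(2)[OF u0(1)] u0(2) v(2) by (simp add: H_def)
  show thesis
  proof (rule that[of z])
    show "cmod (z i) < 1" if "i < n" for i using Kd z(1) that by blast
    show "cyc_sum n parea z > G (cyc_sum n pdist z)" using Hz by (simp add: H_def)
    fix u :: "nat \<Rightarrow> complex" assume u: "\<And>i. i < n \<Longrightarrow> cmod (u i) < 1"
    have "H u \<le> H z"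
    proof (cases "H u > 0")
      case True
      then obtain u' where "u' \<in> K" "H u' = H u" using norm[of u] u by blast
      then show ?thesis using z(2) by metis
    qed (use Hz in linarith)
    then show "cyc_sum n parea u - G (cyc_sum n pdist u) \<le> cyc_sum n parea z - G (cyc_sum n pdist z)"
      by (simp add: H_def)
  qed
qed

text \<open>Every vertex in turn is moved to the origin, where the variation applies with one and
  the same \<open>l\<close>, the derivative of \<open>G\<close> at the total length. The side
  leaving a vertex is the side arriving at the next one, so the equality of adjacent sides
  propagates to one common \<open>\<rho>\<close>; the multiplier \<open>\<kappa>\<close> depends on
  \<open>l\<close> and \<open>\<rho>\<close> alone.\<close>

lemma maximizer_rigid:
  assumes n: "n \<ge> 3" and z: "\<And>i. i < n \<Longrightarrow> cmod (z i) < 1"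
    and max: "\<And>u. (\<And>i. i < n \<Longrightarrow> cmod (u i) < 1) \<Longrightarrow>
       cyc_sum n parea u - G (cyc_sum n pdist u) \<le> cyc_sum n parea z - G (cyc_sum n pdist z)"
    and G: "(G has_real_derivative l) (at (cyc_sum n pdist z))"
    and nz: "\<exists>i<n. z i \<noteq> z (Suc i mod n)"
  obtains \<rho> \<kappa> where "\<rho> > 0"
    "\<And>j. j < n \<Longrightarrow> cmod (pinv (z j) (z (Suc j mod n))) = \<rho>"
    "\<And>j. j < n \<Longrightarrow> pinv (z j) (z (Suc j mod n)) = \<kappa> * pinv (z j) (z ((j + n - 1) mod n))"
proof -
  define a where "a j = pinv (z j) (z ((j + n - 1) mod n))" for j
  define b where "b j = pinv (z j) (z (Suc j mod n))" for j
  have ab1: "cmod (a j) < 1" "cmod (b j) < 1" if "j < n" for j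
    using z cyc_pred[OF n that] that by (auto simp: a_def b_def intro!: pinv_bound)
  have cb: "cmod (b j) = pdelta (z j) (z (Suc j mod n))" if "j < n" for j
    by (simp add: b_def pinv_def pdelta_def norm_divide)
  have ca: "cmod (a j) = pdelta (z ((j + n - 1) mod n)) (z j)" if "j < n" for j
    unfolding pdelta_commute[of _ "z j"] by (simp add: a_def pinv_def pdelta_def norm_divide)
  have crit: "(a j = 0 \<longleftrightarrow> b j = 0) \<and> (a j \<noteq> 0 \<longrightarrow> b j \<noteq> 0 \<longrightarrow> \<i> * (b j - a j) = of_real l * (sgn (a j) + sgn (b j)))"
    if j: "j < n" for j
  proof -
    define v where "v i = pinv (z j) (z i)" for i
    have vj: "v j = 0" by (simp add: v_def)
    have va: "v ((j + n - 1) mod n) = a j" and vb: "v (Suc j mod n) = b j" by (simp_all add: v_def a_def b_def)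
    have vd: "cmod (v i) < 1" if "i < n" for i using that z j by (auto simp: v_def intro: pinv_bound)
    have eS: "cyc_sum n parea v = cyc_sum n parea z" and eL: "cyc_sum n pdist v = cyc_sum n pdist z"
      unfolding v_def using z j n by (auto intro!: cyc_sum_parea_pinv cyc_sum_pdist_pinv)
    define R where "R F = (\<Sum>i\<in>{..<n} - {j, (j + n - 1) mod n}. F (v i) (v (Suc i mod n)))" for F :: "complex \<Rightarrow> complex \<Rightarrow> real"
    have up: "cyc_sum n F (v(j := e)) = R F + F (a j) e + F e (b j)" for F :: "complex \<Rightarrow> complex \<Rightarrow> real" and e
      unfolding cyc_sum_update[OF n j, of F v e] va vb R_def by (simp only: ac_simps)
    have up0: "cyc_sum n F v = R F + F (a j) 0 + F 0 (b j)" for F :: "complex \<Rightarrow> complex \<Rightarrow> real"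
      using up[of F 0] vj by (metis fun_upd_triv)
    have m: "parea (a j) e + parea e (b j) - G (R pdist + pdist (a j) e + pdist e (b j))
        \<le> - G (R pdist + pdist (a j) 0 + pdist 0 (b j))" if "cmod e < 1" for e
    proof -
      have "cyc_sum n parea (v(j := e)) - G (cyc_sum n pdist (v(j := e))) \<le> cyc_sum n parea z - G (cyc_sum n pdist z)"
        by (rule max) (use vd that in auto)
      then show ?thesis unfolding eS[symmetric] eL[symmetric] up up0 by simp
    qed
    have G': "(G has_real_derivative l) (at (R pdist + pdist (a j) 0 + pdist 0 (b j)))"
      using G unfolding eL[symmetric] up0 .
    have 1: "\<i> * (b j - a j) = of_real l * (sgn (a j) + sgn (b j))" if "a j \<noteq> 0" "b j \<noteq> 0"
      using critical_pair[OF ab1[OF j] that G' m] .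
    have 2: "b j = 0" if a0: "a j = 0"
    proof (rule critical_zero[OF ab1(2)[OF j]])
      show "(G has_real_derivative l) (at (R pdist + pdist 0 (b j)))" using G' a0 by simp
      show "parea e (b j) - G (R pdist + pdist 0 e + pdist e (b j)) \<le> - G (R pdist + pdist 0 (b j))" if "cmod e < 1" for e
        using m[OF that] a0 by simp
    qed
    \<comment> \<open>Conjugation combined with exchanging the order of the points preserves
      \<open>parea\<close>, so \<open>critical_zero\<close> applies to the other neighbour as
      well.\<close>
    have 3: "cnj (a j) = 0" if b0: "b j = 0"
    proof (rule critical_zero)
      show "cmod (cnj (a j)) < 1" using ab1(1)[OF j] by simp
      have e: "pdist 0 (cnj (a j)) = pdist (a j) 0" using pdist_cnj[of 0 "a j"] by (simp add: pdist_commute)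
      show "(G has_real_derivative l) (at (R pdist + pdist 0 (cnj (a j))))" using G' b0 by (simp add: e)
      fix e assume e1: "cmod e < 1"
      have p: "parea e (cnj (a j)) = parea (a j) (cnj e)" using parea_cnj[of "cnj e" "a j"] ab1(1)[OF j] e1 by simp
      have q: "pdist e (cnj (a j)) = pdist (a j) (cnj e)" using pdist_cnj[of "cnj e" "a j"] by (simp add: pdist_commute)
      have r: "pdist 0 e = pdist (cnj e) 0" using pdist_cnj[of 0 "e"] by (simp add: pdist_commute)
      show "parea e (cnj (a j)) - G (R pdist + pdist 0 e + pdist e (cnj (a j))) \<le> - G (R pdist + pdist 0 (cnj (a j)))"
        using m[of "cnj e"] e1 b0 unfolding p q r e by (simp add: add_ac)
    qed
    show ?thesis using 1 2 3 by auto
  qed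
  have eq: "cmod (a j) = cmod (b j)" if "j < n" for j
    using crit[OF that] critical_eq_norm(1)[of "a j" "b j" l] by (cases "a j = 0") auto
  define \<rho> where "\<rho> = cmod (b 0)"
  have step: "cmod (b (Suc j)) = cmod (b j)" if "Suc j < n" for j
    using eq[OF that] ca[OF that] cb[of j] that by simp
  have rho: "cmod (b j) = \<rho>" if "j < n" for j
    using that by (induction j) (auto simp: \<rho>_def step)
  obtain i where i: "i < n" "z i \<noteq> z (Suc i mod n)" using nz by auto
  have "cmod (b i) \<noteq> 0" using cb[OF i(1)] i pdelta_eq_0[of "z i" "z (Suc i mod n)"] z cyc_pred[OF n i(1)] by simp
  then have pos: "\<rho> > 0" using rho[OF i(1)] by (metis norm_ge_zero order_le_less)
  show thesis
  proof (rule that[OF pos])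
    show "cmod (pinv (z j) (z (Suc j mod n))) = \<rho>" if "j < n" for j
      using rho[OF that] by (simp add: b_def)
    show "pinv (z j) (z (Suc j mod n)) = ((of_real l + \<i> * of_real \<rho>) / (\<i> * of_real \<rho> - of_real l)) * pinv (z j) (z ((j + n - 1) mod n))"
      if "j < n" for j
    proof -
      have "a j \<noteq> 0" "b j \<noteq> 0" using eq[OF that] rho[OF that] pos by auto
      then have "b j = ((of_real l + \<i> * of_real \<rho>) / (\<i> * of_real \<rho> - of_real l)) * a j"
        using critical_eq_norm(2)[of "a j" "b j" l] crit[OF that] eq[OF that] rho[OF that] by simp
      then show ?thesis by (simp add: a_def b_def)
    qed
  qed
qed

section \<open>Disc automorphisms as matrices of SU(1,1) up to scaling, and their orbits\<close>

definition paut :: "(complex \<Rightarrow> complex) \<Rightarrow> bool" where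
  "paut f \<longleftrightarrow> (\<exists>p q. cmod q < cmod p \<and> (\<forall>z. cmod z < 1 \<longrightarrow> f z = (p * z + q) / (cnj q * z + cnj p)))"

lemma paut_denom_nz:
  assumes "cmod q < cmod p" "cmod z < 1" shows "cnj q * z + cnj p \<noteq> 0"
proof
  assume "cnj q * z + cnj p = 0"
  then have "cnj p = - (cnj q * z)" by (simp add: add_eq_0_iff)
  then have "cmod p = cmod q * cmod z" by (metis complex_mod_cnj norm_minus_cancel norm_mult)
  also have "\<dots> \<le> cmod q * 1" using assms by (intro mult_left_mono) auto
  finally show False using assms by simp
qed

lemma paut_denom_identity:
  "(cmod (cnj q * z + cnj p))\<^sup>2 - (cmod (p * z + q))\<^sup>2 = ((cmod p)\<^sup>2 - (cmod q)\<^sup>2) * (1 - (cmod z)\<^sup>2)"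
  unfolding cmod_power2 by (simp add: algebra_simps power2_eq_square)

lemma paut_disc:
  assumes "paut f" "cmod z < 1" shows "cmod (f z) < 1"
proof -
  obtain p q where pq: "cmod q < cmod p" "f z = (p * z + q) / (cnj q * z + cnj p)"
    using assms by (auto simp: paut_def)
  have "(cmod q)\<^sup>2 < (cmod p)\<^sup>2" using pq by (intro power_strict_mono) auto
  then have "(cmod (p * z + q))\<^sup>2 < (cmod (cnj q * z + cnj p))\<^sup>2"
    using paut_denom_identity[of q z p] disc_sq[OF assms(2)]
    by (smt (verit) mult_pos_pos)
  then have "cmod (p * z + q) < cmod (cnj q * z + cnj p)" by (rule power_less_imp_less_base) simp
  then show ?thesis unfolding pq by (simp add: norm_divide divide_less_eq_1)
qed

lemma paut_pinv: "cmod w < 1 \<Longrightarrow> paut (pinv w)"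
  unfolding paut_def
\<comment> \<open>Multiplying numerator and denominator by \<open>\<i>\<close> brings the matrix of
  \<open>pinv w\<close> into the required conjugate-symmetric form.\<close>
proof (rule exI[of _ "- \<i>"], rule exI[of _ "\<i> * w"], intro conjI allI impI)
  fix z assume "cmod w < 1" "cmod z < 1"
  have "- \<i> * z + \<i> * w = \<i> * (w - z)" "cnj (\<i> * w) * z + cnj (- \<i>) = \<i> * (1 - cnj w * z)"
    by (simp_all add: algebra_simps)
  then show "pinv w z = (- \<i> * z + \<i> * w) / (cnj (\<i> * w) * z + cnj (- \<i>))"
    by (simp only: pinv_def) simp
qed (simp add: norm_mult)

lemma paut_rot: 
  assumes "cmod u = 1" shows "paut (\<lambda>z. u * z)"
  unfolding paut_def
\<comment> \<open>With \<open>q = 0\<close> the map is multiplication by \<open>p / cnj p\<close>,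
  which is \<open>p^2\<close> when \<open>cmod p = 1\<close>; hence the square root.\<close>
proof (rule exI[of _ "csqrt u"], rule exI[of _ 0], intro conjI allI impI)
  have c: "csqrt u * csqrt u = u" by (metis power2_csqrt power2_eq_square)
  have "cmod (csqrt u) = 1" using assms by (simp add: norm_csqrt)
  then have "csqrt u * cnj (csqrt u) = 1" using complex_norm_square[of "csqrt u"] by simp
  moreover fix z assume "cmod z < 1"
  ultimately have "u * z * cnj (csqrt u) = csqrt u * z" using c
    by (metis mult.assoc mult.commute mult.right_neutral)
  moreover have "cnj (csqrt u) \<noteq> 0" using assms by auto
  ultimately show "u * z = (csqrt u * z + 0) / (cnj 0 * z + cnj (csqrt u))" by (simp add: field_simps)
qed (use assms in auto)

lemma paut_comp:
  assumes "paut f" "paut g" shows "paut (\<lambda>z. f (g z))"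
proof -
  obtain p q where f: "cmod q < cmod p" "\<And>z. cmod z < 1 \<Longrightarrow> f z = (p * z + q) / (cnj q * z + cnj p)"
    using assms by (auto simp: paut_def)
  obtain r s where g: "cmod s < cmod r" "\<And>z. cmod z < 1 \<Longrightarrow> g z = (r * z + s) / (cnj s * z + cnj r)"
    using assms by (auto simp: paut_def)
  let ?P = "p * r + q * cnj s" and ?Q = "p * s + q * cnj r"
  have "(cmod q)\<^sup>2 < (cmod p)\<^sup>2" "(cmod s)\<^sup>2 < (cmod r)\<^sup>2" using f(1) g(1) by (auto intro: power_strict_mono)
  moreover have "(cmod ?P)\<^sup>2 - (cmod ?Q)\<^sup>2 = ((cmod p)\<^sup>2 - (cmod q)\<^sup>2) * ((cmod r)\<^sup>2 - (cmod s)\<^sup>2)"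
    unfolding cmod_power2 by (simp add: algebra_simps power2_eq_square)
  ultimately have "(cmod ?Q)\<^sup>2 < (cmod ?P)\<^sup>2" by (smt (verit) mult_pos_pos)
  then have "cmod ?Q < cmod ?P" by (rule power_less_imp_less_base) simp
  moreover have "f (g z) = (?P * z + ?Q) / (cnj ?Q * z + cnj ?P)" if z: "cmod z < 1" for z
  proof -
    have n1: "cnj s * z + cnj r \<noteq> 0" by (rule paut_denom_nz[OF g(1) z])
    have "f (g z) = (p * g z + q) / (cnj q * g z + cnj p)" using f(2)[OF paut_disc[OF assms(2) z]] .
    also have "p * g z + q = (?P * z + ?Q) / (cnj s * z + cnj r)"
      unfolding g(2)[OF z] using n1 by (simp add: field_simps)
    also have "cnj q * g z + cnj p = (cnj ?Q * z + cnj ?P) / (cnj s * z + cnj r)"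
      unfolding g(2)[OF z] using n1 by (simp add: field_simps)
    finally show ?thesis using n1 by simp
  qed
  ultimately show ?thesis unfolding paut_def by blast
qed

lemma paut_fix0:
  assumes "paut f" "f 0 = 0"
  obtains u where "cmod u = 1" "\<And>z. cmod z < 1 \<Longrightarrow> f z = u * z"
proof -
  obtain p q where f: "cmod q < cmod p" "\<And>z. cmod z < 1 \<Longrightarrow> f z = (p * z + q) / (cnj q * z + cnj p)"
    using assms by (auto simp: paut_def)
  have "q = 0" using f(2)[of 0] assms(2) f(1) by auto
  then have "f z = (p / cnj p) * z" if "cmod z < 1" for z using f(2)[OF that] by simp
  moreover have "cmod (p / cnj p) = 1" using f(1) by (simp add: norm_divide) (auto simp: \<open>q = 0\<close>)
  ultimately show ?thesis using that by blast
qed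

text \<open>Recentred at \<open>z\<close> in the source and at \<open>f z\<close> in the target,
  \<open>f\<close> becomes an automorphism fixing \<open>0\<close>, that is, a rotation. Ratios such
  as the multiplier \<open>\<kappa>\<close> at a vertex are therefore carried along by
  \<open>f\<close>.\<close>

lemma paut_conj:
  assumes "paut f" "cmod z < 1"
  obtains u where "cmod u = 1" "\<And>x. cmod x < 1 \<Longrightarrow> pinv (f z) (f x) = u * pinv z x"
proof -
  have fz: "cmod (f z) < 1" by (rule paut_disc[OF assms])
  have "paut (\<lambda>x. pinv (f z) (f (pinv z x)))"
    by (rule paut_comp[OF paut_pinv[OF fz] paut_comp[OF assms(1) paut_pinv[OF assms(2)]]])
  then obtain u where u: "cmod u = 1" "\<And>x. cmod x < 1 \<Longrightarrow> pinv (f z) (f (pinv z x)) = u * x"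
    by (rule paut_fix0) simp_all
  have "pinv (f z) (f x) = u * pinv z x" if "cmod x < 1" for x
    using u(2)[OF pinv_bound[OF assms(2) that]] assms(2) that by simp
  then show ?thesis using that u(1) by blast
qed

text \<open>The map \<open>f\<close> is built to take \<open>Z 0\<close>, \<open>Z 1\<close> to
  \<open>Z 1\<close>, \<open>Z 2\<close>, which is possible since both pairs have the same distance.
  Once \<open>f\<close> shifts two consecutive vertices, the equal multiplier
  \<open>\<kappa>\<close> at the next vertex makes it shift the third as well.\<close>

lemma equiangular_orbit:
  assumes Z: "\<And>i. cmod (Z i) < 1" and \<rho>: "\<rho> > 0" "\<And>i. cmod (pinv (Z (Suc i)) (Z i)) = \<rho>" "\<And>i. cmod (pinv (Z i) (Z (Suc i))) = \<rho>"
    and \<kappa>: "\<And>i. pinv (Z (Suc i)) (Z (Suc (Suc i))) = \<kappa> * pinv (Z (Suc i)) (Z i)"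
  obtains f where "paut f" "\<And>i. f (Z i) = Z (Suc i)"
proof -
  define u where "u = pinv (Z 1) (Z 2) / pinv (Z 0) (Z 1)"
  have n0: "pinv (Z 0) (Z 1) \<noteq> 0" using \<rho>(1) \<rho>(3)[of 0] by auto
  have u: "cmod u = 1" using \<rho>(1) \<rho>(3)[of 0] \<rho>(3)[of 1] by (simp add: u_def norm_divide numeral_2_eq_2)
  define f where "f x = pinv (Z 1) (u * pinv (Z 0) x)" for x
  have f: "paut f" unfolding f_def
    by (intro paut_comp[OF paut_pinv[OF Z]] paut_comp[OF paut_rot[OF u] paut_pinv[OF Z]])
  have "f (Z i) = Z (Suc i) \<and> f (Z (Suc i)) = Z (Suc (Suc i))" for i
  proof (induction i)
    case 0
    have "f (Z 0) = Z 1" by (simp add: f_def)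
    moreover have "f (Z 1) = Z 2" using n0 Z by (simp add: f_def u_def)
    ultimately show ?case by (simp add: numeral_2_eq_2)
  next
    case (Suc i)
    obtain t where t: "\<And>x. cmod x < 1 \<Longrightarrow> pinv (f (Z (Suc i))) (f x) = t * pinv (Z (Suc i)) x"
      using paut_conj[OF f Z[of "Suc i"]] by blast
    let ?W = "Z (Suc (Suc i))"
    have 1: "pinv ?W (Z (Suc i)) = t * pinv (Z (Suc i)) (Z i)" using t[OF Z[of i]] Suc by simp
    have "pinv ?W (f ?W) = t * pinv (Z (Suc i)) ?W" using t[OF Z[of "Suc (Suc i)"]] Suc by simp
    also have "\<dots> = \<kappa> * pinv ?W (Z (Suc i))" unfolding \<kappa> 1 by simp
    also have "\<dots> = pinv ?W (Z (Suc (Suc (Suc i))))" by (simp add: \<kappa>)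
    finally have "f ?W = Z (Suc (Suc (Suc i)))"
      by (metis Z paut_disc[OF f] pinv_pinv)
    then show ?case using Suc by simp
  qed
  then show ?thesis using that f by blast
qed

text \<open>The hyperboloid coordinates of a point of the Poincare disc; disc automorphisms act linearly on them,
  so an automorphism of finite order fixes the barycentre of an orbit.\<close>

definition hypx :: "complex \<Rightarrow> complex" where "hypx z = 2 * z / of_real (1 - (cmod z)\<^sup>2)"
definition hyph :: "complex \<Rightarrow> real" where "hyph z = (1 + (cmod z)\<^sup>2) / (1 - (cmod z)\<^sup>2)"

text \<open>Points of the hyperboloid are timelike and future-directed, and the cone of such vectors
  is convex; a sum of them can therefore be normalised back to the hyperboloid.\<close>

lemma hypx_less_hyph:
  assumes "cmod z < 1" shows "cmod (hypx z) < hyph z"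
proof -
  have d: "0 < 1 - (cmod z)\<^sup>2" using disc_sq[OF assms] by simp
  have "cmod (hypx z) = 2 * cmod z / (1 - (cmod z)\<^sup>2)"
    unfolding hypx_def norm_divide norm_mult norm_of_real using d by simp
  moreover have "2 * cmod z < 1 + (cmod z)\<^sup>2"
  proof -
    have "(1 - cmod z)\<^sup>2 > 0" using assms by simp
    then show ?thesis by (simp add: power2_eq_square algebra_simps)
  qed
  ultimately show ?thesis using d by (simp add: hyph_def divide_strict_right_mono)
qed

text \<open>The coefficients on the right are free of \<open>z\<close>: this is one component of a
  Lorentz transformation, and it passes to sums over an orbit.\<close>

lemma hypx_paut:
  assumes pq: "cmod q < cmod p" and z: "cmod z < 1"
    and f: "fz = (p * z + q) / (cnj q * z + cnj p)"
  shows "hypx fz = (p\<^sup>2 * hypx z + q\<^sup>2 * cnj (hypx z) + 2 * p * q * of_real (hyph z)) / of_real ((cmod p)\<^sup>2 - (cmod q)\<^sup>2)"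
proof -
  let ?d = "cnj q * z + cnj p" and ?N = "(cmod p)\<^sup>2 - (cmod q)\<^sup>2"
  have d: "?d \<noteq> 0" by (rule paut_denom_nz[OF pq z])
  have N: "?N > 0" using pq by (simp add: power_strict_mono)
  have z1: "1 - (cmod z)\<^sup>2 > 0" using disc_sq[OF z] by simp
  have "1 - (cmod fz)\<^sup>2 = ?N * (1 - (cmod z)\<^sup>2) / (cmod ?d)\<^sup>2"
    using paut_denom_identity[of q z p] d unfolding f norm_divide power_divide by (simp add: divide_simps)
  then have "hypx fz = 2 * ((p * z + q) / ?d) * of_real ((cmod ?d)\<^sup>2) / of_real (?N * (1 - (cmod z)\<^sup>2))"
    unfolding hypx_def f by simp
  also have "of_real ((cmod ?d)\<^sup>2) = ?d * cnj ?d" by (metis complex_norm_square of_real_power)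
  also have "2 * ((p * z + q) / ?d) * (?d * cnj ?d) = 2 * (p * z + q) * cnj ?d" using d by simp
  also have "2 * (p * z + q) * cnj ?d = p\<^sup>2 * (2 * z) + q\<^sup>2 * (2 * cnj z) + 2 * p * q * (1 + z * cnj z)"
    by (simp add: algebra_simps power2_eq_square)
  also have "z * cnj z = of_real ((cmod z)\<^sup>2)" by (metis complex_norm_square of_real_power)
  also have "(p\<^sup>2 * (2 * z) + q\<^sup>2 * (2 * cnj z) + 2 * p * q * (1 + of_real ((cmod z)\<^sup>2))) / of_real (?N * (1 - (cmod z)\<^sup>2))
    = (p\<^sup>2 * hypx z + q\<^sup>2 * cnj (hypx z) + 2 * p * q * of_real (hyph z)) / of_real ?N"
  proof -
    define D E :: complex where "D = of_real (1 - (cmod z)\<^sup>2)" and "E = of_real ?N"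
    have nz: "D \<noteq> 0" "E \<noteq> 0" using z1 N unfolding D_def E_def of_real_eq_0_iff by linarith+
    have e: "of_real (?N * (1 - (cmod z)\<^sup>2)) = E * D" "of_real (hyph z) = (1 + of_real ((cmod z)\<^sup>2)) / D"
      "hypx z = 2 * z / D" "cnj (hypx z) = 2 * cnj z / D"
      by (simp_all add: D_def E_def hyph_def hypx_def)
    have cD: "cnj D = D" by (simp add: D_def)
    show ?thesis unfolding e E_def[symmetric] using nz by (simp add: divide_simps cD)
  qed
  finally show ?thesis .
qed

text \<open>With the barycentre of the orbit moved to \<open>0\<close>, the sum of the
  \<open>hypx\<close> vanishes. The conjugated automorphism permutes the orbit and acts linearly on
  this sum, which leaves only \<open>2 * p * q\<close> times a positive number; so
  \<open>q = 0\<close> and the automorphism is a rotation.\<close>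

lemma periodic_orbit_rotation:
  assumes n: "n > 0" and Z: "\<And>i. cmod (Z i) < 1" "\<And>i. Z (i + n) = Z i"
    and f: "paut f" "\<And>i. f (Z i) = Z (Suc i)"
  obtains w r \<omega> where "cmod w < 1" "cmod \<omega> = 1" "\<And>i. pinv w (Z i) = r * \<omega> ^ i"
proof -
  define X where "X = (\<Sum>i<n. hypx (Z i))"
  define H where "H = (\<Sum>i<n. hyph (Z i))"
  have "cmod X \<le> (\<Sum>i<n. cmod (hypx (Z i)))" unfolding X_def by (rule norm_sum)
  also have "\<dots> < H" unfolding H_def using n Z by (intro sum_strict_mono hypx_less_hyph) auto
  finally have XH: "cmod X < H" .
  have H0: "H > 0" using XH by (smt (verit) norm_ge_zero)
  define e where "e = sqrt (H\<^sup>2 - (cmod X)\<^sup>2)"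
  have e: "e > 0" "e\<^sup>2 = H\<^sup>2 - (cmod X)\<^sup>2" using XH by (auto simp: e_def power_strict_mono power_mono)
  \<comment> \<open>The vector \<open>(X, H) / e\<close> lies on the hyperboloid, and
    \<open>z = hypx z / (1 + hyph z)\<close> inverts the coordinates; this yields the point of the
    disc that represents the barycentre.\<close>
  define w where "w = X / of_real (H + e)"
  have w: "cmod w < 1" unfolding w_def norm_divide norm_of_real using XH e H0 by simp
  have pw: "\<And>z. cmod z < 1 \<Longrightarrow> pinv w z = ((- \<i>) * z + (\<i> * w)) / (cnj (\<i> * w) * z + cnj (- \<i>))"
  proof -
    fix z 
    have "- \<i> * z + \<i> * w = \<i> * (w - z)" "cnj (\<i> * w) * z + cnj (- \<i>) = \<i> * (1 - cnj w * z)"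
      by (simp_all add: algebra_simps)
    then show "pinv w z = (- \<i> * z + \<i> * w) / (cnj (\<i> * w) * z + cnj (- \<i>))"
      by (simp only: pinv_def) simp
  qed
  define Y where "Y i = pinv w (Z i)" for i
  have Y: "cmod (Y i) < 1" for i unfolding Y_def by (rule pinv_bound[OF w Z(1)])
  have hY: "hypx (Y i) = (- hypx (Z i) - w\<^sup>2 * cnj (hypx (Z i)) + 2 * w * of_real (hyph (Z i))) / of_real (1 - (cmod w)\<^sup>2)" for i
    using hypx_paut[of "\<i> * w" "- \<i>" "Z i", OF _ Z(1) pw[OF Z(1)]] w
    by (simp add: Y_def norm_mult power_mult_distrib)
  have "(\<Sum>i<n. hypx (Y i)) = (- X - w\<^sup>2 * cnj X + 2 * w * of_real H) / of_real (1 - (cmod w)\<^sup>2)"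
    unfolding hY X_def H_def
    by (simp add: sum_divide_distrib[symmetric] sum.distrib sum_subtractf sum_negf sum_distrib_left[symmetric])
  also have "- X - w\<^sup>2 * cnj X + 2 * w * of_real H = 0"
  proof -
    define E where "E = (of_real (H + e) :: complex)"
    have E: "E \<noteq> 0" "w = X / E" using e H0 unfolding E_def w_def of_real_eq_0_iff by auto
    have "X * cnj X = of_real (H\<^sup>2 - e\<^sup>2)" using e(2) complex_norm_square[of X] by simp
    then have "- (E\<^sup>2) - X * cnj X + 2 * E * of_real H = of_real (- (H + e)\<^sup>2 - (H\<^sup>2 - e\<^sup>2) + 2 * (H + e) * H)"
      unfolding E_def by simp
    also have "- (H + e)\<^sup>2 - (H\<^sup>2 - e\<^sup>2) + 2 * (H + e) * H = 0" by (simp add: power2_eq_square algebra_simps)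
    finally have "X * (- (E\<^sup>2) - X * cnj X + 2 * E * of_real H) = 0" by simp
    then have "- X * E\<^sup>2 - X\<^sup>2 * cnj X + 2 * X * E * of_real H = 0" by (simp add: algebra_simps power2_eq_square)
    then show ?thesis unfolding E(2) using E(1) by (simp add: divide_simps power2_eq_square) (simp add: algebra_simps)
  qed
  finally have sumY: "(\<Sum>i<n. hypx (Y i)) = 0" by simp
  define g where "g x = pinv w (f (pinv w x))" for x
  have "paut g" unfolding g_def
    by (intro paut_comp[OF paut_pinv[OF w]] paut_comp[OF f(1) paut_pinv[OF w]])
  then obtain p q where g: "cmod q < cmod p" "\<And>z. cmod z < 1 \<Longrightarrow> g z = (p * z + q) / (cnj q * z + cnj p)"
    by (auto simp: paut_def)
  have gY: "g (Y i) = Y (Suc i)" for i using w Z by (simp add: g_def Y_def f(2))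
  have per: "Y n = Y 0" using Z(2)[of 0] by (simp add: Y_def)
  have "(\<Sum>i<n. hypx (Y (Suc i))) = (\<Sum>i<n. hypx (Y i))"
    using sum.lessThan_Suc_shift[of "\<lambda>i. hypx (Y i)" n] sum.lessThan_Suc[of "\<lambda>i. hypx (Y i)" n] per
    by (simp add: add.commute)
  then have "0 = (\<Sum>i<n. (p\<^sup>2 * hypx (Y i) + q\<^sup>2 * cnj (hypx (Y i)) + 2 * p * q * of_real (hyph (Y i))) / of_real ((cmod p)\<^sup>2 - (cmod q)\<^sup>2))"
    using sumY hypx_paut[OF g(1) Y g(2)[OF Y]] by (simp add: gY)
  also have "\<dots> = (p\<^sup>2 * (\<Sum>i<n. hypx (Y i)) + q\<^sup>2 * cnj (\<Sum>i<n. hypx (Y i)) + 2 * p * q * of_real (\<Sum>i<n. hyph (Y i)))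
      / of_real ((cmod p)\<^sup>2 - (cmod q)\<^sup>2)"
    by (simp add: sum_divide_distrib[symmetric] sum.distrib sum_distrib_left[symmetric])
  finally have "2 * p * q * of_real (\<Sum>i<n. hyph (Y i)) / of_real ((cmod p)\<^sup>2 - (cmod q)\<^sup>2) = 0"
    unfolding sumY by simp
  moreover have "(\<Sum>i<n. hyph (Y i)) > 0"
    using n hypx_less_hyph[OF Y] by (intro sum_pos) (auto intro: le_less_trans[OF norm_ge_zero])
  moreover have "(cmod p)\<^sup>2 - (cmod q)\<^sup>2 > 0" using g(1) by (simp add: power_strict_mono)
  ultimately have "q = 0" using g(1) by (auto simp del: of_real_sum of_real_diff)
  then have gr: "g z = (p / cnj p) * z" if "cmod z < 1" for z using g(2)[OF that] by simp
  have p1: "cmod (p / cnj p) = 1" using g(1) by (simp add: norm_divide) (auto simp: \<open>q = 0\<close>)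
  have Yi: "Y i = Y 0 * (p / cnj p) ^ i" for i
  proof (induction i)
    case (Suc i)
    then show ?case using gY[of i] gr[OF Y[of i]] by simp
  qed simp
  show ?thesis by (rule that[OF w p1 Yi[unfolded Y_def]])
qed

section \<open>Area and perimeter of polygons with vertices \<open>r * \<omega> ^ i\<close>\<close>

text \<open>The area of the regular n-gon of perimeter \<open>L\<close>.\<close>

definition isoarea :: "nat \<Rightarrow> real \<Rightarrow> real" where
  "isoarea n L = 2 * real n * (arccos (cos (pi / real n) / cosh (L / (2 * real n))) - pi / real n)"

lemma cos_pi_n:
  assumes "n \<ge> 3" shows "0 < cos (pi / real n)" "cos (pi / real n) < 1" "0 < pi / real n" "pi / real n < pi / 2"
    "pi / real n \<le> pi"
proof -
  show a: "0 < pi / real n" "pi / real n < pi / 2" using assms by (auto simp: field_simps)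
  show b: "pi / real n \<le> pi" using a pi_gt_zero by linarith
  show "0 < cos (pi / real n)" using a by (intro cos_gt_zero_pi) auto
  show "cos (pi / real n) < 1" using a b cos_monotone_0_pi[of 0 "pi / real n"] by simp
qed

lemma cos_cosh_ratio:
  assumes "n \<ge> 3"
  shows "0 < cos (pi / real n) / cosh x" "cos (pi / real n) / cosh x < 1"
  using cos_pi_n[OF assms] cosh_real_ge_1[of x] by (auto simp: divide_less_eq_1)

lemma isoarea_deriv:
  assumes "n \<ge> 3" shows "\<exists>l. (isoarea n has_real_derivative l) (at L)"
proof -
  let ?x = "L / (2 * real n)"
  have "cosh ?x \<noteq> 0" by (simp add: cosh_real_nonzero)
  then have 1: "((\<lambda>L. cos (pi / real n) / cosh (L / (2 * real n))) has_real_derivative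
     - cos (pi / real n) * sinh ?x / (2 * real n) / (cosh ?x)\<^sup>2) (at L)"
    using assms by (auto intro!: derivative_eq_intros simp: power2_eq_square field_simps)
  have "((\<lambda>L. arccos (cos (pi / real n) / cosh (L / (2 * real n)))) has_real_derivative
     inverse (- sqrt (1 - (cos (pi / real n) / cosh ?x)\<^sup>2)) * (- cos (pi / real n) * sinh ?x / (2 * real n) / (cosh ?x)\<^sup>2)) (at L)"
    by (rule DERIV_chain2[OF DERIV_arccos 1]) (use cos_cosh_ratio[OF assms, of ?x] in linarith)+
  from DERIV_cmult[OF DERIV_diff[OF this DERIV_const]] show ?thesis unfolding isoarea_def by blast
qed

lemma isoarea_nonneg:
  assumes "n \<ge> 3" shows "isoarea n L \<ge> 0"
proof -
  let ?x = "L / (2 * real n)"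
  have "cos (pi / real n) / cosh ?x \<le> cos (pi / real n)"
    using cos_pi_n[OF assms] cosh_real_ge_1[of ?x] by (simp add: divide_le_eq mult_le_cancel_left1)
  then have "arccos (cos (pi / real n)) \<le> arccos (cos (pi / real n) / cosh ?x)"
    using cos_cosh_ratio[OF assms, of ?x] by (intro arccos_le_arccos) auto
  moreover have "arccos (cos (pi / real n)) = pi / real n"
    using cos_pi_n[OF assms] by (intro arccos_cos) auto
  ultimately show ?thesis by (simp add: isoarea_def)
qed

lemma isoarea_0: "n \<ge> 3 \<Longrightarrow> isoarea n 0 = 0"
  using cos_pi_n[of n] by (simp add: isoarea_def arccos_cos)

lemma isoarea_continuous: "n \<ge> 3 \<Longrightarrow> continuous_on S (isoarea n)"
  using isoarea_deriv by (meson DERIV_isCont continuous_at_imp_continuous_on)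

text \<open>The half area of one of the n isosceles triangles, as a function of its half apex angle.\<close>

lemma half_area_decreasing:
  fixes c x y :: real
  assumes "c > 1" "0 < x" "x < y" "y < pi"
  shows "arccos (cos y / c) - y < arccos (cos x / c) - x"
proof -
  have "\<exists>d. ((\<lambda>\<mu>. arccos (cos \<mu> / c) - \<mu>) has_real_derivative d) (at m) \<and> d < 0" if "x \<le> m" "m \<le> y" for m
  proof -
    have s: "sin m > 0" using that assms by (intro sin_gt_zero) auto
    have cm: "\<bar>cos m / c\<bar> < 1" using assms(1) le_less_trans[OF abs_cos_le_one[of m] assms(1)] by (simp add: abs_divide)
    have "((\<lambda>\<mu>. cos \<mu> / c) has_real_derivative - sin m / c) (at m)"
      using assms by (auto intro!: derivative_eq_intros)
    from DERIV_chain2[OF DERIV_arccos this]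
    have "((\<lambda>\<mu>. arccos (cos \<mu> / c)) has_real_derivative inverse (- sqrt (1 - (cos m / c)\<^sup>2)) * (- sin m / c)) (at m)"
      using cm unfolding abs_less_iff by linarith
    then have D: "((\<lambda>\<mu>. arccos (cos \<mu> / c) - \<mu>) has_real_derivative inverse (- sqrt (1 - (cos m / c)\<^sup>2)) * (- sin m / c) - 1) (at m)"
      by (intro DERIV_diff DERIV_ident)
    \<comment> \<open>This is \<open>1 / c^2 < 1\<close>, and it says that the derivative
      \<open>sin m / (c * sqrt (1 - (cos m / c)^2)) - 1\<close> is negative.\<close>
    have "(sin m / c)\<^sup>2 < 1 - (cos m / c)\<^sup>2"
    proof -
      have "(sin m / c)\<^sup>2 + (cos m / c)\<^sup>2 = 1 / c\<^sup>2"
        unfolding power_divide add_divide_distrib[symmetric] by simp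
      also have "\<dots> < 1" using assms by (simp add: divide_less_eq_1)
      finally show ?thesis by simp
    qed
    then have "sin m / c < sqrt (1 - (cos m / c)\<^sup>2)" by (rule real_less_rsqrt)
    moreover have "sin m / c > 0" using s assms by simp
    moreover have aux: "inverse (- q) * (- s) - 1 < 0" if "s < q" "0 < s" for s q :: real
      using that by (simp add: field_simps)
    ultimately have "inverse (- sqrt (1 - (cos m / c)\<^sup>2)) * (- sin m / c) - 1 < 0"
      using aux by (simp only: minus_divide_left[symmetric])
    with D show ?thesis by blast
  qed
  then show ?thesis using DERIV_neg_imp_decreasing[of x y "\<lambda>\<mu>. arccos (cos \<mu> / c) - \<mu>"] assms(3) by blast
qed

text \<open>The triangle \<open>0\<close>, \<open>r\<close>, \<open>r * \<omega>\<close> has apex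
  angle \<open>2 * \<mu>\<close>; here \<open>R = (cmod r)^2\<close>, and \<open>c\<close> is
  \<open>cosh\<close> of half the base. After multiplication of the kernel by
  \<open>exp (- \<i> * \<mu>)\<close> the real part gives
  \<open>c * cos (t + \<mu>) = cos \<mu>\<close> for half the area \<open>t\<close>, and the
  imaginary part gives \<open>c > 1\<close> and the branch of \<open>arccos\<close>. Angles
  \<open>\<mu>\<close> up to \<open>pi\<close> occur because the polygon may wind around
  \<open>0\<close> several times.\<close>

lemma star_polygon_area:
  assumes R: "0 < R" "R < 1" and m: "0 < \<mu>" "\<mu> < pi"
  defines "\<omega> \<equiv> exp (2 * \<i> * of_real \<mu>)"
  defines "c \<equiv> cmod (1 - of_real R * \<omega>) / (1 - R)"
  shows "c > 1" "- Im (Ln (1 - of_real R * \<omega>)) = arccos (cos \<mu> / c) - \<mu>"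
proof -
  let ?K = "1 - of_real R * \<omega>"
  define t where "t = - Im (Ln ?K)"
  have w1: "cmod \<omega> = 1" by (simp add: \<omega>_def)
  have "cmod (of_real R * \<omega>) = R" using R w1 by (simp add: norm_mult)
  then have "Re (of_real R * \<omega>) < 1" using complex_Re_le_cmod[of "of_real R * \<omega>"] R by linarith
  then have Re: "Re ?K > 0" by simp
  then have K0: "?K \<noteq> 0" by (metis less_irrefl zero_complex.sel(1))
  have t: "\<bar>t\<bar> < pi / 2" using Re_Ln_pos_lt_imp[OF Re] by (simp add: t_def)
  have K: "?K = of_real (c * (1 - R)) * exp (- \<i> * of_real t)"
  proof -
    have "exp (\<i> * of_real (Im (Ln ?K))) = ?K / of_real (cmod ?K)" by (rule exp_i_Im_Ln[OF K0])
    then show ?thesis using K0 R by (simp add: t_def c_def)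
  qed
  have c0: "c > 0" using K0 R by (simp add: c_def)
  have "?K * exp (- \<i> * of_real \<mu>) = exp (- \<i> * of_real \<mu>) - of_real R * exp (\<i> * of_real \<mu>)"
    unfolding \<omega>_def by (simp add: algebra_simps flip: exp_add)
  moreover have "?K * exp (- \<i> * of_real \<mu>) = of_real (c * (1 - R)) * exp (- \<i> * of_real (t + \<mu>))"
    by (subst K) (simp add: algebra_simps flip: exp_add)
  ultimately have E: "of_real (c * (1 - R)) * exp (- \<i> * of_real (t + \<mu>)) = exp (- \<i> * of_real \<mu>) - of_real R * exp (\<i> * of_real \<mu>)"
    by simp
  have neg: "cos (- \<mu> - t) = cos (\<mu> + t)" "sin (- \<mu> - t) = - sin (\<mu> + t)"
    using cos_minus[of "\<mu> + t"] sin_minus[of "\<mu> + t"] by simp_all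
  have "c * (1 - R) * cos (t + \<mu>) = (1 - R) * cos \<mu>"
    using arg_cong[OF E, of Re] neg by (simp add: Re_exp algebra_simps)
  then have C: "c * cos (t + \<mu>) = cos \<mu>" using R by simp
  have S: "c * (1 - R) * sin (t + \<mu>) = (1 + R) * sin \<mu>"
    using arg_cong[OF E, of Im] neg by (simp add: Im_exp algebra_simps)
  have sm: "sin \<mu> > 0" using m by (intro sin_gt_zero)
  have sp: "sin (t + \<mu>) > 0"
  proof -
    have "c * (1 - R) * sin (t + \<mu>) > 0" unfolding S using sm R by simp
    then show ?thesis by (rule zero_less_mult_pos) (use c0 R in simp)
  qed
  have "(1 - R) * sin \<mu> < (1 + R) * sin \<mu>" using sm R by simp
  then have "(1 - R) * sin \<mu> < (1 - R) * (c * sin (t + \<mu>))"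
    unfolding S[symmetric] by (simp only: mult_ac)
  then have "sin \<mu> < c * sin (t + \<mu>)" using R by simp
  then have "(sin \<mu>)\<^sup>2 < (c * sin (t + \<mu>))\<^sup>2" using sm by (intro power_strict_mono) auto
  then have "(sin \<mu>)\<^sup>2 < c\<^sup>2 * (sin (t + \<mu>))\<^sup>2" by (simp only: power_mult_distrib)
  moreover have "(cos \<mu>)\<^sup>2 = c\<^sup>2 * (cos (t + \<mu>))\<^sup>2" by (simp only: C[symmetric] power_mult_distrib)
  moreover have "c\<^sup>2 * (sin (t + \<mu>))\<^sup>2 + c\<^sup>2 * (cos (t + \<mu>))\<^sup>2 = c\<^sup>2"
    by (simp flip: distrib_left)
  ultimately have "1 < c\<^sup>2" using sin_cos_squared_add[of \<mu>] by linarith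
  then show c1: "c > 1" using c0 by (metis less_le_not_le linorder_not_le one_power2 power_mono zero_less_one_class.zero_le_one less_imp_le)
  have "0 < t + \<mu>"
  proof (rule ccontr)
    assume "\<not> ?thesis"
    moreover have "- pi < t + \<mu>" using t m by linarith
    ultimately have "sin (- (t + \<mu>)) \<ge> 0" by (intro sin_ge_zero) auto
    then show False using sp sin_minus[of "t + \<mu>"] by linarith
  qed
  moreover have "t + \<mu> < pi"
  proof (rule ccontr)
    assume "\<not> ?thesis"
    moreover have "t + \<mu> < 2 * pi" using t m by linarith
    ultimately have "sin (t + \<mu>) \<le> 0" by (intro sin_le_zero) auto
    then show False using sp by simp
  qed
  ultimately have "arccos (cos (t + \<mu>)) = t + \<mu>" by (intro arccos_cos) auto
  moreover have "cos (t + \<mu>) = cos \<mu> / c" using C c0 by (simp add: field_simps)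
  ultimately show "- Im (Ln ?K) = arccos (cos \<mu> / c) - \<mu>" by (simp add: t_def)
qed

lemma cyc_sum_rotation:
  assumes "n > 0" "\<And>i. i < n \<Longrightarrow> v i = r * \<omega> ^ i" "cmod \<omega> = 1" "\<omega> ^ n = 1" "cmod r < 1"
  shows "cyc_sum n parea v = - 2 * real n * Im (Ln (1 - of_real ((cmod r)\<^sup>2) * \<omega>))"
    "cyc_sum n pdist v = real n * pdist r (r * \<omega>)"
proof -
  have next': "v (Suc i mod n) = r * \<omega> ^ Suc i" if "i < n" for i
  proof (cases "Suc i = n")
    case True then show ?thesis using assms(1,4) assms(2)[of 0] by (simp only: True) simp
  next
    case False then have "Suc i < n" using that by simp
    then show ?thesis using assms(2)[of "Suc i"] by simp
  qed
  have cw: "cnj (\<omega> ^ i) * \<omega> ^ i = 1" for i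
    using complex_norm_square[of "\<omega> ^ i"] assms(3) by (simp add: norm_power mult.commute)
  have rr: "cnj r * r = of_real ((cmod r)\<^sup>2)" using complex_norm_square[of r] by (simp add: mult.commute)
  have k: "cnj (r * \<omega> ^ i) * (r * \<omega> ^ Suc i) = of_real ((cmod r)\<^sup>2) * \<omega>" for i
  proof -
    have "cnj (r * \<omega> ^ i) * (r * \<omega> ^ Suc i) = (cnj r * r) * (cnj (\<omega> ^ i) * \<omega> ^ i) * \<omega>"
      by (simp only: complex_cnj_mult power_Suc mult_ac)
    then show ?thesis unfolding cw rr by simp
  qed
  have "parea (v i) (v (Suc i mod n)) = - 2 * Im (Ln (1 - of_real ((cmod r)\<^sup>2) * \<omega>))" if "i < n" for i
    unfolding next'[OF that] assms(2)[OF that] parea_def k ..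
  then show "cyc_sum n parea v = - 2 * real n * Im (Ln (1 - of_real ((cmod r)\<^sup>2) * \<omega>))"
    unfolding cyc_sum_def by simp
  have "pdist (v i) (v (Suc i mod n)) = pdist r (r * \<omega>)" if "i < n" for i
  proof -
    have "r * \<omega> ^ i - r * \<omega> ^ Suc i = \<omega> ^ i * (r - r * \<omega>)" by (simp add: algebra_simps)
    then have "cmod (r * \<omega> ^ i - r * \<omega> ^ Suc i) = cmod (r - r * \<omega>)"
      using assms(3) by (simp only: norm_mult norm_power) simp
    moreover have "cnj r * (r * \<omega>) = of_real ((cmod r)\<^sup>2) * \<omega>"
      by (simp only: mult.assoc[symmetric] rr)
    ultimately show ?thesis
      unfolding next'[OF that] assms(2)[OF that] pdist_def pdelta_def k by (simp only:)
  qed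
  then show "cyc_sum n pdist v = real n * pdist r (r * \<omega>)" unfolding cyc_sum_def by simp
qed

text \<open>For \<open>\<omega> = exp (2 * pi * \<i> * k / n)\<close> the half apex angle is
  \<open>pi * k / n\<close>, at least \<open>pi / n\<close> since \<open>k\<close> is not
  \<open>0\<close>. At a fixed side length the area decreases strictly with this angle, so equality
  singles out \<open>k = 1\<close>.\<close>

lemma rotation_polygon_bound:
  assumes n: "n \<ge> 3" and v: "\<And>i. i < n \<Longrightarrow> v i = r * \<omega> ^ i" and w: "cmod \<omega> = 1" "\<omega> ^ n = 1"
    and r: "0 < cmod r" "cmod r < 1" and w1: "\<omega> \<noteq> 1"
  shows "cyc_sum n parea v \<le> isoarea n (cyc_sum n pdist v)"
    and "cyc_sum n parea v = isoarea n (cyc_sum n pdist v) \<longleftrightarrow> \<omega> = exp (2 * \<i> * of_real (pi / n))"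
proof -
  obtain k where k: "k < n" "\<omega> = exp (2 * of_real pi * \<i> * of_nat k / of_nat n)"
    using w(2) complex_roots_unity[of n] n by auto
  define \<mu> where "\<mu> = pi * real k / real n"
  have k0: "k \<noteq> 0" using w1 k(2) by (intro notI) simp
  have wm: "\<omega> = exp (2 * \<i> * of_real \<mu>)" unfolding k(2) \<mu>_def by (simp add: mult_ac)
  have m: "0 < \<mu>" "\<mu> < pi" "pi / n \<le> \<mu>" using k(1) k0 n by (auto simp: \<mu>_def field_simps)
  have m1: "\<mu> = pi / n \<longleftrightarrow> k = 1" using n by (auto simp: \<mu>_def)
  define R where "R = (cmod r)\<^sup>2"
  have R: "0 < R" "R < 1" using r disc_sq[of r] by (auto simp: R_def)
  define c where "c = cmod (1 - of_real R * \<omega>) / (1 - R)"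
  have c: "c > 1" "- Im (Ln (1 - of_real R * \<omega>)) = arccos (cos \<mu> / c) - \<mu>"
    using star_polygon_area[OF R m(1,2)] unfolding wm[symmetric] c_def by auto
  have nw: "cmod (r * \<omega>) < 1" "cmod (r * \<omega>) = cmod r" using r w by (auto simp: norm_mult)
  have cs: "cosh (cyc_sum n pdist v / (2 * real n)) = c"
  proof -
    have k: "cnj r * (r * \<omega>) = of_real R * \<omega>" using complex_norm_square[of r]
      unfolding R_def by (simp add: mult_ac)
    have "cosh (pdist r (r * \<omega>) / 2) = c"
      unfolding cosh_pdist_half[OF r(2) nw(1)] nw(2) k c_def using R by (simp add: R_def)
    moreover have "cyc_sum n pdist v / (2 * real n) = pdist r (r * \<omega>) / 2"
      using cyc_sum_rotation(2)[OF _ v w r(2)] n by simp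
    ultimately show ?thesis by (simp only:)
  qed
  have A: "cyc_sum n parea v = 2 * real n * (arccos (cos \<mu> / c) - \<mu>)"
    unfolding c(2)[symmetric] using cyc_sum_rotation(1)[OF _ v w r(2)] n by (simp add: R_def)
  have I: "isoarea n (cyc_sum n pdist v) = 2 * real n * (arccos (cos (pi / n) / c) - pi / n)"
    by (simp add: isoarea_def cs)
  have lt: "arccos (cos \<mu> / c) - \<mu> < arccos (cos (pi / n) / c) - pi / n" if "k \<noteq> 1"
    using half_area_decreasing[OF c(1), of "pi / n" \<mu>] m m1 that cos_pi_n(3)[OF n] by auto
  show "cyc_sum n parea v \<le> isoarea n (cyc_sum n pdist v)"
    unfolding A I using lt m1 n by (cases "k = 1") auto
  have "\<omega> = exp (2 * \<i> * of_real (pi / n)) \<longleftrightarrow> k = 1"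
  proof
    assume "\<omega> = exp (2 * \<i> * of_real (pi / n))"
    then have "exp (2 * of_real pi * \<i> * of_nat k / of_nat n) = exp (2 * of_real pi * \<i> * of_nat 1 / of_nat n)"
      unfolding k(2) by (simp add: mult_ac)
    then show "k = 1" using complex_root_unity_eq[of n k 1] n k(1) by (simp add: cong_def)
  next
    assume "k = 1" then show "\<omega> = exp (2 * \<i> * of_real (pi / n))" using wm m1 by simp
  qed
  moreover have "cyc_sum n parea v = isoarea n (cyc_sum n pdist v) \<longleftrightarrow> k = 1"
    unfolding A I using lt m1 n by (cases "k = 1") auto
  ultimately show "cyc_sum n parea v = isoarea n (cyc_sum n pdist v) \<longleftrightarrow> \<omega> = exp (2 * \<i> * of_real (pi / n))" by simp
qed

text \<open>Shared by maximizers and regular polygons: both supply equal sides and a common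
  multiplier \<open>\<kappa>\<close>. Continuing the vertices periodically turns the closed polygon
  into a periodic orbit of one automorphism; \<open>r\<close> and \<open>\<omega>\<close> are
  nontrivial because the side length is positive.\<close>

lemma equiangular_polygon_rotation:
  assumes n: "n \<ge> 3" and z: "\<And>i. i < n \<Longrightarrow> cmod (z i) < 1" and \<rho>: "\<rho> > 0"
    "\<And>j. j < n \<Longrightarrow> cmod (pinv (z j) (z (Suc j mod n))) = \<rho>"
    "\<And>j. j < n \<Longrightarrow> pinv (z j) (z (Suc j mod n)) = \<kappa> * pinv (z j) (z ((j + n - 1) mod n))"
  obtains w r \<omega> where "cmod w < 1" "\<And>i. i < n \<Longrightarrow> pinv w (z i) = r * \<omega> ^ i" "cmod \<omega> = 1" "\<omega> ^ n = 1"
    "0 < cmod r" "cmod r < 1" "\<omega> \<noteq> 1"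
proof -
  define Z where "Z i = z (i mod n)" for i
  have Z1: "cmod (Z i) < 1" for i using z n by (simp add: Z_def)
  have Zp: "Z (i + n) = Z i" for i by (simp add: Z_def)
  have Zs: "z (Suc (i mod n) mod n) = Z (Suc i)" for i by (simp add: Z_def mod_Suc_eq)
  have Zpr: "z ((Suc i mod n + n - 1) mod n) = Z i" for i
  proof -
    have "Suc ((Suc i mod n + n - 1) mod n) mod n = Suc i mod n" using cyc_pred(1)[OF n, of "Suc i mod n"] n by simp
    moreover have "Suc (i mod n) mod n = Suc i mod n" by (simp add: mod_Suc_eq)
    ultimately have "(Suc i mod n + n - 1) mod n = i mod n"
      using cyc_succ_eq_iff[OF n, of "Suc i mod n" "i mod n"] n by simp
    then show ?thesis by (simp add: Z_def)
  qed
  have r1: "cmod (pinv (Z i) (Z (Suc i))) = \<rho>" for i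
    using \<rho>(2)[of "i mod n"] n unfolding Zs by (simp add: Z_def)
  have r2: "cmod (pinv (Z (Suc i)) (Z i)) = \<rho>" for i
  proof -
    have "cmod (pinv (Z (Suc i)) (Z i)) = pdelta (Z (Suc i)) (Z i)" by (simp add: pinv_def pdelta_def norm_divide)
    also have "\<dots> = pdelta (Z i) (Z (Suc i))" by (rule pdelta_commute)
    also have "\<dots> = cmod (pinv (Z i) (Z (Suc i)))" by (simp add: pinv_def pdelta_def norm_divide)
    finally show ?thesis using r1 by simp
  qed
  have kk: "pinv (Z (Suc i)) (Z (Suc (Suc i))) = \<kappa> * pinv (Z (Suc i)) (Z i)" for i
    using \<rho>(3)[of "Suc i mod n"] n unfolding Zs Zpr by (simp add: Z_def)
  obtain f where f: "paut f" "\<And>i. f (Z i) = Z (Suc i)"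
    using equiangular_orbit[of Z \<rho> \<kappa>, OF Z1 \<rho>(1) r2 r1 kk] by blast
  obtain w r \<omega> where W: "cmod w < 1" "cmod \<omega> = 1" "\<And>i. pinv w (Z i) = r * \<omega> ^ i"
    using periodic_orbit_rotation[of n Z, OF _ Z1 Zp f] n by (metis gr0I not_numeral_le_zero)
  have r: "cmod r < 1" using W(3)[of 0] pinv_bound[OF W(1) Z1[of 0]] by simp
  have d: "pdelta (Z 0) (Z 1) = \<rho>" using r1[of 0] by (simp add: pinv_def pdelta_def norm_divide)
  have d': "pdelta r (r * \<omega>) = \<rho>"
    using pdelta_pinv[OF W(1) Z1[of 0] Z1[of 1]] W(3)[of 0] W(3)[of 1] d by simp
  then have "r \<noteq> 0" "\<omega> \<noteq> 1" using \<rho>(1) by auto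
  moreover have "r * \<omega> ^ n = r" using W(3)[of n] W(3)[of 0] Zp[of 0] by simp
  ultimately have "\<omega> ^ n = 1" "0 < cmod r" "\<omega> \<noteq> 1" by auto
  moreover have "pinv w (z i) = r * \<omega> ^ i" if "i < n" for i using W(3)[of i] that by (simp add: Z_def)
  ultimately show ?thesis using that[OF W(1) _ W(2)] r by blast
qed

text \<open>\<open>G\<close> is left general because two choices occur: \<open>isoarea n\<close>
  plus a linear penalty for the inequality, and \<open>isoarea n\<close> itself for the case of
  equality.\<close>

lemma maximizer_rotation:
  assumes n: "n \<ge> 3" and z: "\<And>i. i < n \<Longrightarrow> cmod (z i) < 1"
    and max: "\<And>u. (\<And>i. i < n \<Longrightarrow> cmod (u i) < 1) \<Longrightarrow>
       cyc_sum n parea u - G (cyc_sum n pdist u) \<le> cyc_sum n parea z - G (cyc_sum n pdist z)"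
    and G: "\<exists>l. (G has_real_derivative l) (at (cyc_sum n pdist z))"
    and nz: "\<exists>i<n. z i \<noteq> z (Suc i mod n)"
  obtains w r \<omega> where "cmod w < 1" "\<And>i. i < n \<Longrightarrow> pinv w (z i) = r * \<omega> ^ i" "cmod \<omega> = 1" "\<omega> ^ n = 1"
    "0 < cmod r" "cmod r < 1" "\<omega> \<noteq> 1"
    "cyc_sum n parea z \<le> isoarea n (cyc_sum n pdist z)"
    "cyc_sum n parea z = isoarea n (cyc_sum n pdist z) \<longleftrightarrow> \<omega> = exp (2 * \<i> * of_real (pi / n))"
proof -
  obtain l where G': "(G has_real_derivative l) (at (cyc_sum n pdist z))" using G by blast
  obtain \<rho> \<kappa> where rk: "\<rho> > 0" "\<And>j. j < n \<Longrightarrow> cmod (pinv (z j) (z (Suc j mod n))) = \<rho>"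
    "\<And>j. j < n \<Longrightarrow> pinv (z j) (z (Suc j mod n)) = \<kappa> * pinv (z j) (z ((j + n - 1) mod n))"
    using maximizer_rigid[of n z G l, OF n z max G' nz] by blast
  obtain w r \<omega> where W: "cmod w < 1" "\<And>i. i < n \<Longrightarrow> pinv w (z i) = r * \<omega> ^ i" "cmod \<omega> = 1" "\<omega> ^ n = 1"
    "0 < cmod r" "cmod r < 1" "\<omega> \<noteq> 1"
    using equiangular_polygon_rotation[OF n z rk] by blast
  have e: "cyc_sum n parea (\<lambda>i. pinv w (z i)) = cyc_sum n parea z" "cyc_sum n pdist (\<lambda>i. pinv w (z i)) = cyc_sum n pdist z"
    using cyc_sum_parea_pinv[of n w z] cyc_sum_pdist_pinv[of w n z] W(1) z n by auto
  show thesis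
    using that[OF W] rotation_polygon_bound[of n "\<lambda>i. pinv w (z i)" r \<omega>, OF n W(2-7)] unfolding e by blast
qed

section \<open>The isoperimetric inequality for closed polygons and its equality case\<close>

theorem polygon_area_le:
  assumes n: "n \<ge> 3" and v: "\<And>i. i < n \<Longrightarrow> cmod (v i) < 1"
  shows "cyc_sum n parea v \<le> isoarea n (cyc_sum n pdist v)"
proof (rule ccontr)
  define S L where "S = cyc_sum n parea v" and "L = cyc_sum n pdist v"
  assume "\<not> ?thesis"
  then have SL: "S > isoarea n L" by (simp add: S_def L_def)
  have L: "L \<ge> 0" unfolding L_def using v by (rule cyc_sum_pdist_nonneg)
  \<comment> \<open>So small that the penalty \<open>\<eta> * L\<close> uses up less than the excess
    of \<open>S\<close> over \<open>isoarea n L\<close>; the polygon still violates the inequality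
    for \<open>G\<close>.\<close>
  define \<eta> where "\<eta> = (S - isoarea n L) / (2 * (L + 1))"
  have \<eta>: "\<eta> > 0" using SL L by (simp add: \<eta>_def)
  define G where "G x = isoarea n x + \<eta> * x" for x
  have "\<eta> * L = (S - isoarea n L) * (L / (2 * (L + 1)))" by (simp add: \<eta>_def)
  also have "\<dots> < (S - isoarea n L) * 1" using SL L by (intro mult_strict_left_mono) (auto simp: divide_less_eq_1)
  finally have GL: "S > G L" by (simp add: G_def)
  have cG: "continuous_on {0..} G" unfolding G_def by (intro continuous_intros isoarea_continuous n)
  have Gge: "G x \<ge> \<eta> * x" for x using isoarea_nonneg[OF n] by (simp add: G_def)
  obtain z where z: "\<And>i. i < n \<Longrightarrow> cmod (z i) < 1" "cyc_sum n parea z > G (cyc_sum n pdist z)"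
    "\<And>u. (\<And>i. i < n \<Longrightarrow> cmod (u i) < 1) \<Longrightarrow>
       cyc_sum n parea u - G (cyc_sum n pdist u) \<le> cyc_sum n parea z - G (cyc_sum n pdist z)"
    using maximizer_exists[OF n \<eta> cG Gge v, of id] GL unfolding S_def L_def by (auto simp: o_def)
  have G': "\<exists>l. (G has_real_derivative l) (at x)" for x
  proof -
    obtain l where "(isoarea n has_real_derivative l) (at x)" using isoarea_deriv[OF n] by blast
    then have "(G has_real_derivative l + \<eta>) (at x)" unfolding G_def by (auto intro!: derivative_eq_intros)
    then show ?thesis by blast
  qed
  \<comment> \<open>A constant tuple has area and perimeter \<open>0\<close>, and
    \<open>G 0 = 0\<close>, so it cannot violate the inequality.\<close>
  have "\<exists>i<n. z i \<noteq> z (Suc i mod n)"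
  proof (rule ccontr)
    assume "\<not> ?thesis"
    then have e: "z (Suc i mod n) = z i" if "i < n" for i using that by metis
    have "cyc_sum n parea z = 0" "cyc_sum n pdist z = 0"
      unfolding cyc_sum_def using e z(1) by (auto simp: parea_self)
    then show False using z(2) isoarea_0[OF n] by (simp add: G_def)
  qed
  then have "cyc_sum n parea z \<le> isoarea n (cyc_sum n pdist z)"
    using maximizer_rotation[of n z G, OF n z(1) z(3) G'] by blast
  moreover have "cyc_sum n pdist z \<ge> 0" using z(1) by (rule cyc_sum_pdist_nonneg)
  ultimately show False using z(2) \<eta> by (simp add: G_def) (smt (verit) mult_nonneg_nonneg)
qed

theorem polygon_area_eq:
  assumes n: "n \<ge> 3" and v: "\<And>i. i < n \<Longrightarrow> cmod (v i) < 1"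
    and eq: "cyc_sum n parea v = isoarea n (cyc_sum n pdist v)" and nz: "\<exists>i<n. v i \<noteq> v (Suc i mod n)"
  obtains w r where "cmod w < 1" "0 < cmod r" "cmod r < 1"
    "\<And>i. i < n \<Longrightarrow> pinv w (v i) = r * exp (2 * \<i> * of_real (pi / n)) ^ i"
proof -
  have "cyc_sum n parea u - isoarea n (cyc_sum n pdist u) \<le> cyc_sum n parea v - isoarea n (cyc_sum n pdist v)"
    if "\<And>i. i < n \<Longrightarrow> cmod (u i) < 1" for u
    using polygon_area_le[of n u] n that eq by simp
  from maximizer_rotation[of n v "isoarea n", OF n v this isoarea_deriv[OF n] nz] eq that
  show ?thesis by metis
qed

section \<open>Winding numbers of simple polygons\<close>

text \<open>The broken line from \<open>Z i\<close> with \<open>Suc m\<close> edges, so a closed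
  n-gon is \<open>chain Z i (n - 1)\<close>. Splitting off the first edge suits both
  \<open>arc_join\<close> and the additivity of winding numbers.\<close>

primrec chain :: "(nat \<Rightarrow> complex) \<Rightarrow> nat \<Rightarrow> nat \<Rightarrow> real \<Rightarrow> complex" where
  "chain Z i 0 = linepath (Z i) (Z (Suc i))"
| "chain Z i (Suc m) = linepath (Z i) (Z (Suc i)) +++ chain Z (Suc i) m"

lemma pathstart_chain [simp]: "pathstart (chain Z i m) = Z i"
  by (cases m) auto

lemma pathfinish_chain [simp]: "pathfinish (chain Z i m) = Z (Suc (i + m))"
  by (induction m arbitrary: i) auto

lemma path_chain [simp]: "path (chain Z i m)"
  by (induction m arbitrary: i) auto

lemma path_image_chain: "path_image (chain Z i m) = (\<Union>j\<le>m. closed_segment (Z (i + j)) (Z (Suc (i + j))))"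
proof (induction m arbitrary: i)
  case (Suc m)
  have "{..Suc m} = insert 0 (Suc ` {..m})" by (auto simp: image_iff) (metis Suc_le_D Suc_le_mono atMost_iff not0_implies_Suc)
  then show ?case using Suc by (simp add: path_image_join)
qed auto

lemma winding_number_chain:
  assumes "x \<notin> path_image (chain Z i m)"
  shows "winding_number (chain Z i m) x = (\<Sum>j\<le>m. winding_number (linepath (Z (i + j)) (Z (Suc (i + j)))) x)"
  using assms
proof (induction m arbitrary: i)
  case (Suc m)
  have x: "x \<notin> closed_segment (Z i) (Z (Suc i))" "x \<notin> path_image (chain Z (Suc i) m)"
    using Suc.prems by (auto simp: path_image_join)
  have "winding_number (chain Z i (Suc m)) x = winding_number (linepath (Z i) (Z (Suc i))) x + winding_number (chain Z (Suc i) m) x"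
    using x by (simp add: winding_number_join)
  also have "\<dots> = winding_number (linepath (Z i) (Z (Suc i))) x + (\<Sum>j\<le>m. winding_number (linepath (Z (Suc i + j)) (Z (Suc (Suc i + j)))) x)"
    using Suc.IH[OF x(2)] by simp
  also have "\<dots> = (\<Sum>j\<le>Suc m. winding_number (linepath (Z (i + j)) (Z (Suc (i + j)))) x)"
    by (subst sum.atMost_Suc_shift) simp
  finally show ?case .
qed simp

text \<open>A periodic sequence of vertices makes every neighbour a successor and lets any vertex
  serve as the base point of the loop.\<close>

locale simple_polygon =
  fixes n :: nat and Z :: "nat \<Rightarrow> complex"
  assumes n3: "n \<ge> 3" and per: "\<And>i. Z (i + n) = Z i"
    and inj: "\<And>i j. Z i = Z j \<Longrightarrow> i mod n = j mod n"
    and simple: "\<And>i j. i mod n \<noteq> j mod n \<Longrightarrow>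
      closed_segment (Z i) (Z (Suc i)) \<inter> closed_segment (Z j) (Z (Suc j)) = {Z i, Z (Suc i)} \<inter> {Z j, Z (Suc j)}"
begin

definition bd :: "complex set" where "bd = (\<Union>j<n. closed_segment (Z j) (Z (Suc j)))"

lemma per_mult: "Z (i + k * n) = Z i"
proof (induction k)
  case (Suc k)
  then show ?case using per[of "i + k * n"] by (simp add: algebra_simps)
qed simp

lemma per_mod: "Z (i mod n) = Z i"
  using per_mult[of "i mod n" "i div n"] by simp

lemma Z_eq_iff: "Z i = Z j \<longleftrightarrow> i mod n = j mod n"
  using inj per_mod by metis

lemma segment_mod: "closed_segment (Z (i mod n)) (Z (Suc (i mod n))) = closed_segment (Z i) (Z (Suc i))"
  using per_mod per_mod[of "Suc (i mod n)"] per_mod[of "Suc i"] by (simp add: mod_Suc_eq)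

lemma segment_subset_bd: "closed_segment (Z i) (Z (Suc i)) \<subseteq> bd"
proof -
  have "i mod n < n" using n3 by simp
  then have "closed_segment (Z (i mod n)) (Z (Suc (i mod n))) \<subseteq> bd" unfolding bd_def by blast
  then show ?thesis unfolding segment_mod .
qed

lemma mod_shift_neq: "0 < k \<Longrightarrow> k < n \<Longrightarrow> (i + k) mod n \<noteq> i mod n"
  using mod_eq_dvd_iff_nat[of i "i + k" n] nat_dvd_not_less[of k n] by auto

text \<open>The bound \<open>m + 2 \<le> n\<close> leaves at least one side out, so the first edge
  meets the rest of the chain only at \<open>Z (Suc i)\<close> and the arcs can be joined.\<close>

lemma arc_chain: "m + 2 \<le> n \<Longrightarrow> arc (chain Z i m)"
proof (induction m arbitrary: i)
  case 0
  have "Z i \<noteq> Z (Suc i)" using mod_shift_neq[of 1 i] n3 Z_eq_iff by auto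
  then show ?case by simp
next
  case (Suc m)
  have ne: "Z i \<noteq> Z (Suc i)" using mod_shift_neq[of 1 i] n3 Z_eq_iff by auto
  have "closed_segment (Z i) (Z (Suc i)) \<inter> closed_segment (Z (Suc i + j)) (Z (Suc (Suc i + j))) \<subseteq> {Z (Suc i)}" if "j \<le> m" for j
  proof -
    have a: "(Suc i + j) mod n \<noteq> i mod n" "(Suc (Suc i + j)) mod n \<noteq> i mod n"
      using mod_shift_neq[of "Suc j" i] mod_shift_neq[of "Suc (Suc j)" i] that Suc.prems by auto
    then show ?thesis using simple[of i "Suc i + j"] Z_eq_iff by auto
  qed
  then have "path_image (linepath (Z i) (Z (Suc i))) \<inter> path_image (chain Z (Suc i) m) \<subseteq> {Z (Suc i)}"
    unfolding path_image_chain by auto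
  moreover have "arc (chain Z (Suc i) m)" using Suc by simp
  ultimately show ?case using ne by (auto intro!: arc_join)
qed

definition loop :: "nat \<Rightarrow> real \<Rightarrow> complex" where "loop i = chain Z i (n - 1)"

lemma loop_eq: "loop i = linepath (Z i) (Z (Suc i)) +++ chain Z (Suc i) (n - 2)"
proof -
  have "n - 1 = Suc (n - 2)" using n3 by simp
  then show ?thesis by (simp add: loop_def)
qed

lemma loop_ends: "pathstart (loop i) = Z i" "pathfinish (loop i) = Z i" "path (loop i)"
  using n3 per[of i] by (auto simp: loop_def)

lemma path_image_loop: "path_image (loop i) = bd"
proof
  show "path_image (loop i) \<subseteq> bd"
    unfolding loop_def path_image_chain using segment_subset_bd by blast
  show "bd \<subseteq> path_image (loop i)"
  proof
    fix x assume "x \<in> bd"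
    then obtain j where j: "j < n" "x \<in> closed_segment (Z j) (Z (Suc j))" by (auto simp: bd_def)
    \<comment> \<open>The residue of \<open>j - i\<close>, written with \<open>n - i mod n\<close>
      to stay within the natural numbers.\<close>
    define k where "k = (j + (n - i mod n)) mod n"
    have "(i + k) mod n = (i mod n + (j + (n - i mod n))) mod n"
      unfolding k_def by (metis mod_add_eq mod_add_left_eq mod_mod_trivial)
    also have "i mod n + (j + (n - i mod n)) = j + n" using n3 mod_less_divisor[of n i] by linarith
    finally have "(i + k) mod n = j mod n" by simp
    then have "closed_segment (Z (i + k)) (Z (Suc (i + k))) = closed_segment (Z j) (Z (Suc j))"
      using segment_mod by metis
    moreover have "k \<le> n - 1" using n3 by (simp add: k_def Suc_leI less_Suc_eq_le[symmetric])
    ultimately show "x \<in> path_image (loop i)"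
      unfolding loop_def path_image_chain using j by blast
  qed
qed

lemma simple_loop: "simple_path (loop i)"
  unfolding loop_eq
proof (rule simple_path_join_loop)
  show "arc (linepath (Z i) (Z (Suc i)))" using arc_chain[of 0 i] n3 by simp
  show "arc (chain Z (Suc i) (n - 2))" using arc_chain[of "n-2" "Suc i"] n3 by simp
  show "pathfinish (linepath (Z i) (Z (Suc i))) = pathstart (chain Z (Suc i) (n - 2))" by simp
  show "pathfinish (chain Z (Suc i) (n - 2)) = pathstart (linepath (Z i) (Z (Suc i)))"
    using loop_ends(2)[of i] unfolding loop_eq by simp
  have "closed_segment (Z i) (Z (Suc i)) \<inter> closed_segment (Z (Suc i + j)) (Z (Suc (Suc i + j))) \<subseteq> {Z i, Z (Suc i)}" if "j \<le> n - 2" for j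
  proof -
    have "(Suc i + j) mod n \<noteq> i mod n" using mod_shift_neq[of "Suc j" i] that n3 by auto
    then show ?thesis using simple[of i "Suc i + j"] by auto
  qed
  then show "path_image (linepath (Z i) (Z (Suc i))) \<inter> path_image (chain Z (Suc i) (n - 2))
      \<subseteq> {pathstart (linepath (Z i) (Z (Suc i))), pathstart (chain Z (Suc i) (n - 2))}"
    unfolding path_image_chain by auto
qed

text \<open>The winding number of the loop as a sum over sides: it refers to no base point, so loops
  starting at different vertices can be compared through it.\<close>

definition wsum :: "complex \<Rightarrow> complex" where
  "wsum x = (\<Sum>j<n. winding_number (linepath (Z j) (Z (Suc j))) x)"

lemma wsum_loop0: "x \<notin> bd \<Longrightarrow> winding_number (loop 0) x = wsum x"
  using winding_number_chain[of x Z 0 "n - 1"] path_image_loop[of 0] n3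
  by (simp add: loop_def wsum_def lessThan_Suc_atMost[symmetric])

lemma wsum_shift: "wsum x = (\<Sum>j<n. winding_number (linepath (Z (i + j)) (Z (Suc (i + j)))) x)"
proof (induction i)
  case (Suc i)
  obtain m where m: "n = Suc m" using n3 by (cases n) auto
  let ?f = "\<lambda>j. winding_number (linepath (Z j) (Z (Suc j))) x"
  have "(\<Sum>j<n. ?f (Suc i + j)) + ?f i = (\<Sum>j<n. ?f (i + j)) + ?f (i + n)"
    using sum.lessThan_Suc_shift[of "\<lambda>j. ?f (i + j)" n] by (simp add: add.commute)
  moreover have "?f (i + n) = ?f i" using per[of i] per[of "Suc i"] by simp
  ultimately show ?case using Suc by simp
qed (simp add: wsum_def)

lemma wsum_loop: "x \<notin> bd \<Longrightarrow> winding_number (loop i) x = wsum x"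
  using winding_number_chain[of x Z i "n - 1"] path_image_loop[of i] n3 wsum_shift[of x i]
  by (simp add: loop_def lessThan_Suc_atMost[symmetric])

text \<open>The Jordan curve theorem for the loop; the sign \<open>s\<close> is the orientation in
  which the vertices are listed.\<close>

lemma wsum_cases:
  obtains s where "s \<in> {1, -1 :: real}" "\<And>x. x \<in> inside bd \<Longrightarrow> wsum x = of_real s"
    "\<And>x. x \<notin> bd \<Longrightarrow> x \<notin> inside bd \<Longrightarrow> wsum x = 0"
proof -
  have out: "wsum x = 0" if "x \<notin> bd" "x \<notin> inside bd" for x
  proof -
    have "x \<in> outside bd" using that by (metis ComplI UnE inside_Un_outside)
    then show ?thesis using winding_number_zero_in_outside[of "loop 0" x] loop_ends[of 0] path_image_loop[of 0] wsum_loop0[OF that(1)] by simp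
  qed
  have nb: "x \<notin> bd" if "x \<in> inside bd" for x using that inside_no_overlap by blast
  show thesis
  proof (rule simple_closed_path_winding_number_inside[OF simple_loop[of 0]])
    assume "\<And>z. z \<in> inside (path_image (loop 0)) \<Longrightarrow> winding_number (loop 0) z = 1"
    then show thesis using that[of 1] out nb wsum_loop0 by (simp add: path_image_loop)
  next
    assume "\<And>z. z \<in> inside (path_image (loop 0)) \<Longrightarrow> winding_number (loop 0) z = -1"
    then show thesis using that[of "-1"] out nb wsum_loop0 by (simp add: path_image_loop)
  qed
qed

lemma Jordan_bd: "frontier (inside bd) = bd" "frontier (outside bd) = bd" "inside bd \<noteq> {}" "open (inside bd)"
  "connected (inside bd)" "bounded (inside bd)" "compact bd"
  using Jordan_inside_outside[OF simple_loop[of 0]] loop_ends[of 0] compact_path_image[of "loop 0"]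
  by (auto simp: path_image_loop)

text \<open>Cutting off the vertex \<open>v\<close>: near \<open>v\<close> the winding number of the shortened polygon is constant, so the one
  of the polygon jumps by the orientation of the triangle when \<open>v\<close> is crossed.\<close>

lemma winding_at_vertex:
  assumes nc: "Z (Suc i) \<notin> closed_segment (Z (Suc (Suc i))) (Z i)"
  obtains e where "e > 0"
    "ball (Z (Suc i)) e \<inter> bd \<subseteq> closed_segment (Z i) (Z (Suc i)) \<union> closed_segment (Z (Suc i)) (Z (Suc (Suc i)))"
    "\<And>x y. x \<in> ball (Z (Suc i)) e - bd \<Longrightarrow> y \<in> ball (Z (Suc i)) e - bd \<Longrightarrow>
    wsum x - winding_number (linepath (Z i) (Z (Suc i)) +++ linepath (Z (Suc i)) (Z (Suc (Suc i))) +++ linepath (Z (Suc (Suc i))) (Z i)) x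
  = wsum y - winding_number (linepath (Z i) (Z (Suc i)) +++ linepath (Z (Suc i)) (Z (Suc (Suc i))) +++ linepath (Z (Suc (Suc i))) (Z i)) y"
proof -
  let ?p = "Z i" and ?v = "Z (Suc i)" and ?q = "Z (Suc (Suc i))"
  \<comment> \<open>From \<open>Z (Suc (Suc i))\<close> back to \<open>Z i\<close> there are
    \<open>n - 2\<close> edges, hence the parameter \<open>n - 3\<close>.\<close>
  let ?c = "chain Z (Suc (Suc i)) (n - 3)"
  let ?g = "linepath ?p ?q +++ ?c"
  have fin: "pathfinish ?c = ?p" using per[of i] n3 by (simp add: numeral_3_eq_3 Suc_diff_Suc)
  have "?v \<notin> path_image ?c"
  proof
    assume "?v \<in> path_image ?c"
    then obtain j where j: "j \<le> n - 3" "?v \<in> closed_segment (Z (Suc (Suc i) + j)) (Z (Suc (Suc (Suc i) + j)))"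
      unfolding path_image_chain by auto
    have a: "(Suc i + Suc j) mod n \<noteq> Suc i mod n" "(Suc i + Suc (Suc j)) mod n \<noteq> Suc i mod n"
      using mod_shift_neq[of "Suc j" "Suc i"] mod_shift_neq[of "Suc (Suc j)" "Suc i"] j n3 by auto
    have "?v \<in> {?v, ?q} \<inter> {Z (Suc (Suc i) + j), Z (Suc (Suc (Suc i) + j))}"
      using simple[of "Suc i" "Suc (Suc i) + j"] j a by auto
    then show False using a Z_eq_iff by auto
  qed
  moreover have "?v \<notin> closed_segment ?p ?q" using nc by (simp add: closed_segment_commute)
  ultimately have "?v \<notin> path_image ?g" by (auto simp: path_image_join)
  moreover have pg: "path ?g" "pathfinish ?g = pathstart ?g" using fin by auto
  ultimately obtain e where e: "e > 0" "ball ?v e \<subseteq> - path_image ?g"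
    using open_contains_ball[of "- path_image ?g"] closed_path_image[OF pg(1)] by (metis ComplI open_Compl)
  have lp: "loop i = linepath ?p ?v +++ (linepath ?v ?q +++ ?c)"
    using n3 unfolding loop_eq by (simp add: numeral_3_eq_3 numeral_2_eq_2 Suc_diff_Suc[symmetric])
  have near: "ball ?v e \<inter> bd \<subseteq> closed_segment ?p ?v \<union> closed_segment ?v ?q"
    using e(2) path_image_loop[of i] unfolding lp by (auto simp: path_image_join)
  have key: "wsum x - winding_number (linepath ?p ?v +++ linepath ?v ?q +++ linepath ?q ?p) x = winding_number ?g x"
    if x: "x \<in> ball ?v e - bd" for x
  proof -
    have xi: "x \<notin> closed_segment ?p ?v" "x \<notin> closed_segment ?v ?q" using x segment_subset_bd by auto
    have xg: "x \<notin> path_image ?g" using x e by auto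
    then have xp: "x \<notin> closed_segment ?p ?q" "x \<notin> closed_segment ?q ?p" and xc: "x \<notin> path_image ?c"
      by (auto simp: path_image_join closed_segment_commute)
    have D: "winding_number (linepath ?q ?p) x = - winding_number (linepath ?p ?q) x"
      using winding_number_reversepath[of "linepath ?p ?q" x] xp by simp
    have T: "winding_number (linepath ?p ?v +++ linepath ?v ?q +++ linepath ?q ?p) x
        = winding_number (linepath ?p ?v) x + (winding_number (linepath ?v ?q) x + winding_number (linepath ?q ?p) x)"
      using xi xp by (simp add: winding_number_join path_image_join)
    have G: "winding_number ?g x = winding_number (linepath ?p ?q) x + winding_number ?c x"
      using xp xc by (simp add: winding_number_join)
    have L: "wsum x = winding_number (linepath ?p ?v) x + winding_number (linepath ?v ?q) x + winding_number ?c x"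
    proof -
      show ?thesis using lp xi xc x wsum_loop[of x i] by (simp add: winding_number_join path_image_join add.assoc)
    qed
    show ?thesis unfolding T G L D by simp
  qed
  show thesis
  proof (rule that[OF e(1) near])
    fix x y assume "x \<in> ball ?v e - bd" "y \<in> ball ?v e - bd"
    moreover have "winding_number ?g x = winding_number ?g y"
      by (rule winding_number_eq[OF pg, of _ "ball ?v e"]) (use calculation e in auto)
    ultimately show "wsum x - winding_number (linepath ?p ?v +++ linepath ?v ?q +++ linepath ?q ?p) x =
      wsum y - winding_number (linepath ?p ?v +++ linepath ?v ?q +++ linepath ?q ?p) y"
      using key by simp
  qed
qed

end

section \<open>The area of a polygon\<close>

definition vc :: "real^2 \<Rightarrow> complex" where "vc x = Complex (x $ 1) (x $ 2)"
text \<open>From the Klein to the Poincare disc.\<close>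

definition klp :: "complex \<Rightarrow> complex" where "klp z = z / of_real (1 + sqrt (1 - (cmod z)\<^sup>2))"

lemma norm_vc [simp]: "cmod (vc x) = norm x"
  by (simp add: vc_def complex_norm norm_vec_def L2_set_def sum_2)

lemma inner_vc: "x \<bullet> y = Re (cnj (vc x) * vc y)"
  by (simp add: vc_def inner_vec_def sum_2)

lemma linear_vc: "linear vc"
  by (rule linearI) (auto simp: vc_def complex_eq_iff)

lemma vc_eq_iff [simp]: "vc x = vc y \<longleftrightarrow> x = y"
  by (simp add: vc_def vec_eq_iff forall_2)

section \<open>The Riemannian area of triangles with a vertex at the centre\<close>

lemma klp_bound:
  assumes "cmod z < 1" shows "cmod (klp z) < 1"
proof -
  have "(cmod z)\<^sup>2 < 1" by (rule disc_sq[OF assms])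
  then have "sqrt (1 - (cmod z)\<^sup>2) > 0" by simp
  then have "cmod z < \<bar>1 + sqrt (1 - (cmod z)\<^sup>2)\<bar>" using assms by linarith
  then show ?thesis unfolding klp_def norm_divide norm_of_real by (subst divide_less_eq_1_pos) auto
qed

lemma Im_Ln_real_mult: "r > 0 \<Longrightarrow> z \<noteq> 0 \<Longrightarrow> Im (Ln (of_real r * z)) = Im (Ln z)"
  by (simp add: Ln_times_of_real)

text \<open>The denominators of \<open>klp\<close> are positive, so clearing them leaves the
  argument of the kernel unchanged; the resulting \<open>W\<close> is easier to differentiate along
  a Klein segment.\<close>

lemma parea_klp:
  assumes "cmod a < 1" "cmod b < 1"
  defines "W \<equiv> of_real ((1 + sqrt (1 - (cmod a)\<^sup>2)) * (1 + sqrt (1 - (cmod b)\<^sup>2))) - cnj a * b"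
  shows "parea (klp a) (klp b) = - 2 * Im (Ln W)" "Re W > 0"
proof -
  define r where "r = (1 + sqrt (1 - (cmod a)\<^sup>2)) * (1 + sqrt (1 - (cmod b)\<^sup>2))"
  have "sqrt (1 - (cmod a)\<^sup>2) \<ge> 0" "sqrt (1 - (cmod b)\<^sup>2) \<ge> 0"
    using assms(1,2) disc_sq[of a] disc_sq[of b] by auto
  then have pos: "1 + sqrt (1 - (cmod a)\<^sup>2) > 0" "1 + sqrt (1 - (cmod b)\<^sup>2) > 0" by linarith+
  then have r: "r > 0" unfolding r_def by simp
  have "of_real (1 + sqrt (1 - (cmod a)\<^sup>2)) \<noteq> (0::complex)" "of_real (1 + sqrt (1 - (cmod b)\<^sup>2)) \<noteq> (0::complex)"
    unfolding of_real_eq_0_iff using pos by linarith+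
  then have W: "W = of_real r * (1 - cnj (klp a) * klp b)"
    unfolding W_def klp_def r_def of_real_mult by (simp add: field_simps del: of_real_add)
  have p: "Re (1 - cnj (klp a) * klp b) > 0" by (intro pker_Re_pos klp_bound assms(1,2))
  then show "Re W > 0" unfolding W Re_complex_of_real using r by simp
  show "parea (klp a) (klp b) = - 2 * Im (Ln W)"
    unfolding W parea_def using Im_Ln_real_mult[OF r pker_nz[OF klp_bound[OF assms(1)] klp_bound[OF assms(2)]]] by simp
qed

text \<open>The rate at which the area of the triangle \<open>0\<close>, \<open>a\<close>,
  \<open>p\<close> grows as \<open>p\<close> runs along the Klein segment. It has to match the
  density integrated over the ray from \<open>0\<close> to \<open>p\<close>, which
  \<open>radial_density_integral\<close> evaluates to the same expression;
  \<open>Im (cnj a * b)\<close> is the constant factor of the Jacobian.\<close>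

lemma parea_segment_deriv:
  fixes a b :: complex and t :: real
  assumes "cmod a < 1" "cmod (a + of_real t * (b - a)) < 1"
  defines "k \<equiv> sqrt (1 - (cmod (a + of_real t * (b - a)))\<^sup>2)"
  shows "((\<lambda>t. parea (klp a) (klp (a + of_real t * (b - a)))) has_real_derivative
     Im (cnj a * b) / ((1 + k) * k)) (at t)"
proof -
  define p where "p s = a + of_real s * (b - a)" for s :: real
  define d where "d = b - a"
  define K where "K s = sqrt (1 - (cmod (p s))\<^sup>2)" for s
  define ka where "ka = sqrt (1 - (cmod a)\<^sup>2)"
  define \<alpha> where "\<alpha> = 1 + ka"
  define D where "D = Im (cnj a * b)"
  define pd where "pd = Re (cnj (p t) * d)"
  have k: "k > 0" "k\<^sup>2 = 1 - (cmod (p t))\<^sup>2" using disc_sq[OF assms(2)] by (auto simp: k_def p_def)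
  have ka: "ka \<ge> 0" "ka\<^sup>2 = 1 - (cmod a)\<^sup>2" using disc_sq[OF assms(1)] by (auto simp: ka_def)
  have Kt: "K t = k" by (simp add: K_def k_def p_def)
  have q: "((\<lambda>s. 1 - (cmod (p s))\<^sup>2) has_real_derivative - 2 * pd) (at t)"
    unfolding cmod_power2 p_def pd_def d_def
    by (auto intro!: derivative_eq_intros simp: algebra_simps)
  have K': "(K has_real_derivative - pd / k) (at t)"
    unfolding K_def
    by (rule DERIV_cong[OF DERIV_chain2[OF DERIV_real_sqrt q]]) (use k in \<open>auto simp: K_def[symmetric] Kt field_simps\<close>, simp add: k_def p_def field_simps)
  define W where "W s = of_real (\<alpha> * (1 + K s)) - cnj a * p s" for s
  have W': "(W has_vector_derivative (of_real (\<alpha> * (- pd / k)) - cnj a * d)) (at t)"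
  proof -
    have "((\<lambda>s. \<alpha> * (1 + K s)) has_real_derivative \<alpha> * (- pd / k)) (at t)"
      by (auto intro!: derivative_eq_intros K')
    then have 1: "((\<lambda>s. of_real (\<alpha> * (1 + K s)) :: complex) has_vector_derivative of_real (\<alpha> * (- pd / k))) (at t)"
      by (rule has_vector_derivative_of_real) 
    have 2: "((\<lambda>s. cnj a * p s) has_vector_derivative cnj a * d) (at t)"
      unfolding p_def d_def by (auto intro!: derivative_eq_intros)
    show ?thesis unfolding W_def by (rule has_vector_derivative_diff[OF 1 2])
  qed
  have W0: "Re (W t) > 0" using parea_klp(2)[OF assms(1,2)] by (simp add: W_def \<alpha>_def ka_def K_def p_def)
  have L: "((Ln \<circ> W) has_vector_derivative (of_real (\<alpha> * (- pd / k)) - cnj a * d) * inverse (W t)) (at t)"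
    by (rule field_vector_diff_chain_at[OF W' has_field_derivative_Ln]) (use W0 in \<open>auto simp: complex_nonpos_Reals_iff\<close>)
  define V where "V = of_real (\<alpha> * (- pd / k)) - cnj a * d"
  have I: "((\<lambda>s. - 2 * Im (Ln (W s))) has_real_derivative - 2 * Im (V * inverse (W t))) (at t)"
    using DERIV_cmult[of _ _ _ _ "-2", OF bounded_linear.has_vector_derivative[OF bounded_linear_Im L, folded has_real_derivative_iff_has_vector_derivative]]
    unfolding V_def by simp
  have W2: "(cmod (W t))\<^sup>2 > 0" using W0 by auto
  have Im: "Im (V * inverse (W t)) = Im (V * cnj (W t)) / (cmod (W t))\<^sup>2"
  proof -
    have "V * inverse (W t) = V * cnj (W t) / of_real ((cmod (W t))\<^sup>2)"
      using complex_div_cnj[of V "W t"] by (simp add: divide_inverse)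
    then show ?thesis by (simp only: Im_divide_of_real)
  qed
  have N: "k * Im (V * cnj (W t)) = \<alpha> * D * (- pd * t - (1 + k) * k + (2 - \<alpha>) * k)"
  proof -
    have aa: "(cmod a)\<^sup>2 = \<alpha> * (2 - \<alpha>)" using ka by (simp add: \<alpha>_def power2_eq_square algebra_simps)
    have 1: "Im (cnj (W t)) = t * D" "Re (cnj (W t)) = \<alpha> * (1 + k) - Re (cnj a * p t)"
      by (simp_all add: W_def Kt D_def p_def algebra_simps)
    have 2: "Im V = - D" "Re V = - \<alpha> * pd / k - Re (cnj a * d)"
      by (simp_all add: V_def D_def d_def algebra_simps)
    have 3: "Re (cnj a * p t) = (cmod a)\<^sup>2 + t * Re (cnj a * d)"
      unfolding cmod_power2 by (simp add: p_def d_def algebra_simps power2_eq_square)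
    have "k * Im (V * cnj (W t)) = (k * Re V) * (t * D) - k * D * Re (cnj (W t))"
      unfolding times_complex.sel(2) 1(1) 2(1) by (simp add: algebra_simps)
    also have "k * Re V = - \<alpha> * pd - k * Re (cnj a * d)" unfolding 2 using k by (simp add: field_simps)
    finally show ?thesis unfolding 1(2) 3 aa by (simp add: algebra_simps)
  qed
  have M: "(cmod (W t))\<^sup>2 = 2 * \<alpha> * (1 + k) * (1 + ka * k - Re (cnj a * p t))"
  proof -
    have "(cmod (W t))\<^sup>2 = (\<alpha> * (1 + k))\<^sup>2 - 2 * (\<alpha> * (1 + k)) * Re (cnj a * p t) + (cmod a)\<^sup>2 * (cmod (p t))\<^sup>2"
      unfolding W_def Kt cmod_power2 by (simp add: algebra_simps power2_eq_square)
    also have "(cmod a)\<^sup>2 = 1 - ka\<^sup>2" using ka by simp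
    also have "(cmod (p t))\<^sup>2 = 1 - k\<^sup>2" using k by simp
    finally show ?thesis unfolding \<alpha>_def by (simp add: algebra_simps power2_eq_square)
  qed
  have X: "(- pd * t - (1 + k) * k + (2 - \<alpha>) * k) = - (1 + ka * k - Re (cnj a * p t))"
  proof -
    have "(cmod (p t))\<^sup>2 = Re (cnj a * p t) + t * pd"
      unfolding cmod_power2 by (simp add: p_def pd_def d_def algebra_simps power2_eq_square)
    then show ?thesis using k(2) by (simp add: \<alpha>_def algebra_simps power2_eq_square)
  qed
  \<comment> \<open>\<open>E\<close> occurs both in \<open>Im (V * cnj (W t))\<close> and in
    \<open>(cmod (W t))^2\<close>; its cancellation leaves only \<open>D\<close> and
    \<open>k\<close>.\<close>
  define E where "E = 1 + ka * k - Re (cnj a * p t)"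
  have N': "k * Im (V * cnj (W t)) = - (\<alpha> * D * E)" by (simp only: N X E_def mult_minus_right)
  have M': "(cmod (W t))\<^sup>2 = 2 * \<alpha> * (1 + k) * E" by (simp only: M E_def)
  have "- 2 * Im (V * inverse (W t)) = D / ((1 + k) * k)"
  proof -
  have "\<alpha> * E \<noteq> 0" using W2 unfolding M' by auto
  moreover have "Im (V * cnj (W t)) = - (\<alpha> * D * E) / k" using N' k by (simp add: field_simps)
  ultimately show ?thesis
    unfolding Im M' using k by (simp only: divide_divide_eq_left) (simp add: divide_simps)
  qed
  then have "((\<lambda>s. - 2 * Im (Ln (W s))) has_real_derivative D / ((1 + k) * k)) (at t)" using I by simp
  moreover have "\<forall>\<^sub>F s in nhds t. - 2 * Im (Ln (W s)) = parea (klp a) (klp (p s))"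
  proof -
    have "continuous (at t) (\<lambda>s. cmod (p s))" unfolding p_def by (intro continuous_intros)
    then have "(\<lambda>s. cmod (p s)) \<midarrow>t\<rightarrow> cmod (p t)" by (simp add: continuous_at)
    then have "\<forall>\<^sub>F s in at t. cmod (p s) < 1" using assms(2) by (auto simp: p_def intro: order_tendstoD)
    then have "\<forall>\<^sub>F s in nhds t. cmod (p s) < 1" using assms(2) by (simp add: eventually_nhds_conv_at p_def)
    then show ?thesis
      by eventually_elim (use parea_klp(1)[OF assms(1)] in \<open>simp add: W_def \<alpha>_def ka_def K_def\<close>)
  qed
  ultimately show ?thesis unfolding D_def p_def
    by (subst DERIV_cong_ev[OF refl _ refl, symmetric]) auto
qed

lemma radial_density_integral:
  fixes q :: real
  assumes "0 \<le> q" "q < 1"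
  shows "((\<lambda>s. s / sqrt ((1 - s\<^sup>2 * q) ^ 3)) has_integral 1 / ((1 + sqrt (1 - q)) * sqrt (1 - q))) {0..1}"
proof -
  define w where "w s = sqrt (1 - s\<^sup>2 * q)" for s
  have pos: "1 - s\<^sup>2 * q > 0" if "s \<in> {0..1}" for s
  proof -
    have "s\<^sup>2 * q \<le> 1 * q" using that assms by (intro mult_right_mono) (auto simp: power_le_one)
    then show ?thesis using assms by linarith
  qed
  \<comment> \<open>This antiderivative equals \<open>(1 / w s - 1) / q\<close>; in the form with
    \<open>s^2\<close> in the numerator it makes sense for \<open>q = 0\<close> too.\<close>
  have der: "((\<lambda>s. s\<^sup>2 / ((1 + w s) * w s)) has_real_derivative s / sqrt ((1 - s\<^sup>2 * q) ^ 3)) (at s within {0..1})"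
    if s: "s \<in> {0..1}" for s
  proof -
    have w: "w s > 0" "(w s)\<^sup>2 = 1 - s\<^sup>2 * q" using pos[OF s] by (auto simp: w_def)
    have w': "(w has_real_derivative - s * q / w s) (at s within {0..1})"
    proof -
      have "((\<lambda>s. 1 - s\<^sup>2 * q) has_real_derivative - 2 * s * q) (at s within {0..1})"
        by (auto intro!: derivative_eq_intros)
      from DERIV_chain2[where f = sqrt, OF DERIV_real_sqrt[OF pos[OF s]] this] show ?thesis
        unfolding w_def by (rule DERIV_cong) (simp add: field_simps)
    qed
    have "sqrt ((1 - s\<^sup>2 * q) ^ 3) = w s ^ 3" by (simp add: w_def real_sqrt_power)
    moreover have "((\<lambda>s. s\<^sup>2 / ((1 + w s) * w s)) has_real_derivative
       (2 * s * ((1 + w s) * w s) - s\<^sup>2 * ((- s * q / w s) * w s + (1 + w s) * (- s * q / w s))) / ((1 + w s) * w s)\<^sup>2) (at s within {0..1})"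
      using w by (auto intro!: derivative_eq_intros w' simp: power2_eq_square)
    moreover have "(2 * s * ((1 + w s) * w s) - s\<^sup>2 * ((- s * q / w s) * w s + (1 + w s) * (- s * q / w s))) / ((1 + w s) * w s)\<^sup>2 = s / w s ^ 3"
    proof -
      define u where "u = w s"
      have u: "u > 0" "s\<^sup>2 * q = 1 - u\<^sup>2" using w by (auto simp: u_def)
      have "2 * s * ((1 + u) * u) - s\<^sup>2 * ((- s * q / u) * u + (1 + u) * (- s * q / u))
        = s * (2 * ((1 + u) * u) + (s\<^sup>2 * q) * (1 + (1 + u) / u))"
        using u(1) by (simp add: field_simps power2_eq_square)
      also have "\<dots> = s * (1 + u)\<^sup>2 / u"
        unfolding u(2) using u(1) by (simp add: field_simps power2_eq_square)
      finally show ?thesis unfolding u_def[symmetric] using u(1)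
        by (simp add: power_mult_distrib power2_eq_square power3_eq_cube)
    qed
    ultimately show ?thesis by simp
  qed
  have "((\<lambda>s. s / sqrt ((1 - s\<^sup>2 * q) ^ 3)) has_integral (1\<^sup>2 / ((1 + w 1) * w 1)) - (0\<^sup>2 / ((1 + w 0) * w 0))) {0..1}"
    by (rule fundamental_theorem_of_calculus) (use der in \<open>auto simp: has_real_derivative_iff_has_vector_derivative[symmetric]\<close>)
  then show ?thesis by (simp add: w_def)
qed

lemma exists_two: "(\<exists>i::2. P i) \<longleftrightarrow> P 1 \<or> P 2"
  by (metis exhaust_2)

text \<open>The change of variables lives on \<open>real^2\<close> and iterated integration on
  pairs; this passes from one to the other. The components are exchanged so that the inner integral
  runs over the first coordinate, the radial one.\<close>

lemma has_integral_vec2_prod: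
  fixes f :: "real^2 \<Rightarrow> real"
  assumes "(f has_integral i) (cbox 0 1)"
  shows "((\<lambda>y. f (vector [snd y, fst y])) has_integral i) (cbox (0,0) (1,1))"
proof -
  define g :: "real \<times> real \<Rightarrow> real^2" where "g y = vector [snd y, fst y]" for y
  define h :: "real^2 \<Rightarrow> real \<times> real" where "h x = (x $ 2, x $ 1)" for x
  have hg: "h (g y) = y" for y by (simp add: h_def g_def)
  have gh: "g (h x) = x" for x by (simp add: h_def g_def vec_eq_iff forall_2)
  have gb: "g ` cbox u v = cbox (g u) (g v)" for u v
  proof
    show "g ` cbox u v \<subseteq> cbox (g u) (g v)"
      by (cases u; cases v) (auto simp: g_def mem_box_cart forall_2 cbox_Pair_eq)
    show "cbox (g u) (g v) \<subseteq> g ` cbox u v"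
    proof
      fix x assume "x \<in> cbox (g u) (g v)"
      then have "h x \<in> cbox u v" by (cases u; cases v) (auto simp: g_def h_def mem_box_cart forall_2 cbox_Pair_eq)
      then show "x \<in> g ` cbox u v" using gh by (metis image_eqI)
    qed
  qed
  have hb: "h ` cbox u v = cbox (h u) (h v)" for u v
  proof -
    have "cbox u v = g ` cbox (h u) (h v)" unfolding gb gh ..
    then show ?thesis by (simp add: image_image hg)
  qed
  have cont: "measure lborel (g ` cbox u v) = 1 * measure lborel (cbox u v)" for u v
  proof -
    have 1: "measure lborel (cbox (g u) (g v)) = (if cbox (g u) (g v) = {} then 0 else (\<Prod>i\<in>UNIV. g v $ i - g u $ i))"
      by (rule content_cbox_if_cart)
    have "measure lborel (cbox u v) = measure lborel (cbox (fst u) (fst v)) * measure lborel (cbox (snd u) (snd v))"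
      by (metis content_Pair prod.collapse)
    moreover have "cbox (g u) (g v) = {} \<longleftrightarrow> fst v < fst u \<or> snd v < snd u"
      by (auto simp: interval_eq_empty_cart g_def exists_two)
    ultimately show ?thesis unfolding gb 1 by (auto simp: g_def UNIV_2 content_real_if)
  qed
  have "((\<lambda>y. f (g y)) has_integral (1 / 1) *\<^sub>R i) (h ` cbox 0 1)"
  proof (rule has_integral_twiddle)
    show "continuous (at x) g" for x
    proof -
      have "linear g" by (rule linearI) (auto simp: g_def vec_eq_iff forall_2)
      then show ?thesis by (simp add: linear_continuous_at linear_conv_bounded_linear)
    qed
    show "\<exists>w z. g ` cbox u v = cbox w z" "\<exists>w z. h ` cbox u' v' = cbox w z" for u v u' v'
      using gb hb by blast+
  qed (use hg gh cont assms in auto)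
  moreover have "h ` cbox 0 1 = cbox (0,0) (1,1)" unfolding hb by (simp add: h_def)
  ultimately show ?thesis by (simp add: g_def)
qed

lemma vc_simps [simp]:
  "vc (x + y) = vc x + vc y" "vc (x - y) = vc x - vc y" "vc (c *\<^sub>R x) = of_real c * vc x" "vc 0 = 0"
  by (auto simp: vc_def complex_eq_iff)

lemma hyp_density_continuous: "continuous_on hyp_plane hyp_density"
proof -
  have "(norm x)\<^sup>2 < 1" if "x \<in> hyp_plane" for x :: "real^2"
    using that by (simp add: hyp_plane_def abs_square_less_1)
  then have "continuous_on hyp_plane (\<lambda>x. 1 / sqrt ((1 - (norm x)\<^sup>2) ^ 3))"
    by (intro continuous_intros) fastforce
  then show ?thesis using hyp_density_eq by (subst continuous_on_cong[OF refl]) auto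
qed

lemma negligible_segment2: "negligible (closed_segment a (b::real^2))"
  by (simp add: negligible_convex_interior interior_closed_segment_ge2)

lemma segment_in_hyp_plane:
  "a \<in> hyp_plane \<Longrightarrow> b \<in> hyp_plane \<Longrightarrow> 0 \<le> t \<Longrightarrow> t \<le> 1 \<Longrightarrow> a + t *\<^sub>R (b - a) \<in> hyp_plane"
proof -
  assume a: "a \<in> hyp_plane" "b \<in> hyp_plane" "0 \<le> t" "t \<le> 1"
  have "a + t *\<^sub>R (b - a) = (1 - t) *\<^sub>R a + t *\<^sub>R b" by (simp add: algebra_simps)
  then show ?thesis using a convexD_alt[OF convex_ball[of 0 1], of a b t] by (simp add: hyp_plane_def)
qed

lemma parea_klp_collinear:
  assumes "cmod a < 1" "cmod b < 1" "Im (cnj a * b) = 0"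
  shows "parea (klp a) (klp b) = 0"
proof -
  define W where "W = of_real ((1 + sqrt (1 - (cmod a)\<^sup>2)) * (1 + sqrt (1 - (cmod b)\<^sup>2))) - cnj a * b"
  have "Im W = 0" using assms(3) by (simp add: W_def)
  then have "Im (Ln W) = 0" using parea_klp(2)[OF assms(1,2), folded W_def] Im_Ln_eq_0[of W]
    by (metis less_irrefl zero_complex.sel(1))
  then show ?thesis using parea_klp(1)[OF assms(1,2), folded W_def] by simp
qed

text \<open>The integral is computed in polar coordinates adapted to the triangle.\<close>

lemma triangle_area_aux:
  fixes a b :: "real^2"
  assumes ab: "a \<in> hyp_plane" "b \<in> hyp_plane" and D: "D = Im (cnj (vc a) * vc b)" "D \<noteq> 0"
  shows "(hyp_density has_integral sgn D * parea (klp (vc a)) (klp (vc b))) (convex hull {0, a, b})"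
proof -
  \<comment> \<open>The parameters are the fraction \<open>y $ 1\<close> of the way from
    \<open>0\<close> to the opposite side and the position \<open>y $ 2\<close> on that side; the
    Jacobian is \<open>y $ 1 * D\<close>.\<close>
  define g :: "real^2 \<Rightarrow> real^2" where "g y = (y $ 1) *\<^sub>R (a + (y $ 2) *\<^sub>R (b - a))" for y
  define g' :: "real^2 \<Rightarrow> real^2 \<Rightarrow> real^2" where
    "g' y h = (h $ 1) *\<^sub>R (a + (y $ 2) *\<^sub>R (b - a)) + ((y $ 1) * (h $ 2)) *\<^sub>R (b - a)" for y h
  have D': "D = a $ 1 * b $ 2 - a $ 2 * b $ 1" by (simp add: D(1) vc_def)
  define p where "p t = a + t *\<^sub>R (b - a)" for t
  have p: "p t \<in> hyp_plane" if "0 \<le> t" "t \<le> 1" for t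
    unfolding p_def using segment_in_hyp_plane[OF ab that] .
  define F where "F y = \<bar>y $ 1 * D\<bar> * hyp_density (g y)" for y :: "real^2"
  have gin: "g y \<in> hyp_plane" if "y \<in> cbox 0 1" for y
  proof -
    have y: "0 \<le> y $ 1" "y $ 1 \<le> 1" "0 \<le> y $ 2" "y $ 2 \<le> 1" using that by (auto simp: mem_box_cart forall_2)
    have "norm (g y) \<le> 1 * norm (p (y $ 2))" unfolding g_def p_def[symmetric] using y by (simp add: mult_left_le_one_le)
    also have "\<dots> < 1" using p[OF y(3,4)] by (simp add: hyp_plane_def)
    finally show ?thesis by (simp add: hyp_plane_def)
  qed
  have contg: "continuous_on S g" for S unfolding g_def by (intro continuous_intros)
  have contF: "continuous_on (cbox 0 1) F" unfolding F_def
    by (intro continuous_intros continuous_on_compose2[OF hyp_density_continuous contg]) (use gin in auto)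
  define A where "A = \<bar>D\<bar> * (1 / D) * parea (klp (vc a)) (klp (vc b))"
  have inner: "integral {0..1} (\<lambda>s. F (vector [s, t])) = \<bar>D\<bar> / ((1 + sqrt (1 - (norm (p t))\<^sup>2)) * sqrt (1 - (norm (p t))\<^sup>2))"
    if t: "t \<in> {0..1}" for t
  proof -
    let ?q = "(norm (p t))\<^sup>2"
    have q: "0 \<le> ?q" "?q < 1" using p[of t] t by (auto simp: hyp_plane_def abs_square_less_1)
    have "F (vector [s, t]) = \<bar>D\<bar> * (s / sqrt ((1 - s\<^sup>2 * ?q) ^ 3))" if s: "s \<in> {0..1}" for s
    proof -
      have "vector [s, t] \<in> cbox (0::real^2) 1" using s t by (simp add: mem_box_cart forall_2)
      then have "hyp_density (g (vector [s, t])) = 1 / sqrt ((1 - (norm (g (vector [s, t])))\<^sup>2) ^ 3)"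
        using gin hyp_density_eq by blast
      moreover have "g (vector [s, t]) = s *\<^sub>R p t" by (simp add: g_def p_def)
      ultimately show ?thesis using s by (simp add: F_def abs_mult power_mult_distrib)
    qed
    then have "integral {0..1} (\<lambda>s. F (vector [s, t])) = integral {0..1} (\<lambda>s. \<bar>D\<bar> * (s / sqrt ((1 - s\<^sup>2 * ?q) ^ 3)))"
      by (intro integral_cong) auto
    also have "\<dots> = \<bar>D\<bar> * (1 / ((1 + sqrt (1 - ?q)) * sqrt (1 - ?q)))"
      by (intro integral_unique has_integral_mult_right radial_density_integral q)
    finally show ?thesis by simp
  qed
  have outer: "((\<lambda>t. \<bar>D\<bar> / ((1 + sqrt (1 - (norm (p t))\<^sup>2)) * sqrt (1 - (norm (p t))\<^sup>2))) has_integral A) {0..1}"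
  proof -
    have vp: "vc (p t) = vc a + of_real t * (vc b - vc a)" for t
      unfolding p_def by (simp add: vc_simps)
    have der: "((\<lambda>t. \<bar>D\<bar> * (1 / D) * parea (klp (vc a)) (klp (vc (p t)))) has_vector_derivative
        \<bar>D\<bar> / ((1 + sqrt (1 - (norm (p t))\<^sup>2)) * sqrt (1 - (norm (p t))\<^sup>2))) (at t within {0..1})" if "t \<in> {0..1}" for t
    proof -
      have c: "cmod (vc a) < 1" "cmod (vc a + of_real t * (vc b - vc a)) < 1"
        using ab p[of t] that unfolding vp[symmetric] by (auto simp: hyp_plane_def)
      have "((\<lambda>t. parea (klp (vc a)) (klp (vc (p t)))) has_real_derivative
          D / ((1 + sqrt (1 - (norm (p t))\<^sup>2)) * sqrt (1 - (norm (p t))\<^sup>2))) (at t)"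
        using parea_segment_deriv[OF c] unfolding vp[symmetric] D(1)[symmetric] norm_vc .
      from DERIV_cmult[OF this, of "\<bar>D\<bar> * (1 / D)"] show ?thesis using D(2)
        by (simp add: has_real_derivative_iff_has_vector_derivative has_vector_derivative_at_within)
    qed
    have "((\<lambda>t. \<bar>D\<bar> / ((1 + sqrt (1 - (norm (p t))\<^sup>2)) * sqrt (1 - (norm (p t))\<^sup>2))) has_integral
       \<bar>D\<bar> * (1 / D) * parea (klp (vc a)) (klp (vc (p 1))) - \<bar>D\<bar> * (1 / D) * parea (klp (vc a)) (klp (vc (p 0)))) {0..1}"
      by (rule fundamental_theorem_of_calculus) (use der in auto)
    moreover have "parea (klp (vc a)) (klp (vc (p 0))) = 0"
      using ab klp_bound[of "vc a"] by (simp add: p_def parea_self hyp_plane_def)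
    moreover have "p 1 = b" by (simp add: p_def)
    ultimately show ?thesis by (simp add: A_def)
  qed
  have "integral (cbox 0 1) F = A"
  proof -
    have "(F has_integral integral (cbox 0 1) F) (cbox 0 1)"
      using contF integrable_continuous integrable_integral by blast
    from has_integral_vec2_prod[OF this]
    have "integral (cbox 0 1) F = integral (cbox (0,0) (1,1)) (\<lambda>y. F (vector [snd y, fst y]))"
      by (simp add: integral_unique)
    also have "\<dots> = integral (cbox 0 1) (\<lambda>t. integral (cbox 0 1) (\<lambda>s. (\<lambda>y. F (vector [snd y, fst y])) (t, s)))"
    proof (rule integral_prod_continuous)
      have "continuous_on (cbox (0,0) (1,1)) (\<lambda>y::real\<times>real. vector [snd y, fst y] :: real^2)"
      proof -
        have "linear (\<lambda>y::real\<times>real. vector [snd y, fst y] :: real^2)"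
          by (rule linearI) (auto simp: vec_eq_iff forall_2)
        then show ?thesis by (simp add: linear_continuous_on linear_conv_bounded_linear)
      qed
      then show "continuous_on (cbox (0,0) (1,1)) (\<lambda>y::real\<times>real. F (vector [snd y, fst y]))"
        by (rule continuous_on_compose2[OF contF]) (auto simp: mem_box_cart forall_2 cbox_Pair_eq)
    qed
    also have "\<dots> = integral {0..1} (\<lambda>t. integral {0..1} (\<lambda>s. F (vector [s, t])))" by (simp add: cbox_interval)
    also have "\<dots> = integral {0..1} (\<lambda>t. \<bar>D\<bar> / ((1 + sqrt (1 - (norm (p t))\<^sup>2)) * sqrt (1 - (norm (p t))\<^sup>2)))"
      by (intro integral_cong inner)
    also have "\<dots> = A" using outer by (rule integral_unique)
    finally show ?thesis .
  qed
  then have IB: "integral (box 0 1) F = A" by (simp add: integral_open_interval)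
  have AB: "F absolutely_integrable_on box 0 1"
    using absolutely_integrable_continuous[OF contF] by (simp add: absolutely_integrable_on_open_interval)
  have det: "det (matrix (g' y)) = y $ 1 * D" for y
    by (simp add: det_2 matrix_def g'_def D' axis_def) (simp add: algebra_simps)
  have der: "(g has_derivative g' y) (at y within box 0 1)" for y
  proof -
    have nth: "((\<lambda>x. x $ i) has_derivative (\<lambda>h. h $ i)) (at y within box 0 1)" for i :: 2
      by (rule bounded_linear_imp_has_derivative[OF bounded_linear_vec_nth])
    show ?thesis unfolding g_def g'_def
      by (rule has_derivative_eq_rhs[OF has_derivative_scaleR[OF nth has_derivative_add[OF has_derivative_const has_derivative_scaleR_left[OF nth]]]])
        (simp add: fun_eq_iff)
  qed
  have inj: "inj_on g (box 0 1)"
  proof (rule inj_onI)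
    fix x y assume x: "x \<in> box 0 1" and y: "y \<in> box 0 1" and e: "g x = g y"
    have c: "x $ 1 * (a $ 1 + x $ 2 * (b $ 1 - a $ 1)) = y $ 1 * (a $ 1 + y $ 2 * (b $ 1 - a $ 1))"
      "x $ 1 * (a $ 2 + x $ 2 * (b $ 2 - a $ 2)) = y $ 1 * (a $ 2 + y $ 2 * (b $ 2 - a $ 2))"
      using arg_cong[OF e, of "\<lambda>v::real^2. v $ 1"] arg_cong[OF e, of "\<lambda>v::real^2. v $ 2"] by (auto simp: g_def)
    have "x $ 1 * D = y $ 1 * D" "(x $ 1 * x $ 2) * D = (y $ 1 * y $ 2) * D" unfolding D' using c by algebra+
    then have "x $ 1 = y $ 1" "x $ 1 * x $ 2 = y $ 1 * y $ 2" using D(2) by auto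
    moreover have "x $ 1 > 0" using x by (auto simp: mem_box_cart)
    ultimately show "x = y" by (auto simp: vec_eq_iff forall_2)
  qed
  \<comment> \<open>The density with values in \<open>real^1\<close>, the form in which the change
    of variables is applied.\<close>
  define f1 :: "real^2 \<Rightarrow> real^1" where "f1 x = vec (hyp_density x)" for x
  have "(\<lambda>y. \<bar>det (matrix (g' y))\<bar> *\<^sub>R f1 (g y)) = (\<lambda>y. vec (F y))"
    by (auto simp: f1_def F_def det vec_eq_iff)
  moreover have "(\<lambda>y. vec (F y) :: real^1) absolutely_integrable_on box 0 1"
    using AB by (subst absolutely_integrable_on_1_iff) simp
  moreover have "integral (box 0 1) (\<lambda>y. vec (F y) :: real^1) = vec A"
    using IB set_lebesgue_integral_eq_integral(1)[OF AB] by (subst integral_on_1_eq) simp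
  ultimately have "f1 absolutely_integrable_on (g ` box 0 1) \<and> integral (g ` box 0 1) f1 = vec A"
    using has_absolute_integral_change_of_variables[of "box 0 1" g g' f1 "vec A", OF _ der inj] by simp
  then have "hyp_density absolutely_integrable_on (g ` box 0 1)" "integral (g ` box 0 1) hyp_density = A"
    by (auto simp: absolutely_integrable_on_1_iff integral_on_1_eq f1_def vec_eq_iff)
  then have HI: "(hyp_density has_integral A) (g ` box 0 1)"
    using set_lebesgue_integral_eq_integral(1) integrable_integral by metis
  have hull: "convex hull {0, a, b} = {v *\<^sub>R a + w *\<^sub>R b | v w. 0 \<le> v \<and> 0 \<le> w \<and> v + w \<le> 1}"
    unfolding convex_hull_3
  proof (intro set_eqI iffI)
    fix x assume "x \<in> {u *\<^sub>R 0 + v *\<^sub>R a + w *\<^sub>R b |u v w. 0 \<le> u \<and> 0 \<le> v \<and> 0 \<le> w \<and> u + v + w = 1}"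
    then obtain u v w where "x = u *\<^sub>R 0 + v *\<^sub>R a + w *\<^sub>R b" "0 \<le> u" "0 \<le> v" "0 \<le> w" "u + v + w = 1" by blast
    then show "x \<in> {v *\<^sub>R a + w *\<^sub>R b |v w. 0 \<le> v \<and> 0 \<le> w \<and> v + w \<le> 1}"
      by (intro CollectI exI[of _ v] exI[of _ w]) auto
  next
    fix x assume "x \<in> {v *\<^sub>R a + w *\<^sub>R b |v w. 0 \<le> v \<and> 0 \<le> w \<and> v + w \<le> 1}"
    then obtain v w where "x = v *\<^sub>R a + w *\<^sub>R b" "0 \<le> v" "0 \<le> w" "v + w \<le> 1" by blast
    then show "x \<in> {u *\<^sub>R 0 + v *\<^sub>R a + w *\<^sub>R b |u v w. 0 \<le> u \<and> 0 \<le> v \<and> 0 \<le> w \<and> u + v + w = 1}"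
      by (intro CollectI exI[of _ "1 - v - w"] exI[of _ v] exI[of _ w]) auto
  qed
  have sub1: "g ` box 0 1 \<subseteq> convex hull {0, a, b}"
  proof
    fix x assume "x \<in> g ` box 0 1"
    then obtain y :: "real^2" where y: "0 < y $ 1" "y $ 1 < 1" "0 < y $ 2" "y $ 2 < 1" "x = g y"
      by (auto simp: mem_box_cart forall_2)
    have "x = (y $ 1 * (1 - y $ 2)) *\<^sub>R a + (y $ 1 * y $ 2) *\<^sub>R b"
      unfolding y(5) g_def by (simp add: algebra_simps)
    moreover have "y $ 1 * (1 - y $ 2) + y $ 1 * y $ 2 \<le> 1" using y by (simp add: algebra_simps)
    ultimately show "x \<in> convex hull {0, a, b}" unfolding hull using y
      by (intro CollectI exI[of _ "y $ 1 * (1 - y $ 2)"] exI[of _ "y $ 1 * y $ 2"]) auto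
  qed
  \<comment> \<open>The parametrization reaches everything except points on the three sides, a null
    set; its inverse takes \<open>v a + w b\<close> to \<open>v + w\<close> and
    \<open>w / (v + w)\<close>.\<close>
  have sub2: "convex hull {0, a, b} - g ` box 0 1 \<subseteq> closed_segment 0 a \<union> closed_segment 0 b \<union> closed_segment a b"
  proof
    fix x assume x: "x \<in> convex hull {0, a, b} - g ` box 0 1"
    then obtain v w where vw: "x = v *\<^sub>R a + w *\<^sub>R b" "0 \<le> v" "0 \<le> w" "v + w \<le> 1" unfolding hull by blast
    show "x \<in> closed_segment 0 a \<union> closed_segment 0 b \<union> closed_segment a b"
    proof (rule ccontr)
      assume n: "\<not> ?thesis"
      have "v \<noteq> 0" using n vw by (auto simp: in_segment)
      moreover have "w \<noteq> 0" using n vw by (auto simp: in_segment)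
      moreover have "v + w \<noteq> 1"
      proof
        assume "v + w = 1"
        then have "v = 1 - w" by simp
        then have "x = (1 - w) *\<^sub>R a + w *\<^sub>R b" "w \<le> 1" using vw by auto
        then show False using n vw(3) by (auto simp: in_segment)
      qed
      ultimately have p: "0 < v" "0 < w" "v + w < 1" using vw by auto
      define y :: "real^2" where "y = vector [v + w, w / (v + w)]"
      have "y \<in> box 0 1" using p by (auto simp: y_def mem_box_cart forall_2 field_simps)
      moreover have "g y = x"
      proof -
        have "g y = (v + w) *\<^sub>R a + ((v + w) * (w / (v + w))) *\<^sub>R (b - a)" by (simp add: g_def y_def algebra_simps)
        also have "(v + w) * (w / (v + w)) = w" using p by simp
        finally show ?thesis unfolding vw by (simp add: algebra_simps)
      qed
      ultimately show False using x by blast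
    qed
  qed
  have neg: "negligible (closed_segment 0 a \<union> closed_segment 0 b \<union> closed_segment a b)"
    by (intro negligible_Un negligible_segment2)
  have "(hyp_density has_integral A) (convex hull {0, a, b})"
    by (rule has_integral_spike_set_eq[THEN iffD1, OF _ _ HI]) (use sub1 sub2 in \<open>auto intro!: negligible_subset[OF neg]\<close>)
  moreover have "A = sgn D * parea (klp (vc a)) (klp (vc b))"
    using D(2) by (simp add: A_def sgn_if)
  ultimately show ?thesis by simp
qed

text \<open>Multiplying by the sign brings degenerate triangles under the same formula, with value
  \<open>0\<close>, and integrating over \<open>UNIV\<close> allows the triangles of a fan to be
  added.\<close>

lemma triangle_area:
  fixes a b :: "real^2"
  assumes ab: "a \<in> hyp_plane" "b \<in> hyp_plane" and D: "D = Im (cnj (vc a) * vc b)"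
  shows "((\<lambda>x. sgn D * (if x \<in> convex hull {0, a, b} then hyp_density x else 0)) has_integral parea (klp (vc a)) (klp (vc b))) UNIV"
proof (cases "D = 0")
  case True
  then have "parea (klp (vc a)) (klp (vc b)) = 0"
    using ab D by (intro parea_klp_collinear) (auto simp: hyp_plane_def)
  then show ?thesis using True by simp
next
  case False
  have "((\<lambda>x. if x \<in> convex hull {0, a, b} then hyp_density x else 0) has_integral sgn D * parea (klp (vc a)) (klp (vc b))) UNIV"
    using triangle_area_aux[OF ab D False] by (simp only: has_integral_restrict_UNIV)
  from has_integral_mult_right[OF this, of "sgn D"] show ?thesis using False
    by (simp add: sgn_if split: if_splits)
qed

section \<open>Insides of compact sets under homeomorphisms\<close>

text \<open>For a compact set \<open>S\<close> in an open convex set \<open>B\<close>, the bounded components of the complement can be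
  recognised inside \<open>B\<close>; hence homeomorphisms between such sets preserve insides.\<close>

lemma inside_iff_compact_component:
  fixes S B :: "'a::euclidean_space set"
  assumes B: "open B" "convex B" and S: "compact S" "S \<subseteq> B"
  shows "x \<in> inside S \<longleftrightarrow> x \<in> B - S \<and> compact (connected_component_set (B - S) x \<union> S)"
proof
  assume x: "x \<in> inside S"
  define C where "C = connected_component_set (- S) x"
  have xS: "x \<notin> S" and bC: "bounded C" using x by (auto simp: inside_def C_def)
  have xC: "x \<in> C" using xS by (simp add: C_def)
  have "C \<subseteq> inside S" using x inside_same_component unfolding C_def by blast
  moreover have "inside S \<subseteq> B"
  proof
    fix y assume "y \<in> inside S"
    then have "y \<notin> outside S" using inside_Int_outside by blast
    then show "y \<in> B" using outside_subset_convex[OF B(2) S(2)] by blast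
  qed
  ultimately have CB: "C \<subseteq> B - S" using inside_no_overlap by blast
  have "connected_component_set (B - S) x = C"
  proof
    show "connected_component_set (B - S) x \<subseteq> C" unfolding C_def by (rule connected_component_mono) auto
    show "C \<subseteq> connected_component_set (B - S) x"
      by (rule connected_component_maximal[OF xC _ CB]) (simp add: C_def)
  qed
  moreover have "C \<in> components (- S)" using xS by (auto simp: C_def components_def)
  then have "closed (S \<union> C)" by (intro closed_Un_complement_component compact_imp_closed S)
  moreover have "bounded (S \<union> C)" using bC S compact_imp_bounded by auto
  ultimately have "compact (connected_component_set (B - S) x \<union> S)"
    by (simp add: compact_eq_bounded_closed Un_commute)
  then show "x \<in> B - S \<and> compact (connected_component_set (B - S) x \<union> S)" using CB xC by blast
next
  assume x: "x \<in> B - S \<and> compact (connected_component_set (B - S) x \<union> S)"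
  define C where "C = connected_component_set (B - S) x"
  define D where "D = connected_component_set (- S) x"
  have oC: "open C" unfolding C_def using B S compact_imp_closed by (intro open_connected_component open_Diff)
  have CS: "C \<subseteq> B - S" unfolding C_def by (rule connected_component_subset)
  have CD: "C \<subseteq> D" unfolding C_def D_def by (rule connected_component_mono) auto
  have DS: "D \<subseteq> - S" unfolding D_def by (rule connected_component_subset)
  have "closed (C \<union> S)" using x by (auto simp: C_def intro: compact_imp_closed)
  \<comment> \<open>Compactness of \<open>C \<union> S\<close> makes \<open>C\<close> closed in the
    component \<open>D\<close> of the complement; being open as well, \<open>C\<close> is all of
    \<open>D\<close>.\<close>
  moreover have "C = D \<inter> (C \<union> S)" using CD DS by auto
  ultimately have "closedin (top_of_set D) C" by (metis closedin_closed)
  moreover have "openin (top_of_set D) C" using oC CD by (simp add: openin_open_eq open_subset)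
  moreover have "connected D" by (simp add: D_def)
  moreover have "x \<in> C" unfolding C_def using x by simp
  then have "C \<noteq> {}" by blast
  ultimately have "C = D" using connected_clopen by blast
  moreover have "compact (C \<union> S)" using x by (simp add: C_def)
  then have "bounded C" using compact_imp_bounded bounded_subset by blast
  ultimately show "x \<in> inside S" using x by (simp add: inside_def D_def)
qed

lemma connected_component_homeomorphism:
  assumes h: "homeomorphism B B' f g" and U: "U \<subseteq> B" "x \<in> U"
  shows "connected_component_set (f ` U) (f x) = f ` connected_component_set U x"
proof (rule subset_antisym[rotated])
  have cf: "continuous_on B f" and cg: "continuous_on B' g" and gf: "\<And>y. y \<in> B \<Longrightarrow> g (f y) = y"
    and fB: "f ` B = B'"
    using h by (auto simp: homeomorphism_def)
  show "f ` connected_component_set U x \<subseteq> connected_component_set (f ` U) (f x)"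
  proof (rule connected_component_maximal)
    show "f x \<in> f ` connected_component_set U x" using U by simp
    show "connected (f ` connected_component_set U x)"
      by (rule connected_continuous_image[OF continuous_on_subset[OF cf]])
        (use connected_component_subset[of U x] U in auto)
    show "f ` connected_component_set U x \<subseteq> f ` U" using connected_component_subset[of U x] by blast
  qed
  define K where "K = connected_component_set (f ` U) (f x)"
  have KU: "g y \<in> U \<and> f (g y) = y" if "y \<in> K" for y
  proof -
    have "y \<in> f ` U" using that connected_component_subset[of "f ` U" "f x"] unfolding K_def by blast
    then show ?thesis using gf U(1) by auto
  qed
  have fxK: "f x \<in> K" using U unfolding K_def by simp
  have "g ` K \<subseteq> connected_component_set U x"
  proof (rule connected_component_maximal)
    show "x \<in> g ` K"
    proof (rule image_eqI[OF _ fxK])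
      show "x = g (f x)" using gf[of x] U by auto
    qed
    show "connected (g ` K)"
    proof (rule connected_continuous_image[OF continuous_on_subset[OF cg]])
      show "K \<subseteq> B'" using connected_component_subset[of "f ` U" "f x"] U fB unfolding K_def by blast
      show "connected K" by (simp add: K_def)
    qed
    show "g ` K \<subseteq> U" using KU by blast
  qed
  then show "connected_component_set (f ` U) (f x) \<subseteq> f ` connected_component_set U x" using KU unfolding K_def by (metis image_eqI image_subset_iff subsetI)
qed

lemma inside_homeomorphism:
  fixes S B :: "'a::euclidean_space set" and B' :: "'b::euclidean_space set"
  assumes h: "homeomorphism B B' f g" and B: "open B" "convex B" and B': "open B'" "convex B'"
    and S: "compact S" "S \<subseteq> B"
  shows "inside (f ` S) = f ` inside S"
proof -
  have cf: "continuous_on B f" and cg: "continuous_on B' g" and gf: "\<And>y. y \<in> B \<Longrightarrow> g (f y) = y"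
    and fB: "f ` B = B'" and inj: "inj_on f B"
    using h by (auto simp: homeomorphism_def intro: inj_on_inverseI)
  have S': "compact (f ` S)" "f ` S \<subseteq> B'"
    using S fB by (auto intro: compact_continuous_image continuous_on_subset[OF cf])
  have BS: "B' - f ` S = f ` (B - S)" using inj_on_image_set_diff[OF inj, of B S] S fB by simp
  have key: "f x \<in> inside (f ` S) \<longleftrightarrow> x \<in> inside S" if x: "x \<in> B - S" for x
  proof -
    let ?C = "connected_component_set (B - S) x"
    have C: "?C \<subseteq> B - S" by (rule connected_component_subset)
    have "f x \<in> B' - f ` S" using x BS by blast
    then have "f x \<in> inside (f ` S) \<longleftrightarrow> compact (connected_component_set (B' - f ` S) (f x) \<union> f ` S)"
      using inside_iff_compact_component[OF B' S', of "f x"] by simp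
    also have "connected_component_set (B' - f ` S) (f x) \<union> f ` S = f ` (?C \<union> S)"
      unfolding BS using connected_component_homeomorphism[OF h _ x] by auto
    also have "compact (f ` (?C \<union> S)) \<longleftrightarrow> compact (?C \<union> S)"
    proof
      assume "compact (?C \<union> S)"
      then show "compact (f ` (?C \<union> S))"
        by (rule compact_continuous_image[OF continuous_on_subset[OF cf], rotated]) (use C S in auto)
    next
      assume "compact (f ` (?C \<union> S))"
      then have "compact (g ` f ` (?C \<union> S))"
        by (rule compact_continuous_image[OF continuous_on_subset[OF cg], rotated]) (use C S fB in auto)
      moreover have "g ` f ` (?C \<union> S) = ?C \<union> S"
      proof -
        have "g ` f ` (?C \<union> S) = (\<lambda>x. x) ` (?C \<union> S)"
          unfolding image_image by (rule image_cong) (use C S gf in auto)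
        then show ?thesis by simp
      qed
      ultimately show "compact (?C \<union> S)" by simp
    qed
    also have "\<dots> \<longleftrightarrow> x \<in> inside S" using inside_iff_compact_component[OF B S, of x] x by simp
    finally show ?thesis .
  qed
  have 1: "inside (f ` S) \<subseteq> f ` (B - S)"
    using inside_iff_compact_component[OF B' S'] unfolding BS by blast
  have 2: "inside S \<subseteq> B - S" using inside_iff_compact_component[OF B S] by blast
  show ?thesis using 1 2 key by blast
qed

section \<open>From vertex lists to simple polygons, and the area formula\<close>

definition cv :: "complex \<Rightarrow> real^2" where "cv z = vector [Re z, Im z]"

lemma vc_cv [simp]: "vc (cv z) = z" "cv (vc x) = x"
  by (auto simp: vc_def cv_def vec_eq_iff forall_2)

lemma linear_cv: "linear cv"
  by (rule linearI) (auto simp: cv_def vec_eq_iff forall_2)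

lemma homeomorphism_vc: "homeomorphism UNIV UNIV vc cv"
proof -
  have "surj vc" "surj cv" by (metis surjI vc_cv(1), metis surjI vc_cv(2))
  then show ?thesis using linear_continuous_on[of vc] linear_continuous_on[of cv] linear_vc linear_cv
    by (auto simp: homeomorphism_def linear_conv_bounded_linear)
qed

lemma vc_segment: "vc ` closed_segment a b = closed_segment (vc a) (vc b)"
  by (rule closed_segment_linear_image[OF linear_vc, symmetric])

lemma vc_hull: "vc ` (convex hull S) = convex hull (vc ` S)"
  by (rule convex_hull_linear_image[OF linear_vc])

text \<open>The topological counterpart of \<open>triangle_area\<close>: the triangle spanned by
  \<open>0\<close> and a side counts with the sign of its orientation. A degenerate triangle
  consists of its sides alone, which \<open>y\<close> avoids.\<close>

lemma winding_triangle_0: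
  assumes y: "y \<notin> closed_segment 0 a" "y \<notin> closed_segment a b" "y \<notin> closed_segment b 0"
  shows "winding_number (linepath 0 a) y + winding_number (linepath a b) y + winding_number (linepath b 0) y
    = of_real (sgn (Im (cnj a * b)) * (if y \<in> convex hull {0, a, b} then 1 else 0))"
proof -
  let ?g = "linepath 0 a +++ linepath a b +++ linepath b 0"
  have W: "winding_number ?g y = winding_number (linepath 0 a) y + winding_number (linepath a b) y + winding_number (linepath b 0) y"
    using y by (simp add: winding_number_join path_image_join)
  show ?thesis
  proof (cases "y \<in> convex hull {0, a, b}")
    case False
    have "path_image ?g \<subseteq> convex hull {0, a, b}"
      by (simp add: path_image_join) (intro conjI closed_segment_subset convex_convex_hull hull_inc; simp)
    then have "winding_number ?g y = 0"
      using False by (intro winding_number_zero_outside[of _ "convex hull {0, a, b}"]) auto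
    then show ?thesis using W False by simp
  next
    case True
    have int: "y \<in> interior (convex hull {0, a, b})"
      using True y by (simp add: interior_of_triangle)
    obtain u v w where uvw: "0 \<le> u" "0 \<le> v" "0 \<le> w" "u + v + w = 1" "y = u *\<^sub>R 0 + v *\<^sub>R a + w *\<^sub>R b"
      using True unfolding convex_hull_3 by blast
    have yy: "y = of_real v * a + of_real w * b" using uvw(5) by (simp add: scaleR_conv_of_real)
    have "w \<noteq> 0"
    proof
      assume "w = 0"
      then have "y \<in> closed_segment 0 a" using uvw by (auto simp: in_segment)
      then show False using y by simp
    qed
    then have w: "w > 0" using uvw by simp
    have D: "Im (cnj a * b) \<noteq> 0"
    proof
      assume D: "Im (cnj a * b) = 0"
      have a: "a \<noteq> 0"
      proof
        assume "a = 0"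
        then have "convex hull {0, a, b} = closed_segment b 0" by (simp add: segment_convex_hull insert_commute)
        then show False using True y by simp
      qed
      have "convex hull {0, a, b} \<subseteq> {z. (\<i> * a) \<bullet> z = 0}"
      proof (rule hull_minimal)
        show "{0, a, b} \<subseteq> {z. (\<i> * a) \<bullet> z = 0}" using D by (auto simp: inner_complex_def algebra_simps)
        show "convex {z. (\<i> * a) \<bullet> z = 0}" by (rule convex_hyperplane)
      qed
      then have "y \<in> interior {z. (\<i> * a) \<bullet> z = 0}" using int interior_mono by blast
      then show False using a by simp
    qed
    have "Im ((a - 0) * cnj (a - y)) = w * Im (cnj a * b)" unfolding yy by (simp add: algebra_simps)
    then have "0 < Im ((a - 0) * cnj (a - y)) \<longleftrightarrow> 0 < Im (cnj a * b)" using w by (simp add: zero_less_mult_iff)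
    then have "winding_number ?g y = (if 0 < Im (cnj a * b) then 1 else -1)"
      using winding_number_triangle[OF int] by simp
    then show ?thesis using W True D by (simp add: sgn_if)
  qed
qed

text \<open>Klein vertices, continued periodically, carry the topology since their sides are
  straight; the Poincare vertices \<open>pvert\<close> carry area and length.\<close>

definition kvert :: "(real^2) list \<Rightarrow> nat \<Rightarrow> complex" where "kvert P i = vc (P ! (i mod length P))"

lemma ngon_simple_polygon:
  assumes "hyp_ngon n P" shows "simple_polygon n (kvert P)"
proof
  have n: "n \<ge> 3" "length P = n" "distinct P" and sm: "\<And>i j. i < n \<Longrightarrow> j < n \<Longrightarrow> i \<noteq> j \<Longrightarrow>
        poly_side P i \<inter> poly_side P j = {P ! i, P ! (Suc i mod n)} \<inter> {P ! j, P ! (Suc j mod n)}"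
    using assms by (auto simp: hyp_ngon_def)
  show "n \<ge> 3" by fact
  show "kvert P (i + n) = kvert P i" for i by (simp add: kvert_def n)
  show "i mod n = j mod n" if "kvert P i = kvert P j" for i j
    using that n by (simp add: kvert_def nth_eq_iff_index_eq)
  have seg: "closed_segment (kvert P i) (kvert P (Suc i)) = vc ` poly_side P (i mod n)" for i
    by (simp add: kvert_def poly_side_def vc_segment n mod_Suc_eq)
  show "closed_segment (kvert P i) (kvert P (Suc i)) \<inter> closed_segment (kvert P j) (kvert P (Suc j))
    = {kvert P i, kvert P (Suc i)} \<inter> {kvert P j, kvert P (Suc j)}" if "i mod n \<noteq> j mod n" for i j
  proof -
    have "inj vc" by (simp add: inj_def)
    then have "vc ` poly_side P (i mod n) \<inter> vc ` poly_side P (j mod n) = vc ` ({P ! (i mod n), P ! (Suc (i mod n) mod n)} \<inter> {P ! (j mod n), P ! (Suc (j mod n) mod n)})"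
      using sm[of "i mod n" "j mod n"] that n by (simp add: image_Int[symmetric])
    also have "\<dots> = {kvert P i, kvert P (Suc i)} \<inter> {kvert P j, kvert P (Suc j)}"
      using \<open>inj vc\<close> by (simp add: image_Int kvert_def n mod_Suc_eq)
    finally show ?thesis unfolding seg .
  qed
qed

lemma ngon_bd:
  assumes "hyp_ngon n P" shows "simple_polygon.bd n (kvert P) = vc ` poly_boundary P"
    and "inside (vc ` poly_boundary P) = vc ` inside (poly_boundary P)"
proof -
  interpret simple_polygon n "kvert P" by (rule ngon_simple_polygon[OF assms])
  have n: "length P = n" using assms by (simp add: hyp_ngon_def)
  show "bd = vc ` poly_boundary P"
    unfolding bd_def poly_boundary_def image_UN n
    by (rule SUP_cong) (auto simp: poly_side_def kvert_def n vc_segment)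
  have "compact (poly_boundary P)" unfolding poly_boundary_def poly_side_def by (intro compact_UN) auto
  then show "inside (vc ` poly_boundary P) = vc ` inside (poly_boundary P)"
    by (intro inside_homeomorphism[OF homeomorphism_vc]) auto
qed

definition pvert :: "(real^2) list \<Rightarrow> nat \<Rightarrow> complex" where "pvert P i = klp (vc (P ! i))"

lemma pvert_bound: "hyp_ngon n P \<Longrightarrow> i < n \<Longrightarrow> cmod (pvert P i) < 1"
  unfolding pvert_def by (rule klp_bound) (auto simp: hyp_ngon_def hyp_plane_def subset_iff)

lemma ngon_boundary_subset:
  assumes P: "hyp_ngon n P" shows "poly_boundary P \<subseteq> hyp_plane"
proof -
  have n: "length P = n" "n \<ge> 3" and hp: "\<And>i. i < n \<Longrightarrow> P ! i \<in> hyp_plane" using P by (auto simp: hyp_ngon_def subset_iff)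
  have "poly_side P i \<subseteq> hyp_plane" if "i < n" for i
    unfolding poly_side_def n hyp_plane_def
  proof (rule closed_segment_subset)
    show "P ! i \<in> ball 0 1" "P ! (Suc i mod n) \<in> ball 0 1"
      using hp[of i] hp[of "Suc i mod n"] that n(2) by (auto simp: hyp_plane_def)
  qed simp
  then show ?thesis by (auto simp: poly_boundary_def n)
qed

lemma ngon_region_subset:
  assumes P: "hyp_ngon n P" shows "poly_region P \<subseteq> hyp_plane"
proof -
  have "y \<in> hyp_plane" if "y \<in> inside (poly_boundary P)" for y
  proof -
    have "y \<notin> outside (poly_boundary P)" using that inside_Int_outside by blast
    then show ?thesis using outside_subset_convex[OF convex_ball ngon_boundary_subset[OF P, unfolded hyp_plane_def]]
      by (auto simp: hyp_plane_def)
  qed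
  then show ?thesis using ngon_boundary_subset[OF P] by (auto simp: poly_region_def)
qed

text \<open>The triangles spanned by \<open>0\<close> and the sides are added with sign. Off a null
  set their signed indicators sum to the winding number of the polygon, since the edges at
  \<open>0\<close> cancel; this is \<open>s\<close> on the region and \<open>0\<close> elsewhere. As
  the area is nonnegative, \<open>s\<close> is absorbed into an absolute value.\<close>

theorem hyp_area_eq:
  assumes P: "hyp_ngon n P" shows "hyp_area P = \<bar>cyc_sum n parea (pvert P)\<bar>"
proof -
  interpret simple_polygon n "kvert P" by (rule ngon_simple_polygon[OF P])
  let ?Z = "kvert P" and ?B = "poly_boundary P"
  have n: "length P = n" and hp: "\<And>i. i < n \<Longrightarrow> P ! i \<in> hyp_plane" using P by (auto simp: hyp_ngon_def subset_iff)
  note bdP = ngon_bd(1)[OF P]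
  have inP: "vc x \<in> inside bd \<longleftrightarrow> x \<in> inside ?B" "vc x \<in> bd \<longleftrightarrow> x \<in> ?B" for x
    unfolding bdP ngon_bd(2)[OF P] by (auto simp: image_iff)
  obtain s where s: "s \<in> {1, -1 :: real}" "\<And>x. x \<in> inside bd \<Longrightarrow> wsum x = of_real s"
    "\<And>x. x \<notin> bd \<Longrightarrow> x \<notin> inside bd \<Longrightarrow> wsum x = 0" using wsum_cases by blast
  let ?a = "\<lambda>j. P ! j" and ?b = "\<lambda>j. P ! (Suc j mod n)"
  define D where "D j = Im (cnj (vc (?a j)) * vc (?b j))" for j
  let ?f = "\<lambda>j x. sgn (D j) * (if x \<in> convex hull {0, ?a j, ?b j} then hyp_density x else 0)"
  have I: "((\<lambda>x. \<Sum>j<n. ?f j x) has_integral (\<Sum>j<n. parea (klp (vc (?a j))) (klp (vc (?b j))))) UNIV"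
    by (intro has_integral_sum triangle_area) (auto simp: D_def intro!: hp)
  have Seq: "(\<Sum>j<n. parea (klp (vc (?a j))) (klp (vc (?b j)))) = cyc_sum n parea (pvert P)"
    by (simp add: cyc_sum_def pvert_def)
  \<comment> \<open>Sides and spokes: off this null set the winding numbers of all segments involved
    are meaningful.\<close>
  define N where "N = ?B \<union> (\<Union>j<n. closed_segment 0 (P ! j))"
  have "negligible ?B" unfolding poly_boundary_def poly_side_def
    by (intro negligible_Union) (auto simp: negligible_segment2)
  moreover have "negligible (\<Union>j<n. closed_segment 0 (P ! j))"
    by (intro negligible_Union) (auto simp: negligible_segment2)
  ultimately have N: "negligible N" by (simp add: N_def)
  have pt: "(\<Sum>j<n. sgn (D j) * (if x \<in> convex hull {0, ?a j, ?b j} then 1 else 0)) = s * (if x \<in> poly_region P then 1 else 0)"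
    if x: "x \<notin> N" for x
  proof -
    let ?y = "vc x"
    have yb: "?y \<notin> bd" using x inP(2) by (auto simp: N_def)
    have y1: "?y \<notin> closed_segment (?Z j) (?Z (Suc j))" for j using yb segment_subset_bd by blast
    have y0: "?y \<notin> closed_segment 0 (?Z j)" for j
    proof -
      have "x \<notin> closed_segment 0 (P ! (j mod n))" using x n3 by (auto simp: N_def)
      moreover have "closed_segment 0 (?Z j) = vc ` closed_segment 0 (P ! (j mod n))"
        by (simp add: vc_segment kvert_def n)
      ultimately show ?thesis by (auto simp: image_iff)
    qed
    have t: "of_real (sgn (D j) * (if x \<in> convex hull {0, ?a j, ?b j} then 1 else 0))
       = winding_number (linepath (?Z j) (?Z (Suc j))) ?y
        + (winding_number (linepath 0 (?Z j)) ?y - winding_number (linepath 0 (?Z (Suc j))) ?y)" if j: "j < n" for j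
    proof -
      have z: "?Z j = vc (?a j)" "?Z (Suc j) = vc (?b j)" using j by (auto simp: kvert_def n)
      have h: "x \<in> convex hull {0, ?a j, ?b j} \<longleftrightarrow> ?y \<in> convex hull {0, ?Z j, ?Z (Suc j)}"
      proof -
        have "convex hull {0, ?Z j, ?Z (Suc j)} = vc ` (convex hull {0, ?a j, ?b j})"
          unfolding vc_hull z by simp
        then show ?thesis by (auto simp: image_iff)
      qed
      have c: "?y \<notin> closed_segment (?Z (Suc j)) 0" using y0[of "Suc j"] by (simp add: closed_segment_commute)
      have r: "winding_number (linepath (?Z (Suc j)) 0) ?y = - winding_number (linepath 0 (?Z (Suc j))) ?y"
        using winding_number_reversepath[of "linepath 0 (?Z (Suc j))" ?y] y0[of "Suc j"] by simp
      show ?thesis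
        unfolding h D_def z[symmetric] winding_triangle_0[OF y0[of j] y1[of j] c, symmetric] r by simp
    qed
    have "complex_of_real (\<Sum>j<n. sgn (D j) * (if x \<in> convex hull {0, ?a j, ?b j} then 1 else 0))
      = wsum ?y + (\<Sum>j<n. winding_number (linepath 0 (?Z j)) ?y - winding_number (linepath 0 (?Z (Suc j))) ?y)"
      unfolding of_real_sum wsum_def sum.distrib[symmetric] by (rule sum.cong[OF refl]) (use t in auto)
    also have "(\<Sum>j<n. winding_number (linepath 0 (?Z j)) ?y - winding_number (linepath 0 (?Z (Suc j))) ?y) = 0"
      using per[of 0] sum_lessThan_telescope'[of "\<lambda>j. winding_number (linepath 0 (?Z j)) ?y" n] by simp
    also have "wsum ?y + 0 = of_real (s * (if x \<in> poly_region P then 1 else 0))"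
    proof (cases "?y \<in> inside bd")
      case True then show ?thesis using s(2) inP(1) by (simp add: poly_region_def)
    next
      case False then show ?thesis using s(3)[OF yb] yb inP by (simp add: poly_region_def)
    qed
    finally show ?thesis unfolding of_real_eq_iff .
  qed
  have "((\<lambda>x. s * (if x \<in> poly_region P then hyp_density x else 0)) has_integral cyc_sum n parea (pvert P)) UNIV"
  proof (rule has_integral_spike[OF N _ I[unfolded Seq]])
    fix x assume x: "x \<in> UNIV - N"
    have "(\<Sum>j<n. ?f j x) = (\<Sum>j<n. sgn (D j) * (if x \<in> convex hull {0, ?a j, ?b j} then 1 else 0)) * hyp_density x"
      unfolding sum_distrib_right by (intro sum.cong) auto
    then show "s * (if x \<in> poly_region P then hyp_density x else 0) = (\<Sum>j<n. ?f j x)"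
      using pt[of x] x by simp
  qed
  from has_integral_mult_right[OF this, of s]
  have "((\<lambda>x. if x \<in> poly_region P then hyp_density x else 0) has_integral s * cyc_sum n parea (pvert P)) UNIV"
    using s(1) by auto
  then have H: "(hyp_density has_integral s * cyc_sum n parea (pvert P)) (poly_region P)"
    by (simp only: has_integral_restrict_UNIV)
  have "hyp_density x \<ge> 0" if "x \<in> poly_region P" for x
  proof -
    have "x \<in> hyp_plane" using ngon_region_subset[OF P] that by blast
    moreover from this have "(norm x)\<^sup>2 < 1" by (simp add: hyp_plane_def abs_square_less_1)
    ultimately show ?thesis using hyp_density_eq[of x] by simp
  qed
  then have "s * cyc_sum n parea (pvert P) \<ge> 0" using H by (rule has_integral_nonneg[rotated])
  moreover have "hyp_area P = s * cyc_sum n parea (pvert P)" unfolding hyp_area_def using H by (rule integral_unique)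
  ultimately show ?thesis using s(1) by auto
qed

section \<open>Isometries of the Klein disc\<close>

text \<open>The inverse of \<open>klp\<close>, from the Poincare to the Klein disc; both preserve
  every ray from \<open>0\<close>.\<close>

definition pkl :: "complex \<Rightarrow> complex" where "pkl z = 2 * z / of_real (1 + (cmod z)\<^sup>2)"

lemma disc_less_iff: "cmod z < 1 \<longleftrightarrow> (cmod z)\<^sup>2 < 1"
  by (metis abs_norm_cancel abs_square_less_1)

lemma pkl_cmod: "1 - (cmod (pkl z))\<^sup>2 = ((1 - (cmod z)\<^sup>2) / (1 + (cmod z)\<^sup>2))\<^sup>2"
proof -
  have p: "1 + (cmod z)\<^sup>2 > 0" by (simp add: add_pos_nonneg)
  have "(cmod (pkl z))\<^sup>2 = 4 * (cmod z)\<^sup>2 / (1 + (cmod z)\<^sup>2)\<^sup>2"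
    unfolding pkl_def norm_divide norm_mult norm_of_real power_divide power_mult_distrib by simp
  moreover have "(1 + (cmod z)\<^sup>2)\<^sup>2 - 4 * (cmod z)\<^sup>2 = (1 - (cmod z)\<^sup>2)\<^sup>2" by (simp add: power2_eq_square algebra_simps)
  ultimately show ?thesis using p by (simp add: power_divide divide_simps left_diff_distrib)
qed

lemma pkl_bound: "cmod z < 1 \<Longrightarrow> cmod (pkl z) < 1"
proof -
  assume "cmod z < 1"
  then have "(cmod z)\<^sup>2 < 1" by (rule disc_sq)
  moreover have "1 + (cmod z)\<^sup>2 > 0" by (simp add: add_pos_nonneg)
  ultimately have "((1 - (cmod z)\<^sup>2) / (1 + (cmod z)\<^sup>2))\<^sup>2 > 0" by simp
  then have "(cmod (pkl z))\<^sup>2 < 1" using pkl_cmod[of z] by linarith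
  then show ?thesis using disc_less_iff by blast
qed

lemma klp_pkl:
  assumes "cmod z < 1" shows "klp (pkl z) = z"
proof -
  have a: "(cmod z)\<^sup>2 < 1" using disc_sq[OF assms] .
  have p: "1 + (cmod z)\<^sup>2 > 0" by (simp add: add_pos_nonneg)
  have "sqrt (1 - (cmod (pkl z))\<^sup>2) = (1 - (cmod z)\<^sup>2) / (1 + (cmod z)\<^sup>2)"
    unfolding pkl_cmod using a p by simp
  then have "1 + sqrt (1 - (cmod (pkl z))\<^sup>2) = 2 / (1 + (cmod z)\<^sup>2)" using p by (simp add: field_simps)
  moreover have "of_real (1 + (cmod z)\<^sup>2) \<noteq> (0::complex)" using p unfolding of_real_eq_0_iff by linarith
  ultimately show ?thesis unfolding klp_def[of "pkl z"] unfolding pkl_def of_real_divide by (simp del: of_real_add)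
qed

lemma klp_cmod:
  assumes "cmod z < 1" defines "k \<equiv> sqrt (1 - (cmod z)\<^sup>2)"
  shows "(cmod (klp z))\<^sup>2 = (1 - k) / (1 + k)" "k > 0" "k\<^sup>2 = 1 - (cmod z)\<^sup>2"
proof -
  show k: "k > 0" "k\<^sup>2 = 1 - (cmod z)\<^sup>2" using disc_sq[OF assms(1)] by (auto simp: k_def)
  have "(cmod (klp z))\<^sup>2 = (cmod z)\<^sup>2 / (1 + k)\<^sup>2"
    unfolding klp_def k_def[symmetric] norm_divide norm_of_real power_divide by simp
  also have "(cmod z)\<^sup>2 = (1 - k) * (1 + k)" using k by (simp add: power2_eq_square algebra_simps)
  finally show "(cmod (klp z))\<^sup>2 = (1 - k) / (1 + k)" using k by (simp add: power2_eq_square)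
qed

lemma pkl_klp:
  assumes "cmod z < 1" shows "pkl (klp z) = z"
proof -
  define k where "k = sqrt (1 - (cmod z)\<^sup>2)"
  note k = klp_cmod[OF assms, folded k_def]
  have "1 + (cmod (klp z))\<^sup>2 = 2 / (1 + k)" unfolding k(1) using k(2) by (simp add: field_simps)
  then have "pkl (klp z) = 2 * klp z / of_real (2 / (1 + k))" by (simp only: pkl_def)
  moreover have "2 * klp z / of_real (2 / (1 + k)) = z"
  proof -
    define E :: complex where "E = of_real (1 + k)"
    have "E \<noteq> 0" using k(2) unfolding E_def of_real_eq_0_iff by linarith
    moreover have "klp z = z / E" by (simp only: klp_def k_def E_def)
    moreover have "of_real (2 / (1 + k)) = 2 / E" by (simp only: E_def of_real_divide of_real_numeral)
    ultimately show ?thesis by (simp only:) (simp add: field_simps)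
  qed
  ultimately show ?thesis by (rule trans)
qed

lemma cosh_pdist:
  assumes "cmod z < 1" "cmod w < 1"
  shows "cosh (pdist z w) = 2 * (cmod (1 - cnj z * w))\<^sup>2 / ((1 - (cmod z)\<^sup>2) * (1 - (cmod w)\<^sup>2)) - 1"
proof -
  have "cosh (pdist z w) = 2 * (cosh (pdist z w / 2))\<^sup>2 - 1"
    using cosh_double[of "pdist z w / 2"] by (simp add: sinh_square_eq)
  moreover have "(1 - (cmod z)\<^sup>2) * (1 - (cmod w)\<^sup>2) \<ge> 0" using disc_sq[of z] disc_sq[of w] assms by simp
  ultimately show ?thesis unfolding cosh_pdist_half[OF assms] power_divide by simp
qed

text \<open>This identifies \<open>pdist\<close> with the distance formula of the Klein
  model.\<close>

lemma cosh_pdist_klp: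
  assumes "cmod a < 1" "cmod b < 1"
  shows "cosh (pdist (klp a) (klp b)) = (1 - Re (cnj a * b)) / sqrt ((1 - (cmod a)\<^sup>2) * (1 - (cmod b)\<^sup>2))"
proof -
  define k l where "k = sqrt (1 - (cmod a)\<^sup>2)" and "l = sqrt (1 - (cmod b)\<^sup>2)"
  note k = klp_cmod[OF assms(1), folded k_def] and l = klp_cmod[OF assms(2), folded l_def]
  have m: "1 - (cmod (klp a))\<^sup>2 = 2 * k / (1 + k)" "1 - (cmod (klp b))\<^sup>2 = 2 * l / (1 + l)"
    unfolding k(1) l(1) using k(2) l(2) by (simp_all add: field_simps)
  have nz: "of_real (1 + k) \<noteq> (0::complex)" "of_real (1 + l) \<noteq> (0::complex)"
    using k(2) l(2) unfolding of_real_eq_0_iff by linarith+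
  have "1 - cnj (klp a) * klp b = (of_real ((1 + k) * (1 + l)) - cnj a * b) / of_real ((1 + k) * (1 + l))"
    unfolding klp_def k_def[symmetric] l_def[symmetric] of_real_mult using nz by (simp add: field_simps del: of_real_add)
  then have "(cmod (1 - cnj (klp a) * klp b))\<^sup>2 = (cmod (of_real ((1 + k) * (1 + l)) - cnj a * b))\<^sup>2 / ((1 + k) * (1 + l))\<^sup>2"
    by (simp only: norm_divide norm_of_real power_divide power2_abs)
  also have "(cmod (of_real ((1 + k) * (1 + l)) - cnj a * b))\<^sup>2 = ((1 + k) * (1 + l))\<^sup>2 - 2 * ((1 + k) * (1 + l)) * Re (cnj a * b) + (cmod a)\<^sup>2 * (cmod b)\<^sup>2"
    unfolding cmod_power2 by (simp add: algebra_simps power2_eq_square)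
  also have "(cmod a)\<^sup>2 = (1 + k) * (1 - k)" using k(3) by (simp add: power2_eq_square algebra_simps)
  also have "(cmod b)\<^sup>2 = (1 + l) * (1 - l)" using l(3) by (simp add: power2_eq_square algebra_simps)
  also have "((1 + k) * (1 + l))\<^sup>2 - 2 * ((1 + k) * (1 + l)) * Re (cnj a * b) + (1 + k) * (1 - k) * ((1 + l) * (1 - l))
     = (1 + k) * (1 + l) * (2 * (1 + k * l - Re (cnj a * b)))"
    by (simp add: power2_eq_square algebra_simps)
  finally have e: "(cmod (1 - cnj (klp a) * klp b))\<^sup>2 = 2 * (1 + k * l - Re (cnj a * b)) / ((1 + k) * (1 + l))"
    using k(2) l(2) by (simp add: power2_eq_square)
  have "cosh (pdist (klp a) (klp b)) = (1 - Re (cnj a * b)) / (k * l)"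
    unfolding cosh_pdist[OF klp_bound[OF assms(1)] klp_bound[OF assms(2)]] e m
    using k(2) l(2) by (simp add: divide_simps)
  then show ?thesis by (simp add: k_def l_def real_sqrt_mult)
qed

lemma hyp_plane_vc: "x \<in> hyp_plane \<longleftrightarrow> cmod (vc x) < 1"
  by (simp add: hyp_plane_def)

lemma hyp_dist_cosh:
  assumes "x \<in> hyp_plane" "y \<in> hyp_plane"
  shows "(1 - x \<bullet> y) / sqrt ((1 - (norm x)\<^sup>2) * (1 - (norm y)\<^sup>2)) = cosh (pdist (klp (vc x)) (klp (vc y)))"
  using cosh_pdist_klp[of "vc x" "vc y"] assms by (simp add: hyp_plane_vc inner_vc)

lemma hyp_dist_pdist:
  assumes "x \<in> hyp_plane" "y \<in> hyp_plane"
  shows "hyp_dist x y = pdist (klp (vc x)) (klp (vc y))"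
  unfolding hyp_dist_def hyp_dist_cosh[OF assms]
  by (rule arcosh_cosh_real) (use assms in \<open>auto intro!: pdist_nonneg klp_bound simp: hyp_plane_vc[symmetric]\<close>, auto simp: hyp_plane_vc)

lemma cosh_hyp_dist:
  assumes "x \<in> hyp_plane" "y \<in> hyp_plane"
  shows "cosh (hyp_dist x y) = (1 - x \<bullet> y) / sqrt ((1 - (norm x)\<^sup>2) * (1 - (norm y)\<^sup>2))"
  unfolding hyp_dist_pdist[OF assms] hyp_dist_cosh[OF assms] ..

section \<open>Half-turns as geodesic maps of the Klein disc\<close>

text \<open>The half-turn \<open>pinv w\<close> of the disc, seen in the Klein model, is a fractional linear map.\<close>

definition kturn :: "complex \<Rightarrow> complex \<Rightarrow> complex" where
  "kturn w k = (2 * w - k - w\<^sup>2 * cnj k) / of_real (1 + (cmod w)\<^sup>2 - 2 * Re (cnj w * k))"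

lemma kturn_denom_pos:
  assumes "cmod w < 1" "cmod k < 1" shows "1 + (cmod w)\<^sup>2 - 2 * Re (cnj w * k) > 0"
proof -
  have "Re (cnj w * k) \<le> cmod w * cmod k" using complex_Re_le_cmod[of "cnj w * k"] by (simp add: norm_mult)
  also have "\<dots> \<le> cmod w * 1" using assms by (intro mult_left_mono) auto
  finally have "1 + (cmod w)\<^sup>2 - 2 * Re (cnj w * k) \<ge> (1 - cmod w)\<^sup>2" by (simp add: power2_eq_square algebra_simps)
  moreover have "(1 - cmod w)\<^sup>2 > 0" using assms by simp
  ultimately show ?thesis by linarith
qed

lemma pkl_pinv:
  assumes w: "cmod w < 1" and z: "cmod z < 1" shows "pkl (pinv w z) = kturn w (pkl z)"
proof -
  define d where "d = 1 - cnj w * z"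
  have d: "d \<noteq> 0" using pker_nz[OF w z] by (simp add: d_def)
  have p: "1 + (cmod z)\<^sup>2 > 0" by (simp add: add_pos_nonneg)
  have 1: "(cmod d)\<^sup>2 + (cmod (w - z))\<^sup>2 = (1 + (cmod w)\<^sup>2) * (1 + (cmod z)\<^sup>2) - 4 * Re (cnj w * z)"
    unfolding d_def cmod_power2 by (simp add: algebra_simps power2_eq_square)
  have "1 + (cmod (pinv w z))\<^sup>2 = ((cmod d)\<^sup>2 + (cmod (w - z))\<^sup>2) / (cmod d)\<^sup>2"
    unfolding pinv_def d_def[symmetric] norm_divide power_divide using d by (simp add: field_simps)
  then have "pkl (pinv w z) = 2 * ((w - z) / d) * of_real ((cmod d)\<^sup>2) / of_real ((cmod d)\<^sup>2 + (cmod (w - z))\<^sup>2)"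
    unfolding pkl_def pinv_def d_def[symmetric] by simp
  also have "2 * ((w - z) / d) * of_real ((cmod d)\<^sup>2) = 2 * (w - z) * cnj d"
  proof -
    have "of_real ((cmod d)\<^sup>2) = d * cnj d" by (metis complex_norm_square of_real_power)
    then show ?thesis using d by simp
  qed
  finally have L: "pkl (pinv w z) = 2 * (w - z) * cnj d / of_real ((1 + (cmod w)\<^sup>2) * (1 + (cmod z)\<^sup>2) - 4 * Re (cnj w * z))"
    unfolding 1 .
  define s where "s = 1 + (cmod z)\<^sup>2"
  have s: "of_real s \<noteq> (0::complex)" using p unfolding s_def of_real_eq_0_iff by linarith
  have zz: "z * cnj z = of_real (s - 1)" using complex_norm_square[of z] by (simp add: s_def)
  have N: "2 * w - pkl z - w\<^sup>2 * cnj (pkl z) = 2 * (w - z) * cnj d / of_real s"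
  proof -
    have "2 * (w - z) * cnj d = 2 * w * (1 + z * cnj z) - 2 * z - w\<^sup>2 * (2 * cnj z)"
      by (simp add: d_def algebra_simps power2_eq_square)
    also have "1 + z * cnj z = of_real s" unfolding zz by simp
    finally have e: "2 * (w - z) * cnj d = 2 * w * of_real s - 2 * z - w\<^sup>2 * (2 * cnj z)" .
    have "pkl z = 2 * z / of_real s" "cnj (pkl z) = 2 * cnj z / of_real s" by (simp_all add: pkl_def s_def)
    then show ?thesis unfolding e using s by (simp add: diff_divide_distrib)
  qed
  have D: "1 + (cmod w)\<^sup>2 - 2 * Re (cnj w * pkl z) = ((1 + (cmod w)\<^sup>2) * s - 4 * Re (cnj w * z)) / s"
  proof -
    have "cnj w * pkl z = 2 * (cnj w * z) / of_real s" by (simp add: pkl_def s_def)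
    then have "Re (cnj w * pkl z) = 2 * Re (cnj w * z) / s" by (simp add: Re_divide_of_real)
    then show ?thesis using p by (simp add: s_def[symmetric] field_simps)
  qed
  show ?thesis unfolding L kturn_def N D s_def[symmetric] using s by simp
qed

lemma kturn_disc:
  assumes "cmod w < 1" "cmod k < 1"
  shows "cmod (kturn w k) < 1" "kturn w (kturn w k) = k" "klp (kturn w k) = pinv w (klp k)"
proof -
  have e: "kturn w k = pkl (pinv w (klp k))"
    using pkl_pinv[OF assms(1) klp_bound[OF assms(2)]] pkl_klp[OF assms(2)] by simp
  have b: "cmod (pinv w (klp k)) < 1" using assms by (intro pinv_bound klp_bound)
  show "cmod (kturn w k) < 1" unfolding e by (rule pkl_bound[OF b])
  show "klp (kturn w k) = pinv w (klp k)" unfolding e by (rule klp_pkl[OF b])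
  show "kturn w (kturn w k) = k"
    unfolding e using pkl_pinv[OF assms(1) b] assms klp_bound[OF assms(2)] by (simp add: pkl_klp)
qed

lemma kturn_continuous: "cmod w < 1 \<Longrightarrow> continuous_on {k. cmod k < 1} (kturn w)"
  unfolding kturn_def
  by (intro continuous_intros) (use kturn_denom_pos in \<open>force simp del: of_real_add of_real_diff simp: of_real_eq_0_iff\<close>)

text \<open>Numerator and denominator of \<open>kturn\<close> are real-affine in \<open>k\<close>,
  so the map is projective: a convex combination goes to a convex combination, with the weights
  rescaled by the positive denominators at the endpoints.\<close>

lemma kturn_segment_subset:
  assumes w: "cmod w < 1" and k: "cmod a < 1" "cmod b < 1" "x \<in> closed_segment a b"
  shows "kturn w x \<in> closed_segment (kturn w a) (kturn w b)"
proof -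
  obtain t where t: "0 \<le> t" "t \<le> 1" "x = (1 - t) *\<^sub>R a + t *\<^sub>R b" using k(3) by (auto simp: in_segment)
  define d where "d k = 1 + (cmod w)\<^sup>2 - 2 * Re (cnj w * k)" for k
  define m where "m k = 2 * w - k - w\<^sup>2 * cnj k" for k
  have K: "kturn w k = m k / of_real (d k)" for k by (simp add: kturn_def m_def d_def)
  have dp: "d a > 0" "d b > 0" using kturn_denom_pos[OF w] k by (auto simp: d_def)
  have dx: "d x = (1 - t) * d a + t * d b" unfolding t(3) d_def by (simp add: algebra_simps)
  have mx: "m x = (1 - t) *\<^sub>R m a + t *\<^sub>R m b" unfolding t(3) m_def by (simp add: scaleR_conv_of_real algebra_simps)
  have dx0: "d x > 0" unfolding dx using dp t by (cases "t = 0") (auto intro: add_nonneg_pos)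
  define s where "s = t * d b / d x"
  have "t * d b \<le> d x" unfolding dx using t dp by simp
  then have s: "0 \<le> s" "s \<le> 1" using t dp dx0 by (auto simp: s_def)
  have s1: "1 - s = (1 - t) * d a / d x" using dx0 by (simp add: s_def field_simps dx)
  have "(1 - s) *\<^sub>R kturn w a + s *\<^sub>R kturn w b = kturn w x"
  proof -
    have "((1 - t) * d a / d x) *\<^sub>R (m a / of_real (d a)) = ((1 - t) *\<^sub>R m a) / of_real (d x)"
      using dp dx0 by (simp add: scaleR_conv_of_real)
    moreover have "(t * d b / d x) *\<^sub>R (m b / of_real (d b)) = (t *\<^sub>R m b) / of_real (d x)"
      using dp dx0 by (simp add: scaleR_conv_of_real)
    ultimately show ?thesis unfolding s1 K by (simp add: s_def mx add_divide_distrib)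
  qed
  then show ?thesis using s by (auto simp: in_segment)
qed

definition geodesic_map :: "(real^2 \<Rightarrow> real^2) \<Rightarrow> bool" where
  "geodesic_map f \<longleftrightarrow> continuous_on hyp_plane f \<and> (\<forall>x\<in>hyp_plane. \<forall>y\<in>hyp_plane.
     f ` closed_segment x y = closed_segment (f x) (f y))"

definition hturn :: "complex \<Rightarrow> real^2 \<Rightarrow> real^2" where "hturn w x = cv (kturn w (vc x))"

lemma hturn_in: "cmod w < 1 \<Longrightarrow> x \<in> hyp_plane \<Longrightarrow> hturn w x \<in> hyp_plane"
  and hturn_hturn: "cmod w < 1 \<Longrightarrow> x \<in> hyp_plane \<Longrightarrow> hturn w (hturn w x) = x"
  and klp_hturn: "cmod w < 1 \<Longrightarrow> x \<in> hyp_plane \<Longrightarrow> klp (vc (hturn w x)) = pinv w (klp (vc x))"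
  by (auto simp: hturn_def hyp_plane_vc kturn_disc)

lemma hturn_isometry:
  assumes w: "cmod w < 1" shows "hyp_isometry (hturn w)"
  unfolding hyp_isometry_def
proof (intro conjI ballI)
  show "hturn w ` hyp_plane = hyp_plane"
    using hturn_in[OF w] hturn_hturn[OF w] by (metis (no_types, lifting) image_eqI image_subset_iff subsetI subset_antisym)
  fix x y assume xy: "x \<in> hyp_plane" "y \<in> hyp_plane"
  then show "hyp_dist (hturn w x) (hturn w y) = hyp_dist x y"
    using hturn_in[OF w] w by (simp add: hyp_dist_pdist klp_hturn klp_bound hyp_plane_vc[symmetric]) (simp add: hyp_plane_vc klp_bound)
qed

lemma segment_hyp_plane: "x \<in> hyp_plane \<Longrightarrow> y \<in> hyp_plane \<Longrightarrow> closed_segment x y \<subseteq> hyp_plane"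
  unfolding hyp_plane_def by (rule closed_segment_subset) auto

lemma hturn_geodesic:
  assumes w: "cmod w < 1" shows "geodesic_map (hturn w)"
  unfolding geodesic_map_def
proof (intro conjI ballI)
  have c: "continuous_on hyp_plane vc" "continuous_on UNIV cv"
    using linear_continuous_on[of vc] linear_continuous_on[of cv] linear_vc linear_cv by (auto simp: linear_conv_bounded_linear)
  have "continuous_on hyp_plane (\<lambda>x. kturn w (vc x))"
    by (rule continuous_on_compose2[OF kturn_continuous[OF w] c(1)]) (auto simp: hyp_plane_vc)
  then show "continuous_on hyp_plane (hturn w)" unfolding hturn_def
    by (rule continuous_on_compose2[OF c(2)]) auto
  have sub: "hturn w ` closed_segment x y \<subseteq> closed_segment (hturn w x) (hturn w y)" if "x \<in> hyp_plane" "y \<in> hyp_plane" for x y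
  proof
    fix u assume "u \<in> hturn w ` closed_segment x y"
    then obtain p where p: "p \<in> closed_segment x y" "u = hturn w p" by auto
    then have "vc p \<in> closed_segment (vc x) (vc y)" using vc_segment[of x y] by blast
    then have "kturn w (vc p) \<in> closed_segment (kturn w (vc x)) (kturn w (vc y))"
      using that by (intro kturn_segment_subset[OF w]) (auto simp: hyp_plane_vc)
    then show "u \<in> closed_segment (hturn w x) (hturn w y)"
      unfolding p hturn_def closed_segment_linear_image[OF linear_cv] by blast
  qed
  fix x y assume xy: "x \<in> hyp_plane" "y \<in> hyp_plane"
  have "closed_segment (hturn w x) (hturn w y) \<subseteq> hturn w ` closed_segment x y"
  proof
    fix u assume u: "u \<in> closed_segment (hturn w x) (hturn w y)"
    have uh: "u \<in> hyp_plane" using u segment_hyp_plane hturn_in[OF w] xy by blast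
    have "hturn w u \<in> closed_segment x y"
      using sub[OF hturn_in[OF w xy(1)] hturn_in[OF w xy(2)]] u hturn_hturn[OF w] xy by auto
    then show "u \<in> hturn w ` closed_segment x y" using hturn_hturn[OF w uh] by (metis image_eqI)
  qed
  then show "hturn w ` closed_segment x y = closed_segment (hturn w x) (hturn w y)" using sub[OF xy] by blast
qed

section \<open>Arbitrary isometries\<close>

lemma isometry_in: "hyp_isometry f \<Longrightarrow> x \<in> hyp_plane \<Longrightarrow> f x \<in> hyp_plane"
  by (auto simp: hyp_isometry_def)

lemma isometry_comp: "hyp_isometry f \<Longrightarrow> hyp_isometry g \<Longrightarrow> hyp_isometry (\<lambda>x. f (g x))"
  unfolding hyp_isometry_def by (simp add: image_image[symmetric, of f g]) (metis image_eqI)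

lemma geodesic_comp:
  assumes "geodesic_map f" "geodesic_map g" "\<And>x. x \<in> hyp_plane \<Longrightarrow> g x \<in> hyp_plane"
  shows "geodesic_map (\<lambda>x. f (g x))"
  using assms unfolding geodesic_map_def
  by (auto simp: image_image[symmetric, of f g] image_subset_iff intro: continuous_on_compose2)

text \<open>The distance to \<open>0\<close> determines the norm, and then the distance between two
  points determines their inner product.\<close>

lemma isometry_fix0_linear:
  assumes g: "hyp_isometry g" "g 0 = 0" and x: "x \<in> hyp_plane" and y: "y \<in> hyp_plane"
  shows "norm (g x) = norm x" "g x \<bullet> g y = x \<bullet> y"
proof -
  have 0: "0 \<in> hyp_plane" by (simp add: hyp_plane_def)
  have lt: "(norm z)\<^sup>2 < 1" if "z \<in> hyp_plane" for z :: "real^2" using that by (simp add: hyp_plane_def abs_square_less_1)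
  have nrm: "(norm (g z))\<^sup>2 = (norm z)\<^sup>2" if z: "z \<in> hyp_plane" for z
  proof -
    have gz: "g z \<in> hyp_plane" using isometry_in[OF g(1) z] .
    have "hyp_dist 0 (g z) = hyp_dist 0 z" using g z 0 unfolding hyp_isometry_def by metis
    then have "1 / sqrt (1 - (norm (g z))\<^sup>2) = 1 / sqrt (1 - (norm z)\<^sup>2)"
      using cosh_hyp_dist[OF 0 z] cosh_hyp_dist[OF 0 gz] by simp
    then show ?thesis using lt[OF z] lt[OF gz] by simp
  qed
  show "norm (g x) = norm x" using nrm[OF x] by simp
  have d: "hyp_dist (g x) (g y) = hyp_dist x y" using g x y by (simp add: hyp_isometry_def)
  have "(1 - g x \<bullet> g y) / sqrt ((1 - (norm x)\<^sup>2) * (1 - (norm y)\<^sup>2)) = (1 - x \<bullet> y) / sqrt ((1 - (norm x)\<^sup>2) * (1 - (norm y)\<^sup>2))"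
    using cosh_hyp_dist[OF isometry_in[OF g(1) x] isometry_in[OF g(1) y]]
    unfolding d cosh_hyp_dist[OF x y] nrm[OF x] nrm[OF y] by (rule sym)
  moreover have "sqrt ((1 - (norm x)\<^sup>2) * (1 - (norm y)\<^sup>2)) \<noteq> 0" using lt[OF x] lt[OF y] by simp
  ultimately have "1 - g x \<bullet> g y = 1 - x \<bullet> y" unfolding divide_cancel_right by blast
  then show "g x \<bullet> g y = x \<bullet> y" by simp
qed

text \<open>Since inner products are preserved, the squared norm of
  \<open>g ((1 - t) x + t y) - (1 - t) g x - t g y\<close> can be expanded and equals the same
  expression without \<open>g\<close>, which is \<open>0\<close>. So \<open>g\<close> is affine on
  segments.\<close>

lemma isometry_fix0_geodesic:
  assumes g: "hyp_isometry g" "g 0 = 0" shows "geodesic_map g"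
  unfolding geodesic_map_def
proof (intro conjI ballI)
  note L = isometry_fix0_linear[OF g]
  have d: "dist (g x) (g y) = dist x y" if "x \<in> hyp_plane" "y \<in> hyp_plane" for x y
  proof -
    have "(norm (g x - g y))\<^sup>2 = (norm (x - y))\<^sup>2"
      using L[OF that(1) that(1)] L[OF that(2) that(2)] L[OF that] by (simp add: power2_norm_eq_inner inner_diff_left inner_diff_right inner_commute)
    then show ?thesis by (simp add: dist_norm)
  qed
  then show "continuous_on hyp_plane g" unfolding continuous_on_iff by metis
  fix x y assume xy: "x \<in> hyp_plane" "y \<in> hyp_plane"
  have lin: "g ((1 - t) *\<^sub>R x + t *\<^sub>R y) = (1 - t) *\<^sub>R g x + t *\<^sub>R g y" if t: "0 \<le> t" "t \<le> 1" for t
  proof -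
    let ?z = "(1 - t) *\<^sub>R x + t *\<^sub>R y"
    have "?z \<in> closed_segment x y" using t by (auto simp: in_segment)
    then have z: "?z \<in> hyp_plane" using segment_hyp_plane[OF xy] by blast
    have "(norm (g ?z - ((1 - t) *\<^sub>R g x + t *\<^sub>R g y)))\<^sup>2 = (norm (?z - ((1 - t) *\<^sub>R x + t *\<^sub>R y)))\<^sup>2"
      unfolding power2_norm_eq_inner inner_diff_left inner_diff_right inner_add_left inner_add_right inner_scaleR_left inner_scaleR_right
      using L(2)[OF z z] L(2)[OF z xy(1)] L(2)[OF z xy(2)] L(2)[OF xy(1) z] L(2)[OF xy(2) z] L(2)[OF xy(1) xy(1)] L(2)[OF xy(2) xy(2)]
        L(2)[OF xy] L(2)[OF xy(2) xy(1)]
      by (simp add: inner_add_left inner_add_right inner_commute[of y x])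
    then show ?thesis by simp
  qed
  show "g ` closed_segment x y = closed_segment (g x) (g y)"
  proof
    show "g ` closed_segment x y \<subseteq> closed_segment (g x) (g y)"
    proof
      fix u assume "u \<in> g ` closed_segment x y"
      then obtain t where "0 \<le> t" "t \<le> 1" "u = g ((1 - t) *\<^sub>R x + t *\<^sub>R y)" by (auto simp: in_segment)
      then show "u \<in> closed_segment (g x) (g y)" unfolding in_segment using lin by blast
    qed
    show "closed_segment (g x) (g y) \<subseteq> g ` closed_segment x y"
    proof
      fix u assume "u \<in> closed_segment (g x) (g y)"
      then obtain t where "0 \<le> t" "t \<le> 1" "u = g ((1 - t) *\<^sub>R x + t *\<^sub>R y)" using lin unfolding in_segment by metis
      moreover from this have "(1 - t) *\<^sub>R x + t *\<^sub>R y \<in> closed_segment x y" by (auto simp: in_segment)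
      ultimately show "u \<in> g ` closed_segment x y" by blast
    qed
  qed
qed

text \<open>\<open>isometric\<close> quantifies over all distance-preserving bijections of the
  plane, so it has to be proved that they carry sides to sides; a half-turn reduces this to
  isometries fixing \<open>0\<close>.\<close>

theorem isometry_geodesic:
  assumes f: "hyp_isometry f" shows "geodesic_map f"
proof -
  have 0: "0 \<in> hyp_plane" by (simp add: hyp_plane_def)
  define w where "w = klp (vc (f 0))"
  have w: "cmod w < 1" unfolding w_def using isometry_in[OF f 0] by (intro klp_bound) (simp add: hyp_plane_vc)
  define g where "g x = hturn w (f x)" for x
  have g: "hyp_isometry g" unfolding g_def by (rule isometry_comp[OF hturn_isometry[OF w] f])
  have "klp (vc (g 0)) = 0" unfolding g_def klp_hturn[OF w isometry_in[OF f 0]] by (simp add: w_def)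
  then have "pkl (klp (vc (g 0))) = 0" by (simp add: pkl_def)
  then have "vc (g 0) = vc 0" using isometry_in[OF g 0] by (simp add: pkl_klp hyp_plane_vc)
  then have "g 0 = 0" by (simp only: vc_eq_iff)
  then have G: "geodesic_map (\<lambda>x. hturn w (g x))"
    using geodesic_comp[OF hturn_geodesic[OF w] isometry_fix0_geodesic[OF g] isometry_in[OF g]] by blast
  have e: "hturn w (g x) = f x" if "x \<in> hyp_plane" for x
    unfolding g_def by (rule hturn_hturn[OF w isometry_in[OF f that]])
  show ?thesis unfolding geodesic_map_def
  proof (intro conjI ballI)
    show "continuous_on hyp_plane f"
      by (rule continuous_on_eq[of _ "\<lambda>x. hturn w (g x)"]) (use G e in \<open>auto simp: geodesic_map_def\<close>)
    fix x y assume xy: "x \<in> hyp_plane" "y \<in> hyp_plane"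
    have "f ` closed_segment x y = (\<lambda>x. hturn w (g x)) ` closed_segment x y"
      by (rule image_cong[OF refl]) (use e segment_hyp_plane[OF xy] in auto)
    also have "\<dots> = closed_segment (hturn w (g x)) (hturn w (g y))" using G xy by (simp add: geodesic_map_def)
    finally show "f ` closed_segment x y = closed_segment (f x) (f y)" unfolding e[OF xy(1)] e[OF xy(2)] .
  qed
qed

lemma hyp_dist_eq_0: "x \<in> hyp_plane \<Longrightarrow> y \<in> hyp_plane \<Longrightarrow> hyp_dist x y = 0 \<longleftrightarrow> x = y"
proof -
  assume xy: "x \<in> hyp_plane" "y \<in> hyp_plane"
  then have b: "cmod (vc x) < 1" "cmod (vc y) < 1" by (auto simp: hyp_plane_vc)
  have "hyp_dist x y = 0 \<longleftrightarrow> klp (vc x) = klp (vc y)"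
    unfolding hyp_dist_pdist[OF xy] using b by (intro pdist_eq_0 klp_bound)
  also have "\<dots> \<longleftrightarrow> vc x = vc y" using pkl_klp[OF b(1)] pkl_klp[OF b(2)] by metis
  finally show ?thesis by simp
qed

lemma isometry_inj: "hyp_isometry f \<Longrightarrow> inj_on f hyp_plane"
  unfolding inj_on_def using hyp_dist_eq_0 isometry_in by (metis hyp_isometry_def)

lemma isometry_inverse:
  assumes f: "hyp_isometry f"
  obtains g where "hyp_isometry g" "\<And>x. x \<in> hyp_plane \<Longrightarrow> g (f x) = x" "\<And>x. x \<in> hyp_plane \<Longrightarrow> f (g x) = x"
    "homeomorphism hyp_plane hyp_plane f g"
proof -
  define g where "g = inv_into hyp_plane f"
  have im: "f ` hyp_plane = hyp_plane" using f by (simp add: hyp_isometry_def)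
  have gf: "g (f x) = x" if "x \<in> hyp_plane" for x unfolding g_def using isometry_inj[OF f] that by (rule inv_into_f_f)
  have fg: "f (g x) = x" if "x \<in> hyp_plane" for x unfolding g_def using that im by (intro f_inv_into_f) auto
  have gin: "g x \<in> hyp_plane" if "x \<in> hyp_plane" for x unfolding g_def using that im by (intro inv_into_into) auto
  have gim: "g ` hyp_plane = hyp_plane" using gin gf isometry_in[OF f] by (metis (no_types, lifting) image_eqI image_subset_iff subsetI subset_antisym)
  have g: "hyp_isometry g" unfolding hyp_isometry_def using gim fg gin f by (auto simp: hyp_isometry_def) (metis fg gin)
  have "homeomorphism hyp_plane hyp_plane f g"
    using isometry_geodesic[OF f] isometry_geodesic[OF g] gf fg im gim by (auto simp: homeomorphism_def geodesic_map_def)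
  then show ?thesis using that g gf fg by blast
qed

lemma isometry_ngon:
  assumes f: "hyp_isometry f" and P: "hyp_ngon n P"
  shows "hyp_ngon n (map f P)" "poly_boundary (map f P) = f ` poly_boundary P"
    "poly_region (map f P) = f ` poly_region P" "\<And>i. i < n \<Longrightarrow> side_length (map f P) i = side_length P i"
proof -
  have n: "length P = n" "n \<ge> 3" "distinct P" and sP: "set P \<subseteq> hyp_plane" using P by (auto simp: hyp_ngon_def)
  have hp: "P ! i \<in> hyp_plane" if "i < n" for i using sP that n by auto
  have sm: "Suc i mod n < n" for i using n by simp
  have side: "poly_side (map f P) i = f ` poly_side P i" if "i < n" for i
    using isometry_geodesic[OF f] hp[OF that] hp[OF sm] that sm[of i] by (simp add: poly_side_def n geodesic_map_def)
  have sideh: "poly_side P i \<subseteq> hyp_plane" if "i < n" for i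
    unfolding poly_side_def n by (rule segment_hyp_plane[OF hp[OF that] hp[OF sm]])
  show "hyp_ngon n (map f P)" unfolding hyp_ngon_def
  proof (intro conjI allI impI)
    show "distinct (map f P)" using n inj_on_subset[OF isometry_inj[OF f] sP] by (simp add: distinct_map)
    show "set (map f P) \<subseteq> hyp_plane" using isometry_in[OF f] sP by auto
    fix i j assume ij: "i < n" "j < n" "i \<noteq> j"
    have "poly_side (map f P) i \<inter> poly_side (map f P) j = f ` (poly_side P i \<inter> poly_side P j)"
      using side ij inj_on_image_Int[OF isometry_inj[OF f] sideh sideh] by simp
    also have "poly_side P i \<inter> poly_side P j = {P ! i, P ! (Suc i mod n)} \<inter> {P ! j, P ! (Suc j mod n)}"
      using P ij by (simp add: hyp_ngon_def)
    also have "f ` \<dots> = f ` {P ! i, P ! (Suc i mod n)} \<inter> f ` {P ! j, P ! (Suc j mod n)}"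
      using hp sm ij by (intro inj_on_image_Int[OF isometry_inj[OF f]]) auto
    finally show "poly_side (map f P) i \<inter> poly_side (map f P) j = {map f P ! i, map f P ! (Suc i mod n)} \<inter> {map f P ! j, map f P ! (Suc j mod n)}"
      using ij sm n by simp
  qed (use n in auto)
  show bd: "poly_boundary (map f P) = f ` poly_boundary P"
    unfolding poly_boundary_def image_UN using side by (simp add: n)
  obtain g where "homeomorphism hyp_plane hyp_plane f g" using isometry_inverse[OF f] by blast
  moreover have "compact (poly_boundary P)" unfolding poly_boundary_def poly_side_def by (intro compact_UN) auto
  ultimately have "inside (f ` poly_boundary P) = f ` inside (poly_boundary P)"
    using ngon_boundary_subset[OF P] by (intro inside_homeomorphism) (auto simp: hyp_plane_def)
  then show "poly_region (map f P) = f ` poly_region P" unfolding poly_region_def bd by (simp add: image_Un)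
  show "side_length (map f P) i = side_length P i" if "i < n" for i
    using f hp[OF that] hp[OF sm] that sm[of i] by (simp add: side_length_def n hyp_isometry_def)
qed

section \<open>Regular polygons\<close>

lemma cv_simps:
  "cv (x + y) = cv x + cv y" "cv (x - y) = cv x - cv y" "cv (of_real c * x) = c *\<^sub>R cv x"
  by (simp_all add: cv_def vec_eq_iff forall_2)

lemma hyp_peri_eq:
  assumes P: "hyp_ngon n P" shows "hyp_peri P = cyc_sum n pdist (pvert P)"
proof -
  have n: "length P = n" "n \<ge> 3" using P by (auto simp: hyp_ngon_def)
  have hp: "P ! i \<in> hyp_plane" if "i < n" for i using P that by (auto simp: hyp_ngon_def subset_iff)
  show ?thesis unfolding hyp_peri_def cyc_sum_def n(1)
    by (rule sum.cong[OF refl]) (use hp n in \<open>simp add: side_length_def hyp_dist_pdist pvert_def\<close>)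
qed

lemma pkl_rot: "cmod u = 1 \<Longrightarrow> pkl (u * z) = u * pkl z"
  by (simp add: pkl_def norm_mult)

text \<open>In the Klein model the distance is a function of norms and inner products, and the
  inverse \<open>L'\<close> gives surjectivity. Rotations and the reflection are the intended
  cases.\<close>

lemma inner_preserving_isometry:
  fixes L :: "complex \<Rightarrow> complex"
  assumes "\<And>a b. Re (cnj (L a) * L b) = Re (cnj a * b)" "\<And>a. cmod (L a) = cmod a" "\<And>a. L' (L a) = a" "\<And>a. L (L' a) = a"
  shows "hyp_isometry (\<lambda>x. cv (L (vc x)))"
  unfolding hyp_isometry_def
proof (intro conjI ballI)
  have i: "cv (L (vc x)) \<bullet> cv (L (vc y)) = x \<bullet> y" for x y by (simp only: inner_vc vc_cv assms(1))
  have nr: "norm (cv (L (vc x))) = norm x" for x by (simp only: norm_vc[symmetric] vc_cv assms(2))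
  have "x \<in> (\<lambda>x. cv (L (vc x))) ` hyp_plane" if "x \<in> hyp_plane" for x
  proof (rule image_eqI)
    show "x = cv (L (vc (cv (L' (vc x)))))" by (simp add: assms(4))
    have "cmod (L' (vc x)) = cmod (vc x)" using assms(2)[of "L' (vc x)"] assms(4) by simp
    then show "cv (L' (vc x)) \<in> hyp_plane" using that by (simp only: hyp_plane_vc vc_cv)
  qed
  then show "(\<lambda>x. cv (L (vc x))) ` hyp_plane = hyp_plane" using nr by (auto simp: hyp_plane_def)
  show "hyp_dist (cv (L (vc x))) (cv (L (vc y))) = hyp_dist x y" for x y unfolding hyp_dist_def i nr ..
qed

definition hrot :: "complex \<Rightarrow> real^2 \<Rightarrow> real^2" where "hrot u x = cv (u * vc x)"
definition hrefl :: "real^2 \<Rightarrow> real^2" where "hrefl x = cv (cnj (vc x))"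

lemma hrot_isometry:
  assumes "cmod u = 1" shows "hyp_isometry (hrot u)"
proof -
  have uu: "u * cnj u = 1" "cnj u * u = 1" using complex_norm_square[of u] assms by (auto simp: mult.commute)
  have "hyp_isometry (\<lambda>x. cv (u * vc x))"
  proof (rule inner_preserving_isometry[where L' = "\<lambda>z. cnj u * z"])
    fix a b
    have "cnj (u * a) * (u * b) = (cnj u * u) * (cnj a * b)" by (simp add: mult_ac)
    then have "cnj (u * a) * (u * b) = cnj a * b" unfolding uu by simp
    then show "Re (cnj (u * a) * (u * b)) = Re (cnj a * b)" by (simp only:)
    show "cmod (u * a) = cmod a" using assms by (simp add: norm_mult)
    show "cnj u * (u * a) = a" "u * (cnj u * a) = a" using uu by (simp_all flip: mult.assoc)
  qed
  then show ?thesis by (simp add: hrot_def[abs_def])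
qed

lemma hrefl_isometry: "hyp_isometry hrefl"
proof -
  have "hyp_isometry (\<lambda>x. cv (cnj (vc x)))"
    by (rule inner_preserving_isometry[where L' = cnj]) auto
  then show ?thesis by (simp add: hrefl_def[abs_def])
qed

section \<open>The standard regular polygons\<close>

definition regular_root :: "nat \<Rightarrow> complex" where "regular_root n = exp (2 * \<i> * of_real (pi / n))"

text \<open>\<open>r\<close> is the Euclidean circumradius in the Poincare disc. That the list is a
  simple polygon is never computed; it is inherited through an isometry from a given
  polygon.\<close>

definition std_ngon :: "nat \<Rightarrow> real \<Rightarrow> (real^2) list" where
  "std_ngon n r = map (\<lambda>j. cv (pkl (of_real r * regular_root n ^ j))) [0..<n]"

lemma regular_root_norm [simp]: "cmod (regular_root n) = 1"
  by (simp add: regular_root_def)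

lemma regular_root_power: "n > 0 \<Longrightarrow> regular_root n ^ n = 1"
proof -
  assume "n > 0"
  then have "regular_root n ^ n = exp (2 * of_real pi * \<i>)"
    unfolding regular_root_def exp_of_nat_mult[symmetric] by (simp add: mult_ac)
  then show ?thesis by simp
qed

lemma klp_cnj: "klp (cnj z) = cnj (klp z)" by (simp add: klp_def)
lemma cyc_sum_cnj:
  assumes "n > 0" "\<And>i. i < n \<Longrightarrow> cmod (v i) < 1"
  shows "cyc_sum n parea (\<lambda>i. cnj (v i)) = - cyc_sum n parea v" "cyc_sum n pdist (\<lambda>i. cnj (v i)) = cyc_sum n pdist v"
proof -
  have "parea (cnj (v i)) (cnj (v (Suc i mod n))) = - parea (v i) (v (Suc i mod n))" if "i < n" for i
    using assms that parea_cnj[of "v i" "v (Suc i mod n)"] parea_swap[of "v i" "v (Suc i mod n)"] by simp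
  then show "cyc_sum n parea (\<lambda>i. cnj (v i)) = - cyc_sum n parea v"
    unfolding cyc_sum_def sum_negf[symmetric] by (intro sum.cong) auto
qed (simp add: cyc_sum_def)

lemma pvert_neq:
  assumes P: "hyp_ngon n P" shows "i < n \<Longrightarrow> j < n \<Longrightarrow> i \<noteq> j \<Longrightarrow> pvert P i \<noteq> pvert P j"
proof -
  assume ij: "i < n" "j < n" "i \<noteq> j"
  have n: "length P = n" "distinct P" and hp: "\<And>i. i < n \<Longrightarrow> P ! i \<in> hyp_plane" using P by (auto simp: hyp_ngon_def subset_iff)
  have "P ! i \<noteq> P ! j" using n ij by (simp add: nth_eq_iff_index_eq)
  then show ?thesis unfolding pvert_def using hp ij by (metis hyp_plane_vc pkl_klp vc_eq_iff)
qed

text \<open>A clockwise polygon is reflected first, so that its signed area attains the bound. The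
  equality case then yields a half-turn to the centre, and a rotation makes the first vertex real
  and positive.\<close>

theorem extremal_imp_std:
  assumes P: "hyp_ngon n P" and eq: "\<bar>cyc_sum n parea (pvert P)\<bar> = isoarea n (cyc_sum n pdist (pvert P))"
  obtains f r where "hyp_isometry f" "0 < r" "r < 1" "map f P = std_ngon n r"
proof -
  have n: "n \<ge> 3" "length P = n" using P by (auto simp: hyp_ngon_def)
  have hp: "P ! i \<in> hyp_plane" if "i < n" for i using P that by (auto simp: hyp_ngon_def subset_iff)
  have b: "cmod (pvert P i) < 1" if "i < n" for i using pvert_bound[OF P that] .
  obtain h where h: "hyp_isometry h" "cyc_sum n parea (\<lambda>i. klp (vc (h (P ! i)))) = isoarea n (cyc_sum n pdist (\<lambda>i. klp (vc (h (P ! i)))))"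
    "\<And>i j. i < n \<Longrightarrow> j < n \<Longrightarrow> i \<noteq> j \<Longrightarrow> klp (vc (h (P ! i))) \<noteq> klp (vc (h (P ! j)))"
  proof (cases "cyc_sum n parea (pvert P) \<ge> 0")
    case True
    have "hyp_isometry (\<lambda>x. x)" by (simp add: hyp_isometry_def)
    then show ?thesis using that[of "\<lambda>x. x"] True eq pvert_neq[OF P] by (simp add: pvert_def[abs_def])
  next
    case False
    have e: "klp (vc (hrefl (P ! i))) = cnj (pvert P i)" for i by (simp add: hrefl_def klp_cnj pvert_def)
    show ?thesis
      by (rule that[of hrefl]) (use hrefl_isometry False eq pvert_neq[OF P] cyc_sum_cnj[of n "pvert P"] b n in \<open>auto simp: e\<close>)
  qed
  define v where "v i = klp (vc (h (P ! i)))" for i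
  have hh: "h (P ! i) \<in> hyp_plane" if "i < n" for i using isometry_in[OF h(1) hp[OF that]] .
  have v: "cmod (v i) < 1" if "i < n" for i unfolding v_def using hh[OF that] by (intro klp_bound) (simp add: hyp_plane_vc)
  have nz: "\<exists>i<n. v i \<noteq> v (Suc i mod n)"
    using h(3)[of 0 1] n by (intro exI[of _ 0]) (auto simp: v_def)
  obtain w \<rho> where w: "cmod w < 1" "0 < cmod \<rho>" "cmod \<rho> < 1" "\<And>i. i < n \<Longrightarrow> pinv w (v i) = \<rho> * regular_root n ^ i"
    using polygon_area_eq[OF n(1) v h(2)[folded v_def] nz] unfolding regular_root_def by metis
  define u where "u = cnj \<rho> / of_real (cmod \<rho>)"
  have u: "cmod u = 1" using w(2) by (simp add: u_def norm_divide)
  have ur: "u * \<rho> = of_real (cmod \<rho>)"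
  proof -
    have "cnj \<rho> * \<rho> = of_real (cmod \<rho>) * of_real (cmod \<rho>)" using complex_norm_square[of \<rho>] by (simp add: power2_eq_square mult.commute)
    then show ?thesis using w(2) by (simp add: u_def)
  qed
  define f where "f x = hrot u (hturn w (h x))" for x
  have f: "hyp_isometry f" unfolding f_def
    by (rule isometry_comp[OF hrot_isometry[OF u] isometry_comp[OF hturn_isometry[OF w(1)] h(1)]])
  have "f (P ! i) = cv (pkl (of_real (cmod \<rho>) * regular_root n ^ i))" if i: "i < n" for i
  proof -
    let ?y = "vc (hturn w (h (P ! i)))"
    have y: "cmod ?y < 1" using hturn_in[OF w(1) hh[OF i]] by (simp add: hyp_plane_vc)
    have "klp ?y = \<rho> * regular_root n ^ i" unfolding klp_hturn[OF w(1) hh[OF i]] v_def[symmetric] by (rule w(4)[OF i])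
    then have "?y = pkl (\<rho> * regular_root n ^ i)" using pkl_klp[OF y] by simp
    then have "u * ?y = pkl (of_real (cmod \<rho>) * regular_root n ^ i)"
      unfolding ur[symmetric] mult.assoc using pkl_rot[OF u] by simp
    then show ?thesis by (simp add: f_def hrot_def)
  qed
  then have "map f P = std_ngon n (cmod \<rho>)"
    unfolding std_ngon_def using n by (intro nth_equalityI) auto
  then show thesis using that[OF f w(2,3)] by blast
qed

lemma std_ngon_nth: "i < n \<Longrightarrow> std_ngon n r ! i = cv (pkl (of_real r * regular_root n ^ i))"
  by (simp add: std_ngon_def)

lemma pvert_std:
  assumes "0 \<le> r" "r < 1" "i < n" shows "pvert (std_ngon n r) i = of_real r * regular_root n ^ i"
proof -
  have "cmod (of_real r * regular_root n ^ i) < 1" using assms by (simp add: norm_mult norm_power)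
  then show ?thesis using assms by (simp add: pvert_def std_ngon_nth klp_pkl)
qed

lemma std_ngon_area:
  assumes n: "n \<ge> 3" and r: "0 < r" "r < 1" and Q: "hyp_ngon n (std_ngon n r)"
  shows "hyp_area (std_ngon n r) = isoarea n (hyp_peri (std_ngon n r))"
proof -
  have w1: "regular_root n \<noteq> 1"
    using pvert_neq[OF Q, of 0 1] n r by (auto simp: pvert_std)
  have v: "pvert (std_ngon n r) i = of_real r * regular_root n ^ i" if "i < n" for i
    using pvert_std that r by auto
  have "cyc_sum n parea (pvert (std_ngon n r)) = isoarea n (cyc_sum n pdist (pvert (std_ngon n r)))"
    by (rule iffD2[OF rotation_polygon_bound(2)[OF n v regular_root_norm regular_root_power _ _ w1] regular_root_def])
      (use n r in auto)
  then show ?thesis unfolding hyp_area_eq[OF Q] hyp_peri_eq[OF Q] using isoarea_nonneg[OF n] by simp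
qed

lemma std_ngon_side:
  assumes n: "n \<ge> 3" and r: "0 < r" "r < 1" and Q: "hyp_ngon n (std_ngon n r)" and i: "i < n"
  shows "side_length (std_ngon n r) i = pdist (of_real r) (of_real r * regular_root n)"
    "hyp_peri (std_ngon n r) = real n * pdist (of_real r) (of_real r * regular_root n)"
proof -
  let ?Q = "std_ngon n r" and ?w = "regular_root n"
  have hp: "?Q ! j \<in> hyp_plane" if "j < n" for j using Q that by (auto simp: hyp_ngon_def subset_iff)
  have l: "length ?Q = n" by (simp add: std_ngon_def)
  have s: "side_length ?Q j = pdist (of_real r) (of_real r * ?w)" if j: "j < n" for j
  proof -
    have sj: "Suc j mod n < n" using n by simp
    have p: "?w ^ (Suc j mod n) = ?w ^ Suc j"
    proof (cases "Suc j = n")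
      case True then show ?thesis using regular_root_power[of n] n by simp
    next
      case False then show ?thesis using j by simp
    qed
    have b: "cmod (of_real r * ?w ^ k) < 1" for k using r by (simp add: norm_mult norm_power)
    have "side_length ?Q j = pdist (klp (vc (?Q ! j))) (klp (vc (?Q ! (Suc j mod n))))"
      unfolding side_length_def l by (rule hyp_dist_pdist[OF hp[OF j] hp[OF sj]])
    also have "\<dots> = pdist (of_real r * ?w ^ j) (of_real r * ?w ^ Suc j)"
      unfolding std_ngon_nth[OF j] std_ngon_nth[OF sj] vc_cv p klp_pkl[OF b] ..
    also have "\<dots> = pdist (of_real r) (of_real r * ?w)"
    proof -
      have c: "cnj (?w ^ j) * ?w ^ j = 1" using complex_norm_square[of "?w ^ j"] by (simp add: norm_power mult.commute)
      have k: "cnj (of_real r * ?w ^ j) * (of_real r * ?w ^ Suc j) = cnj (of_real r) * (of_real r * ?w)"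
      proof -
        have "cnj (of_real r * ?w ^ j) * (of_real r * ?w ^ Suc j) = (cnj (?w ^ j) * ?w ^ j) * (cnj (of_real r) * (of_real r * ?w))"
          by (simp only: complex_cnj_mult power_Suc mult_ac)
        then show ?thesis unfolding c by simp
      qed
      have "of_real r * ?w ^ j - of_real r * ?w ^ Suc j = ?w ^ j * (of_real r - of_real r * ?w)" by (simp add: algebra_simps)
      then have "cmod (of_real r * ?w ^ j - of_real r * ?w ^ Suc j) = cmod (of_real r - of_real r * ?w)"
        by (simp only: norm_mult norm_power regular_root_norm) simp
      then show ?thesis unfolding pdist_def pdelta_def k by (simp only:)
    qed
    finally show ?thesis .
  qed
  then show "side_length ?Q i = pdist (of_real r) (of_real r * ?w)" using i by blast
  show "hyp_peri ?Q = real n * pdist (of_real r) (of_real r * ?w)" using s by (simp add: hyp_peri_def l)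
qed

text \<open>The square of \<open>cosh\<close> of half the side is an increasing function of
  \<open>r / (1 - r^2)\<close>, hence of \<open>r\<close>. Extremal polygons of equal perimeter thus
  have the same standard form, so a single polygon serves for all of them.\<close>

lemma std_ngon_inj:
  assumes n: "n \<ge> 3" and r: "0 < r" "r < 1" "0 < s" "s < 1" and Q: "hyp_ngon n (std_ngon n r)" "hyp_ngon n (std_ngon n s)"
    and eq: "hyp_peri (std_ngon n r) = hyp_peri (std_ngon n s)"
  shows "r = s"
proof -
  let ?w = "regular_root n"
  define c where "c = Re ?w"
  have w1: "?w \<noteq> 1" using pvert_neq[OF Q(1), of 0 1] n r by (auto simp: pvert_std)
  have c: "c < 1"
  proof (rule ccontr)
    assume "\<not> c < 1"
    moreover have "(Re ?w)\<^sup>2 + (Im ?w)\<^sup>2 = 1" using regular_root_norm[of n] cmod_power2[of ?w] by simp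
    moreover have "c \<le> 1" unfolding c_def using complex_Re_le_cmod[of ?w] by simp
    ultimately have "c = 1" "Im ?w = 0" by (auto simp: c_def)
    then show False using w1 by (simp add: c_def complex_eq_iff)
  qed
  have F: "(cosh (pdist (of_real t) (of_real t * ?w) / 2))\<^sup>2 = 1 + 2 * (1 - c) * (t\<^sup>2 / (1 - t\<^sup>2)\<^sup>2)" if t: "0 < t" "t < 1" for t
  proof -
    have b: "cmod (of_real t) < 1" "cmod (of_real t * ?w) < 1" "t\<^sup>2 < 1" using t by (auto simp: norm_mult abs_square_less_1)
    have k: "cnj (of_real t) * (of_real t * ?w) = of_real (t\<^sup>2) * ?w" by (simp add: power2_eq_square)
    have "cosh (pdist (of_real t) (of_real t * ?w) / 2) = cmod (1 - of_real (t\<^sup>2) * ?w) / (1 - t\<^sup>2)"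
      unfolding cosh_pdist_half[OF b(1,2)] k using b(3) t by (simp add: norm_mult)
    then have "(cosh (pdist (of_real t) (of_real t * ?w) / 2))\<^sup>2 = (cmod (1 - of_real (t\<^sup>2) * ?w))\<^sup>2 / (1 - t\<^sup>2)\<^sup>2"
      by (simp only: power_divide)
    also have "(cmod (1 - of_real (t\<^sup>2) * ?w))\<^sup>2 = (1 - t\<^sup>2)\<^sup>2 + 2 * (1 - c) * t\<^sup>2"
    proof -
      have "(cmod (1 - of_real (t\<^sup>2) * ?w))\<^sup>2 = 1 - 2 * t\<^sup>2 * c + (t\<^sup>2)\<^sup>2 * (cmod ?w)\<^sup>2"
        unfolding cmod_power2 c_def by (simp add: power2_eq_square algebra_simps)
      then show ?thesis by (simp add: power2_eq_square algebra_simps)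
    qed
    finally show ?thesis using b(3) by (simp add: add_divide_distrib)
  qed
  have "pdist (of_real r) (of_real r * ?w) = pdist (of_real s) (of_real s * ?w)"
    using eq std_ngon_side(2)[OF n r(1,2) Q(1), of 0] std_ngon_side(2)[OF n r(3,4) Q(2), of 0] n by simp
  then have "2 * (1 - c) * (r\<^sup>2 / (1 - r\<^sup>2)\<^sup>2) = 2 * (1 - c) * (s\<^sup>2 / (1 - s\<^sup>2)\<^sup>2)"
    using F[OF r(1,2)] F[OF r(3,4)] by simp
  then have e: "r\<^sup>2 / (1 - r\<^sup>2)\<^sup>2 = s\<^sup>2 / (1 - s\<^sup>2)\<^sup>2" unfolding mult_cancel_left using c by auto
  have b: "r\<^sup>2 < 1" "s\<^sup>2 < 1" using r by (auto simp: abs_square_less_1)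
  have "(r / (1 - r\<^sup>2))\<^sup>2 = (s / (1 - s\<^sup>2))\<^sup>2" using e by (simp only: power_divide)
  moreover have "r / (1 - r\<^sup>2) > 0" "s / (1 - s\<^sup>2) > 0" using r b by auto
  ultimately have "r / (1 - r\<^sup>2) = s / (1 - s\<^sup>2)" by (metis less_imp_le power2_eq_imp_eq)
  then have "r * (1 - s\<^sup>2) = s * (1 - r\<^sup>2)" using b by (simp add: field_simps)
  then have "(r - s) * (1 + r * s) = 0" by (simp add: power2_eq_square algebra_simps)
  moreover have "1 + r * s > 0" using r by (simp add: add_pos_pos)
  ultimately show ?thesis by simp
qed

text \<open>The rotation by \<open>regular_root n\<close> shifts the vertices cyclically and
  preserves boundary, inside and metric. It carries each interior angle to the next, including the
  test that decides between an angle and its complement to \<open>2 * pi\<close>.\<close>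

lemma std_ngon_regular:
  assumes n: "n \<ge> 3" and r: "0 < r" "r < 1" and Q: "hyp_ngon n (std_ngon n r)"
  shows "regular_ngon n (std_ngon n r)"
proof -
  let ?Q = "std_ngon n r" and ?w = "regular_root n"
  have l: "length ?Q = n" by (simp add: std_ngon_def)
  define R where "R = hrot ?w"
  have Ri: "hyp_isometry R" unfolding R_def by (rule hrot_isometry) simp
  have RQ: "R (?Q ! i) = ?Q ! (Suc i mod n)" if i: "i < n" for i
  proof -
    have "?w ^ (Suc i mod n) = ?w ^ Suc i"
    proof (cases "Suc i = n")
      case True then show ?thesis using regular_root_power[of n] n by simp
    next
      case False then show ?thesis using i by simp
    qed
    moreover have "?w * pkl (of_real r * ?w ^ i) = pkl (of_real r * ?w ^ Suc i)"
      using pkl_rot[of ?w "of_real r * ?w ^ i"] by (simp add: mult_ac)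
    ultimately show ?thesis using i n by (simp add: R_def hrot_def std_ngon_nth)
  qed
  have bR: "R ` poly_boundary ?Q = poly_boundary ?Q"
  proof -
    have "R ` poly_side ?Q i = poly_side ?Q (Suc i mod n)" if i: "i < n" for i
    proof -
      have hp: "?Q ! j \<in> hyp_plane" if "j < n" for j using Q that by (auto simp: hyp_ngon_def subset_iff)
      have "R ` poly_side ?Q i = closed_segment (R (?Q ! i)) (R (?Q ! (Suc i mod n)))"
        using isometry_geodesic[OF Ri] hp[OF i] hp[of "Suc i mod n"] n unfolding poly_side_def l geodesic_map_def by simp
      then show ?thesis using RQ[OF i] RQ[of "Suc i mod n"] n by (simp add: poly_side_def l)
    qed
    then have "R ` poly_boundary ?Q = (\<Union>i<n. poly_side ?Q (Suc i mod n))" unfolding poly_boundary_def l image_UN by simp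
    also have "\<dots> = (\<Union>i<n. poly_side ?Q i)"
    proof
      have "Suc i mod n < n" for i using n by simp
      then show "(\<Union>i<n. poly_side ?Q (Suc i mod n)) \<subseteq> (\<Union>i<n. poly_side ?Q i)" by blast
      show "(\<Union>i<n. poly_side ?Q i) \<subseteq> (\<Union>i<n. poly_side ?Q (Suc i mod n))"
      proof
        fix x assume "x \<in> (\<Union>i<n. poly_side ?Q i)"
        then obtain i where i: "i < n" "x \<in> poly_side ?Q i" by auto
        then show "x \<in> (\<Union>i<n. poly_side ?Q (Suc i mod n))" using cyc_pred(1,3)[OF n i(1)] by (metis UN_I lessThan_iff)
      qed
    qed
    finally show ?thesis by (simp add: poly_boundary_def l)
  qed
  have Rlin: "R (x + y) = R x + R y" "R (x - y) = R x - R y" "R (c *\<^sub>R x) = c *\<^sub>R R x" for x y c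
    unfolding R_def hrot_def vc_simps mult.left_commute[of ?w] by (simp_all only: cv_simps distrib_left right_diff_distrib)
  have Rinj: "R x = R y \<longleftrightarrow> x = y" for x y
  proof
    assume "R x = R y"
    then have "?w * vc x = ?w * vc y" unfolding R_def hrot_def by (metis vc_cv(1))
    moreover have "?w \<noteq> 0" by (simp add: regular_root_def)
    ultimately show "x = y" by simp
  qed simp
  have iR: "inside (poly_boundary ?Q) = R ` inside (poly_boundary ?Q)"
  proof -
    obtain g where "homeomorphism hyp_plane hyp_plane R g" using isometry_inverse[OF Ri] by blast
    moreover have "compact (poly_boundary ?Q)" unfolding poly_boundary_def poly_side_def by (intro compact_UN) auto
    ultimately have "inside (R ` poly_boundary ?Q) = R ` inside (poly_boundary ?Q)"
      using ngon_boundary_subset[OF Q] by (intro inside_homeomorphism) (auto simp: hyp_plane_def)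
    then show ?thesis unfolding bR .
  qed
  then have inR: "R x \<in> inside (poly_boundary ?Q) \<longleftrightarrow> x \<in> inside (poly_boundary ?Q)" for x
    using Rinj by (metis image_iff)
  have Rinner: "R x \<bullet> R y = x \<bullet> y" for x y
  proof -
    have "cnj ?w * ?w = 1" using complex_norm_square[of ?w] by (simp add: mult.commute)
    moreover have "cnj (?w * vc x) * (?w * vc y) = (cnj ?w * ?w) * (cnj (vc x) * vc y)" by (simp add: mult_ac)
    ultimately show ?thesis by (simp only: inner_vc R_def hrot_def vc_cv) simp
  qed
  have Rnorm: "norm (R x) = norm x" for x by (simp add: norm_eq_sqrt_inner Rinner)
  have ang: "hyp_angle (R v) (R a) (R b) = hyp_angle v a b" for v a b
    by (simp add: hyp_angle_def hyp_metric_def Rinner Rnorm)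
  have step: "interior_angle ?Q (Suc i mod n) = interior_angle ?Q i" if i: "i < n" for i
  proof -
    let ?p = "(i + n - 1) mod n" and ?s = "Suc i mod n"
    have s: "?s < n" using n by simp
    have pp: "(?s + n - 1) mod n = i"
      using cyc_succ_eq_iff[OF n s i] by simp
    have Rv: "R (?Q ! i) = ?Q ! ?s" by (rule RQ[OF i])
    have Rp: "R (?Q ! ?p) = ?Q ! i" using RQ[of ?p] cyc_pred(1,3)[OF n i] by simp
    have Rs: "R (?Q ! ?s) = ?Q ! (Suc ?s mod n)" by (rule RQ[OF s])
    let ?v = "?Q ! i" and ?a = "?Q ! ?p - ?Q ! i" and ?b = "?Q ! ?s - ?Q ! i"
    have e: "?Q ! ((?s + n - 1) mod n) - ?Q ! ?s = R ?a" "?Q ! (Suc ?s mod n) - ?Q ! ?s = R ?b"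
      unfolding pp Rlin Rp Rv Rs by auto
    have m: "?Q ! ?s + t *\<^sub>R (R ?a + R ?b) = R (?v + t *\<^sub>R (?a + ?b))" for t unfolding Rlin Rv ..
    show ?thesis unfolding interior_angle_def Let_def l e m inR unfolding Rv[symmetric] ang ..
  qed
  have all: "interior_angle ?Q i = interior_angle ?Q 0" if "i < n" for i
    using that
  proof (induction i)
    case (Suc i)
    then show ?case using step[of i] by simp
  qed simp
  show ?thesis unfolding regular_ngon_def
    using Q all std_ngon_side(1)[OF n r Q] by metis
qed

section \<open>Angles and orientations at a vertex\<close>

lemma Re_Im_of_real_mult: "Re (of_real r * z) = r * Re z" "Im (of_real r * z) = r * Im z"
  by simp_all

text \<open>A half-turn moves the vertex to the centre, where the Klein metric is Euclidean.
  Invariance is obtained without differentiating: on chords from \<open>v\<close> the metric is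
  expressed through \<open>1 - z \<bullet> z'\<close> for pairs among \<open>v\<close>,
  \<open>z\<close>, \<open>z'\<close>, that is, through distances. The positive factors
  \<open>c\<close> cancel in the angle.\<close>

lemma hyp_angle_pinv:
  assumes h: "v \<in> hyp_plane" "x \<in> hyp_plane" "y \<in> hyp_plane" 
  defines "a \<equiv> pinv (klp (vc v)) (klp (vc x))" and "b \<equiv> pinv (klp (vc v)) (klp (vc y))"
  shows "hyp_angle v (x - v) (y - v) = arccos (Re (cnj a * b) / (cmod a * cmod b))"
proof -
  define w where "w = klp (vc v)"
  have w: "cmod w < 1" unfolding w_def using h(1) by (intro klp_bound) (simp add: hyp_plane_vc)
  define f where "f = hturn w"
  have fi: "hyp_isometry f" unfolding f_def by (rule hturn_isometry[OF w])
  have fv: "f v = 0"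
  proof -
    have "klp (vc (f v)) = 0" unfolding f_def klp_hturn[OF w h(1)] by (simp add: w_def)
    then have "pkl (klp (vc (f v))) = 0" by (simp add: pkl_def)
    then have "vc (f v) = vc 0" using isometry_in[OF fi h(1)] by (simp add: pkl_klp hyp_plane_vc)
    then show ?thesis by (simp only: vc_eq_iff)
  qed
  define q where "q z = sqrt (1 - (norm z)\<^sup>2)" for z :: "real^2"
  have q: "q z > 0" "(q z)\<^sup>2 = 1 - (norm z)\<^sup>2" if "z \<in> hyp_plane" for z
  proof -
    have "(norm z)\<^sup>2 < 1" using that by (simp add: hyp_plane_def abs_square_less_1)
    then show "q z > 0" "(q z)\<^sup>2 = 1 - (norm z)\<^sup>2" by (auto simp: q_def)
  qed
  have ch: "1 - z \<bullet> z' = q z * q z' * cosh (hyp_dist z z')" if "z \<in> hyp_plane" "z' \<in> hyp_plane" for z z'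
    using cosh_hyp_dist[OF that] q(1)[OF that(1)] q(1)[OF that(2)] by (simp add: q_def real_sqrt_mult)
  have fin: "f z \<in> hyp_plane" if "z \<in> hyp_plane" for z by (rule isometry_in[OF fi that])
  have fd: "hyp_dist (f z) (f z') = hyp_dist z z'" if "z \<in> hyp_plane" "z' \<in> hyp_plane" for z z'
    using fi that by (simp add: hyp_isometry_def)
  define c where "c z = q z / (q (f z) * q v)" for z
  have cp: "c z > 0" if "z \<in> hyp_plane" for z using q(1)[OF that] q(1)[OF fin[OF that]] q(1)[OF h(1)] by (simp add: c_def)
  have M: "hyp_metric v (z - v) (z' - v) = c z * c z' * (f z \<bullet> f z')" if z: "z \<in> hyp_plane" "z' \<in> hyp_plane" for z z'
  proof -
    have N: "1 - (norm v)\<^sup>2 = (q v)\<^sup>2" using q(2)[OF h(1)] by simp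
    have N': "v \<bullet> v = 1 - (q v)\<^sup>2" using N by (simp add: power2_norm_eq_inner)
    have qv: "q v > 0" by (rule q(1)[OF h(1)])
    have A: "1 - u \<bullet> v = q u * q v / q (f u)" if u: "u \<in> hyp_plane" for u
    proof -
      have "1 = q (f u) * q 0 * cosh (hyp_dist u v)" using ch[OF fin[OF u] fin[OF h(1)]] fd[OF u h(1)] fv by simp
      moreover have "q 0 = 1" by (simp add: q_def)
      ultimately have "cosh (hyp_dist u v) = 1 / q (f u)" using q(1)[OF fin[OF u]] by (simp add: field_simps)
      then show ?thesis using ch[OF u h(1)] by simp
    qed
    have B: "1 - z \<bullet> z' = q z * q z' * ((1 - f z \<bullet> f z') / (q (f z) * q (f z')))"
      using ch[OF z] ch[OF fin[OF z(1)] fin[OF z(2)]] fd[OF z] q(1)[OF fin[OF z(1)]] q(1)[OF fin[OF z(2)]] by simp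
    have "((z - v) \<bullet> (z' - v)) * (q v)\<^sup>2 + (v \<bullet> (z - v)) * (v \<bullet> (z' - v))
       = (1 - z \<bullet> v) * (1 - z' \<bullet> v) - (1 - z \<bullet> z') * (q v)\<^sup>2"
      by (simp only: inner_diff_left inner_diff_right N' inner_commute[of v z] inner_commute[of v z']) (simp add: algebra_simps)
    also have "\<dots> = (q v)\<^sup>2 * (q z * q z' / (q (f z) * q (f z'))) * (f z \<bullet> f z')"
      unfolding A[OF z(1)] A[OF z(2)] B using q(1)[OF fin[OF z(1)]] q(1)[OF fin[OF z(2)]]
      by (simp add: field_simps power2_eq_square)
    finally have E: "((z - v) \<bullet> (z' - v)) * (q v)\<^sup>2 + (v \<bullet> (z - v)) * (v \<bullet> (z' - v)) = (q v)\<^sup>2 * (q z * q z' / (q (f z) * q (f z'))) * (f z \<bullet> f z')" .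
    have "hyp_metric v (z - v) (z' - v) = (((z - v) \<bullet> (z' - v)) * (q v)\<^sup>2 + (v \<bullet> (z - v)) * (v \<bullet> (z' - v))) / ((q v)\<^sup>2)\<^sup>2"
      unfolding hyp_metric_def N using qv by (simp add: field_simps power2_eq_square)
    also have "\<dots> = c z * c z' * (f z \<bullet> f z')"
      unfolding E c_def using qv by (simp add: field_simps power2_eq_square)
    finally show ?thesis .
  qed
  have "hyp_angle v (x - v) (y - v) = arccos ((f x \<bullet> f y) / (norm (f x) * norm (f y)))"
  proof -
    have "sqrt (c x * c x * (f x \<bullet> f x) * (c y * c y * (f y \<bullet> f y))) = (c x * c y) * (norm (f x) * norm (f y))"
      using cp[OF h(2)] cp[OF h(3)] by (simp add: real_sqrt_mult norm_eq_sqrt_inner)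
    then show ?thesis unfolding hyp_angle_def M[OF h(2,3)] M[OF h(2,2)] M[OF h(3,3)]
      using cp[OF h(2)] cp[OF h(3)] by simp
  qed
  moreover have "vc (f z) = of_real (2 / (1 + (cmod (pinv w (klp (vc z))))\<^sup>2)) * pinv w (klp (vc z))" if z: "z \<in> hyp_plane" for z
  proof -
    have "vc (f z) = pkl (klp (vc (f z)))" using fin[OF z] by (simp add: pkl_klp hyp_plane_vc)
    then show ?thesis unfolding f_def klp_hturn[OF w z] by (simp add: pkl_def)
  qed
  then have "vc (f x) = of_real (2 / (1 + (cmod a)\<^sup>2)) * a" "vc (f y) = of_real (2 / (1 + (cmod b)\<^sup>2)) * b"
    using h unfolding a_def b_def w_def by blast+
  moreover have "(0::real) < 2 / (1 + (cmod a)\<^sup>2)" "(0::real) < 2 / (1 + (cmod b)\<^sup>2)" by (simp_all add: add_pos_nonneg)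
  moreover have "Re (cnj (of_real s * a) * (of_real t * b)) / (cmod (of_real s * a) * cmod (of_real t * b)) = Re (cnj a * b) / (cmod a * cmod b)"
    if "s > 0" "t > 0" for s t :: real
  proof -
    have "cnj (of_real s * a) * (of_real t * b) = of_real (s * t) * (cnj a * b)" by simp
    then have "Re (cnj (of_real s * a) * (of_real t * b)) = (s * t) * Re (cnj a * b)" by (simp only: Re_Im_of_real_mult)
    moreover have "cmod (of_real s * a) * cmod (of_real t * b) = (s * t) * (cmod a * cmod b)" using that by (simp add: norm_mult)
    ultimately show ?thesis using that by (simp only: mult_divide_mult_cancel_left) simp
  qed
  ultimately show ?thesis by (simp only: inner_vc norm_vc[symmetric])
qed

text \<open>Around \<open>V\<close> the numerator of \<open>kturn\<close> is
  \<open>- (x + w^2 * cnj x)\<close> with \<open>x = k - V\<close>, a real-linear map of determinant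
  \<open>1 - (cmod w)^4 > 0\<close>; all other factors are positive.\<close>

lemma pinv_orientation:
  assumes h: "cmod V < 1" "cmod X < 1" "cmod Y < 1"
  defines "a \<equiv> pinv (klp V) (klp X)" and "b \<equiv> pinv (klp V) (klp Y)"
  shows "sgn (Im (cnj a * b)) = sgn (Im (cnj (X - V) * (Y - V)))"
proof -
  define w where "w = klp V"
  have w: "cmod w < 1" unfolding w_def by (rule klp_bound[OF h(1)])
  have Vw: "V = pkl w" unfolding w_def by (rule pkl_klp[OF h(1), symmetric])
  have p: "1 + (cmod w)\<^sup>2 > 0" by (simp add: add_pos_nonneg)
  define d where "d k = 1 + (cmod w)\<^sup>2 - 2 * Re (cnj w * k)" for k
  define m where "m k = 2 * w - k - w\<^sup>2 * cnj k" for k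
  have mV: "V + w\<^sup>2 * cnj V = 2 * w"
  proof -
    define E :: complex where "E = of_real (1 + (cmod w)\<^sup>2)"
    have E: "E \<noteq> 0" using p unfolding E_def of_real_eq_0_iff by linarith
    have "1 + w * cnj w = E" unfolding E_def using complex_norm_square[of w] by simp
    moreover have "V + w\<^sup>2 * cnj V = 2 * w * (1 + w * cnj w) / E"
      unfolding Vw pkl_def E_def[symmetric] using E by (simp add: E_def[symmetric] power2_eq_square add_divide_distrib algebra_simps)
        (simp add: E_def)
    ultimately show ?thesis using E by simp
  qed
  have m: "m k = - ((k - V) + w\<^sup>2 * cnj (k - V))" for k
    unfolding m_def mV[symmetric] by (simp add: algebra_simps)
  have pk: "of_real (2 / (1 + (cmod (pinv w (klp k)))\<^sup>2)) * pinv w (klp k) = m k / of_real (d k)" if "cmod k < 1" for k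
  proof -
    have "of_real (2 / (1 + (cmod (pinv w (klp k)))\<^sup>2)) * pinv w (klp k) = pkl (pinv w (klp k))" by (simp add: pkl_def)
    also have "\<dots> = kturn w k" unfolding pkl_pinv[OF w klp_bound[OF that]] pkl_klp[OF that] ..
    finally show ?thesis by (simp only: kturn_def m_def d_def)
  qed
  have dp: "d k > 0" if "cmod k < 1" for k unfolding d_def by (rule kturn_denom_pos[OF w that])
  define s t where "s = 2 / (1 + (cmod a)\<^sup>2)" and "t = 2 / (1 + (cmod b)\<^sup>2)"
  have st: "s > 0" "t > 0" by (simp_all add: s_def t_def add_pos_nonneg)
  have aX: "of_real (s * d X) * a = m X" using pk[OF h(2)] dp[OF h(2)] by (simp add: a_def[folded w_def] s_def field_simps)
  have bY: "of_real (t * d Y) * b = m Y" using pk[OF h(3)] dp[OF h(3)] by (simp add: b_def[folded w_def] t_def field_simps)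
  have "Im (cnj (m X) * m Y) = (s * d X) * (t * d Y) * Im (cnj a * b)"
  proof -
    have "cnj (m X) * m Y = of_real ((s * d X) * (t * d Y)) * (cnj a * b)" unfolding aX[symmetric] bY[symmetric] by simp
    then show ?thesis by (simp only: Re_Im_of_real_mult)
  qed
  moreover have "Im (cnj (m X) * m Y) = (1 - ((cmod w)\<^sup>2)\<^sup>2) * Im (cnj (X - V) * (Y - V))"
    unfolding m cmod_power2 by (simp add: power2_eq_square algebra_simps)
  ultimately have "sgn ((s * d X) * (t * d Y)) * sgn (Im (cnj a * b)) = sgn (1 - ((cmod w)\<^sup>2)\<^sup>2) * sgn (Im (cnj (X - V) * (Y - V)))"
    by (simp only: sgn_mult[symmetric])
  moreover have "sgn ((s * d X) * (t * d Y)) = 1" using st dp[OF h(2)] dp[OF h(3)] by (intro sgn_pos mult_pos_pos)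
  moreover have "((cmod w)\<^sup>2)\<^sup>2 < 1" using power_strict_mono[of "(cmod w)\<^sup>2" 1 2] disc_sq[OF w] by simp
  then have "sgn (1 - ((cmod w)\<^sup>2)\<^sup>2) = 1" by (intro sgn_pos) simp
  ultimately show ?thesis by simp
qed

context simple_polygon
begin

text \<open>For small \<open>t > 0\<close> the point \<open>v + t c\<close> lies in the triangle at
  \<open>v\<close> and \<open>v - t c\<close> outside it, so the values of \<open>wsum\<close> there
  differ by \<open>sgn D\<close>. Both values lie in \<open>{0, s}\<close>, so their difference
  tells which of the two points is inside. A convex vertex of a counterclockwise polygon has
  \<open>D < 0\<close>, whence the minus sign.\<close>

lemma inside_near_vertex:
  fixes i :: nat
  defines "p \<equiv> Z i" and "v \<equiv> Z (Suc i)" and "q \<equiv> Z (Suc (Suc i))"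
  defines "D \<equiv> Im (cnj (p - v) * (q - v))"
  assumes D: "D \<noteq> 0" and s: "s \<in> {1, -1 :: real}" "\<And>x. x \<in> inside bd \<Longrightarrow> wsum x = of_real s"
    "\<And>x. x \<notin> bd \<Longrightarrow> x \<notin> inside bd \<Longrightarrow> wsum x = 0"
  shows "(\<forall>\<^sub>F t in at_right 0. v + of_real t * ((p - v) + (q - v)) \<in> inside bd) \<longleftrightarrow> sgn D = - s"
proof -
  have indep: "\<alpha> = 0 \<and> \<gamma> = 0" if e: "of_real \<alpha> * (p - v) + of_real \<gamma> * (q - v) = 0" for \<alpha> \<gamma> :: real
  proof -
    have "Im (cnj (p - v) * (of_real \<alpha> * (p - v) + of_real \<gamma> * (q - v))) = \<gamma> * D"
      "Im (cnj (q - v) * (of_real \<alpha> * (p - v) + of_real \<gamma> * (q - v))) = - \<alpha> * D"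
      unfolding D_def by (simp_all add: algebra_simps)
    then show ?thesis unfolding e using D by simp
  qed
  have seg1: "x \<in> closed_segment p v \<Longrightarrow> \<exists>u. x - v = of_real u * (p - v)" for x
  proof -
    assume "x \<in> closed_segment p v"
    then obtain u where "x = (1 - u) *\<^sub>R p + u *\<^sub>R v" by (auto simp: in_segment)
    then have "x - v = of_real (1 - u) * (p - v)" by (simp add: scaleR_conv_of_real algebra_simps)
    then show ?thesis by blast
  qed
  have seg2: "x \<in> closed_segment v q \<Longrightarrow> \<exists>u. x - v = of_real u * (q - v)" for x
  proof -
    assume "x \<in> closed_segment v q"
    then obtain u where "x = (1 - u) *\<^sub>R v + u *\<^sub>R q" by (auto simp: in_segment)
    then have "x - v = of_real u * (q - v)" by (simp add: scaleR_conv_of_real algebra_simps)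
    then show ?thesis by blast
  qed
  have seg3: "x \<in> closed_segment q p \<Longrightarrow> \<exists>u. x - v = of_real u * (p - v) + of_real (1 - u) * (q - v)" for x
  proof -
    assume "x \<in> closed_segment q p"
    then obtain u where "x = (1 - u) *\<^sub>R q + u *\<^sub>R p" by (auto simp: in_segment)
    then have "x - v = of_real u * (p - v) + of_real (1 - u) * (q - v)" by (simp add: scaleR_conv_of_real algebra_simps)
    then show ?thesis by blast
  qed
  have nc: "v \<notin> closed_segment q p"
  proof
    assume "v \<in> closed_segment q p"
    then obtain u where "v - v = of_real u * (p - v) + of_real (1 - u) * (q - v)" using seg3 by blast
    then show False using indep[of u "1 - u"] by auto
  qed
  define c where "c = (p - v) + (q - v)"
  have c0: "c \<noteq> 0" using indep[of 1 1] by (auto simp: c_def)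
  let ?T = "linepath p v +++ linepath v q +++ linepath q p"
  obtain e where e: "e > 0" "ball v e \<inter> bd \<subseteq> closed_segment p v \<union> closed_segment v q"
    "\<And>x y. x \<in> ball v e - bd \<Longrightarrow> y \<in> ball v e - bd \<Longrightarrow> wsum x - winding_number ?T x = wsum y - winding_number ?T y"
    using winding_at_vertex[of i] nc unfolding p_def v_def q_def by blast
  \<comment> \<open>The bound \<open>1/4\<close> keeps \<open>t\<close> below \<open>1/2\<close>,
    where the ray from \<open>v\<close> meets the segment from \<open>q\<close> to \<open>p\<close>;
    the other bound keeps the points in the ball.\<close>
  define t0 where "t0 = min (1/4) (e / (2 * cmod c))"
  have t0: "t0 > 0" using e c0 by (simp add: t0_def)
  have nb: "v + of_real t * c \<in> ball v e - bd" if t: "t \<noteq> 0" "\<bar>t\<bar> < t0" for t :: real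
  proof -
    have "\<bar>t\<bar> * cmod c < e / (2 * cmod c) * cmod c" using t c0 by (intro mult_strict_right_mono) (auto simp: t0_def)
    also have "\<dots> < e" using e(1) c0 by simp
    finally have b: "v + of_real t * c \<in> ball v e" by (simp add: dist_norm norm_mult)
    have 1: "v + of_real t * c \<notin> closed_segment p v"
    proof
      assume "v + of_real t * c \<in> closed_segment p v"
      then obtain u where "of_real t * c = of_real u * (p - v)" using seg1 by fastforce
      then have "of_real (t - u) * (p - v) + of_real t * (q - v) = 0" by (simp add: c_def algebra_simps)
      then show False using indep t by blast
    qed
    have 2: "v + of_real t * c \<notin> closed_segment v q"
    proof
      assume "v + of_real t * c \<in> closed_segment v q"
      then obtain u where "of_real t * c = of_real u * (q - v)" using seg2 by fastforce
      then have "of_real t * (p - v) + of_real (t - u) * (q - v) = 0" by (simp add: c_def algebra_simps)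
      then show False using indep t by blast
    qed
    show ?thesis using b 1 2 e(2) by blast
  qed
  have wx: "winding_number ?T (v + of_real t * c) = - of_real (sgn D)" if t: "0 < t" "t < t0" for t
  proof -
    let ?x = "v + of_real t * c"
    have t4: "t < 1/4" using t by (simp add: t0_def)
    have "?x = t *\<^sub>R p + (1 - 2 * t) *\<^sub>R v + t *\<^sub>R q" by (simp add: c_def scaleR_conv_of_real algebra_simps)
    then have hull: "?x \<in> convex hull {p, v, q}" unfolding convex_hull_3 using t t4
      by (intro CollectI exI[of _ t] exI[of _ "1 - 2 * t"]) auto
    have "?x \<notin> closed_segment q p"
    proof
      assume "?x \<in> closed_segment q p"
      then obtain u where "of_real t * c = of_real u * (p - v) + of_real (1 - u) * (q - v)" using seg3 by fastforce
      then have "of_real (t - u) * (p - v) + of_real (t - (1 - u)) * (q - v) = 0" by (simp add: c_def algebra_simps)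
      then have "t - u = 0 \<and> t - (1 - u) = 0" by (rule indep)
      then show False using t4 by linarith
    qed
    moreover have "?x \<notin> bd" using nb[of t] t by auto
    then have "?x \<notin> closed_segment p v" "?x \<notin> closed_segment v q"
      using segment_subset_bd[of i] segment_subset_bd[of "Suc i"] unfolding p_def v_def q_def by auto
    ultimately have int: "?x \<in> interior (convex hull {p, v, q})" using hull by (simp add: interior_of_triangle)
    have "Im ((v - p) * cnj (v - ?x)) = - t * D" unfolding c_def D_def by (simp add: algebra_simps)
    then have "0 < Im ((v - p) * cnj (v - ?x)) \<longleftrightarrow> D < 0" using t by (simp add: mult_less_0_iff zero_less_mult_iff)
    then show ?thesis using winding_number_triangle[OF int] D by (simp add: sgn_if)
  qed
  have wy: "winding_number ?T (v + of_real (- t) * c) = 0" if t: "0 < t" "t < t0" for t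
  proof (rule winding_number_zero_outside)
    show "path_image ?T \<subseteq> convex hull {p, v, q}"
      by (simp add: path_image_join) (intro conjI closed_segment_subset convex_convex_hull hull_inc; simp)
    show "v + of_real (- t) * c \<notin> convex hull {p, v, q}"
    proof
      assume "v + of_real (- t) * c \<in> convex hull {p, v, q}"
      then obtain \<alpha> \<beta> \<gamma> where "0 \<le> \<alpha>" "0 \<le> \<gamma>" "\<alpha> + \<beta> + \<gamma> = 1" and e: "v + of_real (- t) * c = \<alpha> *\<^sub>R p + \<beta> *\<^sub>R v + \<gamma> *\<^sub>R q"
        unfolding convex_hull_3 by blast
      moreover from this have "\<beta> = 1 - \<alpha> - \<gamma>" by simp
      ultimately have "of_real (\<alpha> + t) * (p - v) + of_real (\<gamma> + t) * (q - v) = 0"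
        by (simp add: c_def scaleR_conv_of_real algebra_simps)
      then show False using indep[of "\<alpha> + t" "\<gamma> + t"] \<open>0 \<le> \<alpha>\<close> t by auto
    qed
  qed auto
  have key: "v + of_real t * c \<in> inside bd \<longleftrightarrow> sgn D = - s" if t: "0 < t" "t < t0" for t
  proof -
    let ?x = "v + of_real t * c" and ?y = "v + of_real (- t) * c"
    have x: "?x \<in> ball v e - bd" and y: "?y \<in> ball v e - bd" using nb[of t] nb[of "-t"] t by auto
    have W: "wsum ?x + of_real (sgn D) = wsum ?y" using e(3)[OF x y] wx[OF t] wy[OF t] by simp
    have wyc: "wsum ?y = 0 \<or> wsum ?y = of_real s" using s(2,3) y by blast
    show ?thesis
    proof
      assume "?x \<in> inside bd"
      then have "of_real s + of_real (sgn D) = wsum ?y" using W s(2) by simp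
      then have "complex_of_real (s + sgn D) = of_real 0 \<or> complex_of_real (s + sgn D) = of_real s" using wyc by simp
      then have "s + sgn D = 0 \<or> s + sgn D = s" unfolding of_real_eq_iff .
      then show "sgn D = - s" using D by (auto simp: sgn_if split: if_splits)
    next
      assume sD: "sgn D = - s"
      show "?x \<in> inside bd"
      proof (rule ccontr)
        assume "?x \<notin> inside bd"
        then have "of_real (sgn D) = wsum ?y" using W s(3) x by simp
        then have "complex_of_real (sgn D) = of_real 0 \<or> complex_of_real (sgn D) = of_real s" using wyc by simp
        then have "sgn D = 0 \<or> sgn D = s" unfolding of_real_eq_iff .
        then show False using D s(1) sD by (auto simp: sgn_if split: if_splits)
      qed
    qed
  qed
  have "(\<forall>\<^sub>F t in at_right 0. v + of_real t * c \<in> inside bd) \<longleftrightarrow> (\<forall>\<^sub>F t in at_right (0::real). sgn D = - s)"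
  proof (rule eventually_subst)
    show "\<forall>\<^sub>F t in at_right 0. (v + of_real t * c \<in> inside bd) = (sgn D = - s)"
      unfolding eventually_at_right_field using key t0 by (intro exI[of _ t0]) auto
  qed
  then show ?thesis unfolding c_def by simp
qed

text \<open>All sides subtend the same angle at \<open>0\<close>, so each contributes
  \<open>Ln \<omega> / (2 * pi * \<i>)\<close> to the winding number there. For a simple polygon the
  total is \<open>0\<close>, \<open>1\<close> or \<open>-1\<close>; the value \<open>0\<close> would
  give \<open>\<omega> = 1\<close>.\<close>

lemma star_polygon_root:
  assumes Zw: "\<And>i. Z i = K * \<omega> ^ i" and w: "cmod \<omega> = 1" and K: "K \<noteq> 0"
  shows "\<omega> = exp (2 * \<i> * of_real (pi / n)) \<or> \<omega> = cnj (exp (2 * \<i> * of_real (pi / n)))"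
proof -
  have n0: "\<omega> \<noteq> 0" using w by auto
  have w1: "\<omega> \<noteq> 1" using Z_eq_iff[of 0 1] n3 Zw[of 0] Zw[of 1] by auto
  have w2: "\<omega> \<noteq> -1"
  proof
    assume "\<omega> = -1"
    then have "Z 2 = Z 0" using Zw[of 0] Zw[of 2] by simp
    then show False using Z_eq_iff[of 2 0] n3 by simp
  qed
  \<comment> \<open>The segment from \<open>1\<close> to \<open>\<omega>\<close> avoids the
    nonpositive reals, so \<open>Ln (x / Z j)\<close> is a primitive of \<open>1 / x\<close> along a
    side. Only \<open>\<omega> = -1\<close> could spoil this, and it would give
    \<open>Z 2 = Z 0\<close>.\<close>
  have nonpos: "of_real (1 - u) + of_real u * \<omega> \<notin> \<real>\<^sub>\<le>\<^sub>0" if u: "0 \<le> u" "u \<le> 1" for u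
  proof
    assume a: "of_real (1 - u) + of_real u * \<omega> \<in> \<real>\<^sub>\<le>\<^sub>0"
    then have "u * Im \<omega> = 0" and le: "1 - u + u * Re \<omega> \<le> 0" by (auto simp: complex_nonpos_Reals_iff)
    then have "u = 0 \<or> Im \<omega> = 0" by simp
    then show False
    proof
      assume "u = 0" then show False using le by simp
    next
      assume "Im \<omega> = 0"
      then have "(Re \<omega>)\<^sup>2 = 1" using w cmod_power2[of \<omega>] by simp
      then have "Re \<omega> = 1 \<or> Re \<omega> = -1" by (simp add: power2_eq_1_iff)
      then show False using w1 w2 \<open>Im \<omega> = 0\<close> by (auto simp: complex_eq_iff)
    qed
  qed
  have seg: "\<exists>u. 0 \<le> u \<and> u \<le> 1 \<and> x = Z j * (of_real (1 - u) + of_real u * \<omega>)" if "x \<in> closed_segment (Z j) (Z (Suc j))" for x j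
    using that unfolding Zw by (auto simp: in_segment scaleR_conv_of_real algebra_simps)
  have Z0: "Z j \<noteq> 0" for j using K n0 by (simp add: Zw)
  have x0: "0 \<notin> closed_segment (Z j) (Z (Suc j))" for j
  proof
    assume "0 \<in> closed_segment (Z j) (Z (Suc j))"
    then obtain u where u: "0 \<le> u" "u \<le> 1" "0 = Z j * (of_real (1 - u) + of_real u * \<omega>)" using seg by blast
    then have "of_real (1 - u) + of_real u * \<omega> = 0" using Z0[of j] by (metis mult_eq_0_iff)
    then show False using nonpos[OF u(1,2)] by simp
  qed
  have wn: "winding_number (linepath (Z j) (Z (Suc j))) 0 = Ln \<omega> / (2 * of_real pi * \<i>)" for j
  proof -
    let ?S = "closed_segment (Z j) (Z (Suc j))"
    have "((\<lambda>x. 1 / x) has_contour_integral (Ln (pathfinish (linepath (Z j) (Z (Suc j))) / Z j) - Ln (pathstart (linepath (Z j) (Z (Suc j))) / Z j))) (linepath (Z j) (Z (Suc j)))"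
    proof (rule contour_integral_primitive[where S = ?S])
      fix x assume x: "x \<in> ?S"
      then obtain u where u: "0 \<le> u" "u \<le> 1" "x = Z j * (of_real (1 - u) + of_real u * \<omega>)" using seg by blast
      then have "x / Z j \<notin> \<real>\<^sub>\<le>\<^sub>0" using nonpos[OF u(1,2)] Z0 by simp
      then show "((\<lambda>x. Ln (x / Z j)) has_field_derivative 1 / x) (at x within ?S)"
        using Z0[of j] by (auto intro!: derivative_eq_intros)
    qed auto
    then have "((\<lambda>x. 1 / x) has_contour_integral Ln \<omega>) (linepath (Z j) (Z (Suc j)))"
      using Z0[of j] by (simp add: Zw) (use K n0 in simp)
    then have "contour_integral (linepath (Z j) (Z (Suc j))) (\<lambda>x. 1 / x) = Ln \<omega>" by (rule contour_integral_unique)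
    then show ?thesis using winding_number_valid_path[of "linepath (Z j) (Z (Suc j))" 0] x0[of j] by simp
  qed
  have ws: "wsum 0 = of_nat n * (Ln \<omega> / (2 * of_real pi * \<i>))" unfolding wsum_def wn by simp
  have "0 \<notin> bd" using x0 by (auto simp: bd_def)
  obtain s where s: "s \<in> {1, -1 :: real}" "\<And>x. x \<in> inside bd \<Longrightarrow> wsum x = of_real s"
    "\<And>x. x \<notin> bd \<Longrightarrow> x \<notin> inside bd \<Longrightarrow> wsum x = 0" using wsum_cases by blast
  have "wsum 0 = 0 \<or> wsum 0 = 1 \<or> wsum 0 = -1"
    using s \<open>0 \<notin> bd\<close> by (cases "0 \<in> inside bd") auto
  moreover have "\<omega> = exp (2 * \<i> * of_real (pi / n) * wsum 0)"
  proof -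
    have "2 * \<i> * of_real (pi / n) * wsum 0 = Ln \<omega>" unfolding ws using n3 by simp
    then show ?thesis using n0 by simp
  qed
  ultimately show ?thesis using w1 by (auto simp: exp_cnj)
qed

end

text \<open>The number \<open>c j = cnj (a j) * b j\<close> encodes the oriented angle at vertex
  \<open>j\<close>. Its modulus is \<open>\<rho>^2\<close> since the sides are equal, its real part
  comes from the cosine of the interior angle, and the sign of its imaginary part from whether that
  angle is reflex. Hence all \<open>c j\<close> agree and the orbit argument applies.\<close>

theorem regular_imp_extremal:
  assumes Q: "regular_ngon n Q"
  shows "\<bar>cyc_sum n parea (pvert Q)\<bar> = isoarea n (cyc_sum n pdist (pvert Q))"
proof -
  have P: "hyp_ngon n Q" and sides: "\<And>i j. i < n \<Longrightarrow> j < n \<Longrightarrow> side_length Q i = side_length Q j"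
    and angs: "\<And>i j. i < n \<Longrightarrow> j < n \<Longrightarrow> interior_angle Q i = interior_angle Q j" using Q unfolding regular_ngon_def by blast+
  interpret simple_polygon n "kvert Q" by (rule ngon_simple_polygon[OF P])
  have n: "length Q = n" and hp: "\<And>i. i < n \<Longrightarrow> Q ! i \<in> hyp_plane" using P by (auto simp: hyp_ngon_def subset_iff)
  let ?z = "pvert Q"
  have z: "cmod (?z i) < 1" if "i < n" for i using pvert_bound[OF P that] .
  have s: "Suc i mod n < n" for i using n3 by simp
  have sd: "side_length Q i = pdist (?z i) (?z (Suc i mod n))" if "i < n" for i
    using hp[OF that] hp[OF s] by (simp add: side_length_def n hyp_dist_pdist pvert_def)
  define \<rho> where "\<rho> = pdelta (?z 0) (?z (Suc 0 mod n))"
  have pd: "pdelta (?z i) (?z (Suc i mod n)) = \<rho>" if i: "i < n" for i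
    using sides[OF i, of 0] sd[OF i] sd[of 0] n3 tanh_pdist[OF z[OF i] z[OF s]] tanh_pdist[OF z[of 0] z[OF s]]
    unfolding \<rho>_def by (metis less_le_trans zero_less_numeral)
  have \<rho>: "\<rho> > 0"
  proof -
    have "?z 0 \<noteq> ?z (Suc 0 mod n)" using n3 by (intro pvert_neq[OF P]) auto
    then have "\<rho> \<noteq> 0" unfolding \<rho>_def using pdelta_eq_0[of "?z 0" "?z (Suc 0 mod n)"] z n3 by simp
    then show ?thesis using pdelta_nonneg[of "?z 0" "?z (Suc 0 mod n)"] unfolding \<rho>_def by linarith
  qed
  define a where "a j = pinv (?z j) (?z ((j + n - 1) mod n))" for j
  define b where "b j = pinv (?z j) (?z (Suc j mod n))" for j
  have pn: "cmod (pinv x y) = pdelta x y" for x y by (simp add: pinv_def pdelta_def norm_divide)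
  have nb: "cmod (b j) = \<rho>" if "j < n" for j unfolding b_def pn by (rule pd[OF that])
  have na: "cmod (a j) = \<rho>" if "j < n" for j
    unfolding a_def pn using pd[of "(j + n - 1) mod n"] cyc_pred[OF n3 that] by (simp add: pdelta_commute)
  define c where "c j = cnj (a j) * b j" for j
  have nc: "(Re (c j))\<^sup>2 + (Im (c j))\<^sup>2 = (\<rho>\<^sup>2)\<^sup>2" if "j < n" for j
  proof -
    have "cmod (c j) = \<rho>\<^sup>2" unfolding c_def norm_mult complex_mod_cnj na[OF that] nb[OF that] by (simp add: power2_eq_square)
    then show ?thesis by (metis cmod_power2)
  qed
  let ?p = "\<lambda>j. Q ! ((j + n - 1) mod n)" and ?s = "\<lambda>j. Q ! (Suc j mod n)"
  define \<theta> where "\<theta> j = hyp_angle (Q ! j) (?p j - Q ! j) (?s j - Q ! j)" for j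
  define C where "C j \<longleftrightarrow> (\<forall>\<^sub>F t in at_right 0. Q ! j + t *\<^sub>R ((?p j - Q ! j) + (?s j - Q ! j)) \<in> inside (poly_boundary Q))" for j
  have ia: "interior_angle Q j = (if C j then \<theta> j else 2 * pi - \<theta> j)" for j
    unfolding interior_angle_def Let_def n C_def \<theta>_def ..
  have ratio: "\<bar>Re (c j) / \<rho>\<^sup>2\<bar> \<le> 1" if j: "j < n" for j
  proof -
    have "(Re (c j))\<^sup>2 \<le> (\<rho>\<^sup>2)\<^sup>2" using nc[OF j] by (smt (verit) zero_le_power2)
    then have "\<bar>Re (c j)\<bar> \<le> \<bar>\<rho>\<^sup>2\<bar>" by (simp only: abs_le_square_iff)
    then show ?thesis using \<rho> by (simp add: abs_divide)
  qed
  have th: "\<theta> j = arccos (Re (c j) / \<rho>\<^sup>2)" if j: "j < n" for j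
    unfolding \<theta>_def hyp_angle_pinv[OF hp[OF j] hp[OF cyc_pred(3)[OF n3 j]] hp[OF s]]
    using na[OF j] nb[OF j] by (simp add: c_def a_def b_def pvert_def power2_eq_square)
  have ct: "cos (interior_angle Q j) = Re (c j) / \<rho>\<^sup>2" if j: "j < n" for j
  proof -
    have "cos (\<theta> j) = Re (c j) / \<rho>\<^sup>2" unfolding th[OF j] using ratio[OF j] by (intro cos_arccos_abs)
    then show ?thesis unfolding ia by (simp add: cos_diff)
  qed
  have Re: "Re (c j) = Re (c 0)" if j: "j < n" for j
    using ct[OF j] ct[of 0] angs[OF j, of 0] n3 \<rho> by simp
  have Im2: "(Im (c j))\<^sup>2 = (Im (c 0))\<^sup>2" if j: "j < n" for j
    using nc[OF j] nc[of 0] Re[OF j] n3 by simp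
  have "c j = c 0" if j: "j < n" for j
  \<comment> \<open>If the imaginary part vanishes, the two sides at each vertex are collinear and
    there is no sign to determine.\<close>
  proof (cases "Im (c 0) = 0")
    case True then show ?thesis using Im2[OF j] Re[OF j] by (simp add: complex_eq_iff)
  next
    case False
    obtain \<sigma> where \<sigma>: "\<sigma> \<in> {1, -1 :: real}" "\<And>x. x \<in> inside bd \<Longrightarrow> wsum x = of_real \<sigma>"
      "\<And>x. x \<notin> bd \<Longrightarrow> x \<notin> inside bd \<Longrightarrow> wsum x = 0" using wsum_cases by blast
    have key: "interior_angle Q i < pi \<longleftrightarrow> sgn (Im (c i)) = - \<sigma>" if i: "i < n" for i
    proof -
      have Im0: "Im (c i) \<noteq> 0" using Im2[OF i] False by auto
      have "(Re (c i))\<^sup>2 < (\<rho>\<^sup>2)\<^sup>2" using nc[OF i] Im0 by (smt (verit) zero_less_power2)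
      then have "\<not> \<bar>\<rho>\<^sup>2\<bar> \<le> \<bar>Re (c i)\<bar>" by (simp only: abs_le_square_iff not_le)
      then have "\<bar>Re (c i)\<bar> < \<rho>\<^sup>2" by simp
      then have r: "-1 < Re (c i) / \<rho>\<^sup>2" "Re (c i) / \<rho>\<^sup>2 < 1" using \<rho> by (auto simp: field_simps abs_less_iff)
      have t: "0 < \<theta> i" "\<theta> i < pi" unfolding th[OF i] using arccos_lt_bounded[OF r] by auto
      let ?i = "(i + n - 1) mod n"
      have k: "kvert Q ?i = vc (?p i)" "kvert Q (Suc ?i) = vc (Q ! i)" "kvert Q (Suc (Suc ?i)) = vc (?s i)"
      proof -
        show "kvert Q ?i = vc (?p i)" by (simp add: kvert_def n)
        show "kvert Q (Suc ?i) = vc (Q ! i)" unfolding kvert_def n cyc_pred(1)[OF n3 i] ..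
        have "Suc (Suc ?i) mod n = Suc (Suc ?i mod n) mod n" by (rule mod_Suc_eq[symmetric])
        then show "kvert Q (Suc (Suc ?i)) = vc (?s i)" unfolding kvert_def n cyc_pred(1)[OF n3 i] by simp
      qed
      define D where "D = Im (cnj (vc (?p i) - vc (Q ! i)) * (vc (?s i) - vc (Q ! i)))"
      have sD: "sgn (Im (c i)) = sgn D"
        unfolding c_def a_def b_def D_def pvert_def
        by (rule pinv_orientation) (use hp[OF i] hp[OF s] hp[OF cyc_pred(3)[OF n3 i]] in \<open>auto simp: hyp_plane_vc\<close>)
      then have D0: "D \<noteq> 0" using Im0 by (metis sgn_zero_iff)
      have "C i \<longleftrightarrow> (\<forall>\<^sub>F t in at_right 0. vc (Q ! i) + of_real t * ((vc (?p i) - vc (Q ! i)) + (vc (?s i) - vc (Q ! i))) \<in> inside bd)"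
      proof -
        have "vc (Q ! i) + of_real t * ((vc (?p i) - vc (Q ! i)) + (vc (?s i) - vc (Q ! i))) \<in> inside bd
          \<longleftrightarrow> Q ! i + t *\<^sub>R ((?p i - Q ! i) + (?s i - Q ! i)) \<in> inside (poly_boundary Q)" for t
        proof -
          have "vc (Q ! i) + of_real t * ((vc (?p i) - vc (Q ! i)) + (vc (?s i) - vc (Q ! i))) = vc (Q ! i + t *\<^sub>R ((?p i - Q ! i) + (?s i - Q ! i)))"
            by (simp only: vc_simps)
          moreover have "vc x \<in> inside bd \<longleftrightarrow> x \<in> inside (poly_boundary Q)" for x
            unfolding ngon_bd[OF P] by (auto simp: image_iff)
          ultimately show ?thesis by (simp only:)
        qed
        then show ?thesis unfolding C_def by simp
      qed
      also have "\<dots> \<longleftrightarrow> sgn D = - \<sigma>"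
        using inside_near_vertex[of ?i \<sigma>] D0 \<sigma> unfolding k D_def by blast
      finally have "C i \<longleftrightarrow> sgn (Im (c i)) = - \<sigma>" unfolding sD .
      moreover have "interior_angle Q i < pi \<longleftrightarrow> C i" unfolding ia using t by auto
      ultimately show ?thesis by simp
    qed
    have "sgn (Im (c j)) = - \<sigma> \<longleftrightarrow> sgn (Im (c 0)) = - \<sigma>" using key[OF j] key[of 0] angs[OF j, of 0] n3 by simp
    moreover have "Im (c j) = Im (c 0) \<or> Im (c j) = - Im (c 0)" using Im2[OF j] by (simp add: power2_eq_iff)
    ultimately have "Im (c j) = Im (c 0)" using \<sigma>(1) False by (auto simp: sgn_if split: if_splits)
    then show ?thesis using Re[OF j] by (simp add: complex_eq_iff)
  qed
  then have bk: "b j = (c 0 / of_real (\<rho>\<^sup>2)) * a j" if j: "j < n" for j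
  proof -
    have "a j * cnj (a j) = of_real (\<rho>\<^sup>2)" using complex_norm_square[of "a j"] na[OF j] by simp
    then have "c j * a j = of_real (\<rho>\<^sup>2) * b j" by (simp add: c_def mult_ac)
    then show ?thesis using \<open>\<And>j. j < n \<Longrightarrow> c j = c 0\<close>[OF j] \<rho> by (simp add: field_simps)
  qed
  obtain w r \<omega> where W: "cmod w < 1" "\<And>i. i < n \<Longrightarrow> pinv w (?z i) = r * \<omega> ^ i" "cmod \<omega> = 1" "\<omega> ^ n = 1"
    "0 < cmod r" "cmod r < 1" "\<omega> \<noteq> 1"
    using equiangular_polygon_rotation[where n = n and z = ?z and \<rho> = \<rho> and \<kappa> = "c 0 / of_real (\<rho>\<^sup>2)",
        OF n3 z \<rho> nb[unfolded b_def] bk[unfolded a_def b_def]] by blast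
  define R where "R = map (hturn w) Q"
  have R: "hyp_ngon n R" unfolding R_def by (rule isometry_ngon(1)[OF hturn_isometry[OF W(1)] P])
  have kR: "kvert R i = pkl r * \<omega> ^ i" for i
  proof -
    have im: "i mod n < n" using n3 by simp
    have "kvert R i = vc (hturn w (Q ! (i mod n)))" using im by (simp add: kvert_def R_def n)
    also have "\<dots> = pkl (klp (vc (hturn w (Q ! (i mod n)))))"
      using hturn_in[OF W(1) hp[OF im]] by (simp add: pkl_klp hyp_plane_vc)
    also have "\<dots> = pkl (\<omega> ^ (i mod n) * r)"
      unfolding klp_hturn[OF W(1) hp[OF im]] using W(2)[OF im] by (simp add: pvert_def mult.commute)
    also have "\<dots> = \<omega> ^ (i mod n) * pkl r" by (rule pkl_rot) (simp add: norm_power W(3))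
    also have "\<omega> ^ (i mod n) = \<omega> ^ i"
    proof -
      have "\<omega> ^ i = \<omega> ^ (n * (i div n) + i mod n)" by simp
      also have "\<dots> = \<omega> ^ (i mod n)" unfolding power_add power_mult W(4) by simp
      finally show ?thesis by simp
    qed
    finally show ?thesis by (simp add: mult.commute)
  qed
  have "pkl r \<noteq> 0" using klp_pkl[OF W(6)] W(5) by (auto simp: klp_def)
  then have root: "\<omega> = exp (2 * \<i> * of_real (pi / n)) \<or> \<omega> = cnj (exp (2 * \<i> * of_real (pi / n)))"
    using simple_polygon.star_polygon_root[OF ngon_simple_polygon[OF R] kR W(3)] by blast
  define v where "v i = pinv w (?z i)" for i
  have e: "cyc_sum n parea v = cyc_sum n parea ?z" "cyc_sum n pdist v = cyc_sum n pdist ?z"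
    unfolding v_def using cyc_sum_parea_pinv[of n w ?z] cyc_sum_pdist_pinv[of w n ?z] W(1) z n3 by auto
  have v: "v i = r * \<omega> ^ i" if "i < n" for i unfolding v_def by (rule W(2)[OF that])
  from root show ?thesis
  proof
    assume "\<omega> = exp (2 * \<i> * of_real (pi / n))"
    then have "cyc_sum n parea v = isoarea n (cyc_sum n pdist v)"
      using rotation_polygon_bound(2)[OF n3 v W(3-7)] by blast
    then show ?thesis unfolding e using isoarea_nonneg[OF n3] by simp
  next
    \<comment> \<open>The vertices run clockwise; the conjugate polygon has the root required by
      \<open>rotation_polygon_bound\<close>.\<close>
    assume o: "\<omega> = cnj (exp (2 * \<i> * of_real (pi / n)))"
    have v': "cnj (v i) = cnj r * cnj \<omega> ^ i" if "i < n" for i using v[OF that] by simp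
    have vd: "cmod (v i) < 1" if "i < n" for i unfolding v_def using pinv_bound[OF W(1) z[OF that]] .
    have "cnj \<omega> ^ n = 1" by (metis W(4) complex_cnj_one complex_cnj_power)
    moreover have "cnj \<omega> \<noteq> 1" using W(7) by (metis complex_cnj_cnj complex_cnj_one)
    ultimately have "cyc_sum n parea (\<lambda>i. cnj (v i)) = isoarea n (cyc_sum n pdist (\<lambda>i. cnj (v i)))"
      using rotation_polygon_bound(2)[OF n3 v'] W(3,5,6) o by simp
    then have "- cyc_sum n parea v = isoarea n (cyc_sum n pdist v)"
      using cyc_sum_cnj[of n v] vd n3 by simp
    then show ?thesis unfolding e using isoarea_nonneg[OF n3, of "cyc_sum n pdist ?z"] by simp
  qed
qed

section \<open>Recovering a polygon from its region\<close>

lemma region_eq_imp_boundary_eq: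
  assumes P: "hyp_ngon n P" and R: "hyp_ngon m R" and eq: "poly_region P = poly_region R"
  shows "poly_boundary P = poly_boundary R"
proof -
  have f: "frontier (vc ` poly_region X) = vc ` poly_boundary X" if X: "hyp_ngon k X" for k X
  proof -
    interpret simple_polygon k "kvert X" by (rule ngon_simple_polygon[OF X])
    have "vc ` poly_region X = bd \<union> inside bd"
      unfolding poly_region_def image_Un ngon_bd[OF X] ..
    also have "\<dots> = - outside bd"
      using inside_Un_outside[of bd] inside_Int_outside[of bd] outside_no_overlap[of bd] by blast
    finally show ?thesis using Jordan_bd(2) by (simp add: ngon_bd(1)[OF X])
  qed
  have "vc ` poly_boundary P = vc ` poly_boundary R" using f[OF P] f[OF R] eq by simp
  then show ?thesis by (simp add: inj_image_eq_iff inj_def)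
qed

lemma norm_convex_combination:
  fixes x y :: "'a::real_inner"
  shows "(norm ((1 - t) *\<^sub>R x + t *\<^sub>R y))\<^sup>2 = (1 - t) * (norm x)\<^sup>2 + t * (norm y)\<^sup>2 - t * (1 - t) * (norm (x - y))\<^sup>2"
  unfolding power2_norm_eq_inner by (simp add: inner_add_left inner_add_right inner_diff_left inner_diff_right inner_commute[of y x] algebra_simps)

text \<open>Two common points force the chords onto one line, and on the line through
  \<open>c\<close> and \<open>d\<close> the norm takes the value \<open>k\<close> only at
  \<open>c\<close> and \<open>d\<close>.\<close>

lemma chord_determined:
  fixes a b c d :: "'a::real_inner"
  assumes nrm: "norm a = k" "norm b = k" "norm c = k" "norm d = k" and ne: "a \<noteq> b" "c \<noteq> d"
    and m: "m1 \<in> closed_segment a b \<inter> closed_segment c d" "m2 \<in> closed_segment a b \<inter> closed_segment c d" "m1 \<noteq> m2"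
  shows "{a, b} = {c, d}"
proof -
  define e where "e = d - c"
  have e0: "e \<noteq> 0" using ne by (simp add: e_def)
  obtain s1 where s1: "m1 = a + s1 *\<^sub>R (b - a)" using m(1) by (auto simp: in_segment algebra_simps)
  obtain s2 where s2: "m2 = a + s2 *\<^sub>R (b - a)" using m(2) by (auto simp: in_segment algebra_simps)
  obtain t1 where t1: "m1 = c + t1 *\<^sub>R e" using m(1) unfolding e_def by (auto simp: in_segment algebra_simps)
  obtain t2 where t2: "m2 = c + t2 *\<^sub>R e" using m(2) unfolding e_def by (auto simp: in_segment algebra_simps)
  have s12: "s2 - s1 \<noteq> 0" using m(3) s1 s2 by auto
  define l where "l = (t2 - t1) / (s2 - s1)"
  have "(s2 - s1) *\<^sub>R (b - a) = m2 - m1" unfolding s1 s2 by (simp add: scaleR_left_diff_distrib)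
  also have "\<dots> = (t2 - t1) *\<^sub>R e" unfolding t1 t2 by (simp add: scaleR_left_diff_distrib)
  finally have "(1 / (s2 - s1)) *\<^sub>R ((s2 - s1) *\<^sub>R (b - a)) = (1 / (s2 - s1)) *\<^sub>R ((t2 - t1) *\<^sub>R e)" by (rule arg_cong)
  then have ba: "b - a = l *\<^sub>R e" using s12 by (simp add: l_def)
  define u where "u = t1 - s1 * l"
  have a: "a = c + u *\<^sub>R e" using s1 t1 unfolding ba by (simp add: u_def algebra_simps)
  have b: "b = c + (u + l) *\<^sub>R e" using ba a by (simp add: algebra_simps)
  have q: "t = 0 \<or> t = 1" if t: "norm (c + t *\<^sub>R e) = k" for t
  proof -
    have e1: "c + t *\<^sub>R e = (1 - t) *\<^sub>R c + t *\<^sub>R d" by (simp add: e_def algebra_simps)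
    have "(norm (c + t *\<^sub>R e))\<^sup>2 = k\<^sup>2 - t * (1 - t) * (norm (c - d))\<^sup>2"
      unfolding e1 norm_convex_combination nrm by (simp add: algebra_simps)
    then have "t * (1 - t) * (norm (c - d))\<^sup>2 = 0" using t by simp
    then show ?thesis using ne by auto
  qed
  have "u = 0 \<or> u = 1" "u + l = 0 \<or> u + l = 1" using q[of u] q[of "u + l"] nrm a b by auto
  moreover have "u \<noteq> u + l" using ne a b by auto
  moreover have "c + 0 *\<^sub>R e = c" "c + 1 *\<^sub>R e = d" by (simp_all add: e_def)
  ultimately show ?thesis using a b by auto
qed

text \<open>An isometry matches regions, not vertex lists, and straight angles could hide extra
  vertices. The vertices of the standard polygon have the largest norm on the boundary, so by strict
  convexity of the disc none lies in the interior of a side of \<open>P\<close>: they are vertices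
  of \<open>P\<close>. Both lists have \<open>n\<close> entries, so the vertex sets agree. Each side
  of \<open>P\<close> then shares infinitely many points with some standard side and coincides with
  it.\<close>

lemma ngon_same_region_std:
  assumes P: "hyp_ngon n P" and R: "hyp_ngon n (std_ngon n r)" and r: "0 < r" "r < 1"
    and eq: "poly_region P = poly_region (std_ngon n r)"
  shows "hyp_peri P = hyp_peri (std_ngon n r)"
proof -
  let ?R = "std_ngon n r"
  have n: "n \<ge> 3" "length P = n" "distinct P" "length ?R = n" "distinct ?R" using P R by (auto simp: hyp_ngon_def)
  have s: "Suc i mod n < n" for i using n by simp
  have bd: "poly_boundary P = poly_boundary ?R" by (rule region_eq_imp_boundary_eq[OF P R eq])
  define k where "k = cmod (pkl (of_real r))"
  have Rn: "norm (?R ! j) = k" if "j < n" for j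
  proof -
    have "pkl (regular_root n ^ j * of_real r) = regular_root n ^ j * pkl (of_real r)"
      by (rule pkl_rot) (simp add: norm_power)
    then have "cmod (vc (?R ! j)) = k" using that by (simp add: std_ngon_nth k_def norm_mult norm_power mult.commute)
    then show ?thesis by simp
  qed
  have ball: "x \<in> cball 0 k" if "x \<in> poly_boundary ?R" for x
  proof -
    obtain j where "j < n" "x \<in> closed_segment (?R ! j) (?R ! (Suc j mod n))"
      using \<open>x \<in> poly_boundary ?R\<close> by (auto simp: poly_boundary_def poly_side_def n)
    moreover have "closed_segment (?R ! j) (?R ! (Suc j mod n)) \<subseteq> cball 0 k" if "j < n" for j
      using Rn[OF that] Rn[OF s] by (intro closed_segment_subset) auto
    ultimately show ?thesis by blast
  qed
  have vP: "P ! i \<in> poly_boundary P" if "i < n" for i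
    using that by (auto simp: poly_boundary_def poly_side_def n intro!: bexI[of _ i])
  have Ple: "norm (P ! i) \<le> k" if "i < n" for i using ball[of "P ! i"] vP[OF that] bd by simp
  have "set ?R \<subseteq> set P"
  proof
    fix u assume "u \<in> set ?R"
    then obtain j where j: "j < n" "u = ?R ! j" using n by (metis in_set_conv_nth)
    have "u \<in> poly_boundary ?R" unfolding j(2) using j(1)
      by (auto simp: poly_boundary_def poly_side_def n intro!: bexI[of _ j])
    then obtain i where i: "i < n" "u \<in> closed_segment (P ! i) (P ! (Suc i mod n))"
      unfolding bd[symmetric] by (auto simp: poly_boundary_def poly_side_def n)
    then obtain t where t: "0 \<le> t" "t \<le> 1" "u = (1 - t) *\<^sub>R (P ! i) + t *\<^sub>R (P ! (Suc i mod n))" by (auto simp: in_segment)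
    have neq: "P ! i \<noteq> P ! (Suc i mod n)" using n i(1) cyc_pred(4)[OF n(1) i(1)] s by (metis nth_eq_iff_index_eq)
    have k0: "k \<ge> 0" by (simp add: k_def)
    have "k\<^sup>2 = (1 - t) * (norm (P ! i))\<^sup>2 + t * (norm (P ! (Suc i mod n)))\<^sup>2 - t * (1 - t) * (norm (P ! i - P ! (Suc i mod n)))\<^sup>2"
      using norm_convex_combination[of t "P ! i"] t(3) Rn[OF j(1)] j(2) by metis
    also have "\<dots> \<le> (1 - t) * k\<^sup>2 + t * k\<^sup>2 - t * (1 - t) * (norm (P ! i - P ! (Suc i mod n)))\<^sup>2"
      using t Ple[OF i(1)] Ple[OF s] by (intro diff_right_mono add_mono mult_left_mono power_mono) auto
    finally have "t * (1 - t) * (norm (P ! i - P ! (Suc i mod n)))\<^sup>2 \<le> 0" by (simp add: algebra_simps)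
    moreover have "(norm (P ! i - P ! (Suc i mod n)))\<^sup>2 > 0" using neq by simp
    ultimately have "t * (1 - t) \<le> 0" by (simp add: mult_le_0_iff)
    then have "t = 0 \<or> t = 1" using t by (smt (verit) mult_pos_pos)
    moreover have "P ! i \<in> set P" "P ! (Suc i mod n) \<in> set P" using i(1) s n(2) by (auto intro!: nth_mem)
    ultimately show "u \<in> set P" using t(3) by auto
  qed
  moreover have "card (set ?R) = n" "card (set P) = n" using n distinct_card[of P] distinct_card[of ?R] by auto
  ultimately have set: "set ?R = set P" by (metis List.finite_set card_subset_eq)
  have side: "side_length P i = side_length ?R 0" if i: "i < n" for i
  proof -
    let ?x = "P ! i" and ?y = "P ! (Suc i mod n)"
    have neq: "?x \<noteq> ?y" using n i cyc_pred(4)[OF n(1) i] s by (metis nth_eq_iff_index_eq)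
    have "?x \<in> set ?R" "?y \<in> set ?R" unfolding set using i s n by auto
    moreover have "norm x = k" if "x \<in> set ?R" for x using that Rn unfolding in_set_conv_nth n(4) by blast
    ultimately have nx: "norm ?x = k" "norm ?y = k" by blast+
    have xy: "closed_segment ?x ?y = poly_side P i" by (simp add: poly_side_def n)
    have "poly_side P i \<subseteq> poly_boundary P" unfolding poly_boundary_def using i n(2) by blast
    then have sub: "closed_segment ?x ?y \<subseteq> (\<Union>j<n. closed_segment (?R ! j) (?R ! (Suc j mod n)))"
      unfolding xy bd by (simp add: poly_boundary_def poly_side_def n)
    have "\<exists>j<n. infinite (closed_segment ?x ?y \<inter> closed_segment (?R ! j) (?R ! (Suc j mod n)))"
    proof (rule ccontr)
      assume "\<not> ?thesis"
      then have "finite (\<Union>j<n. closed_segment ?x ?y \<inter> closed_segment (?R ! j) (?R ! (Suc j mod n)))"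
        by (intro finite_UN_I) auto
      then have "finite (closed_segment ?x ?y)" by (rule finite_subset[rotated]) (use sub in blast)
      then show False using neq by simp
    qed
    then obtain j where j: "j < n" "infinite (closed_segment ?x ?y \<inter> closed_segment (?R ! j) (?R ! (Suc j mod n)))"
      by blast
    let ?I = "closed_segment ?x ?y \<inter> closed_segment (?R ! j) (?R ! (Suc j mod n))"
    obtain m1 where m1: "m1 \<in> ?I" using j(2) by (metis ex_in_conv finite.emptyI)
    obtain m2 where m2: "m2 \<in> ?I" "m1 \<noteq> m2"
    proof -
      have "\<not> ?I \<subseteq> {m1}" using j(2) finite_subset by blast
      then show ?thesis using that by blast
    qed
    have neqR: "?R ! j \<noteq> ?R ! (Suc j mod n)" using n j cyc_pred(4)[OF n(1) j(1)] s by (metis nth_eq_iff_index_eq)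
    have "{?x, ?y} = {?R ! j, ?R ! (Suc j mod n)}"
      by (rule chord_determined[OF nx Rn[OF j(1)] Rn[OF s] neq neqR m1 m2])
    then have "hyp_dist ?x ?y = hyp_dist (?R ! j) (?R ! (Suc j mod n))"
      by (auto simp: doubleton_eq_iff hyp_dist_def inner_commute mult.commute)
    then have "side_length P i = side_length ?R j" by (simp add: side_length_def n)
    also have "\<dots> = side_length ?R 0" using std_ngon_side(1)[OF n(1) r R] j(1) n(1) by simp
    finally show ?thesis .
  qed
  have "side_length ?R i = side_length ?R 0" if "i < n" for i
    using std_ngon_side(1)[OF n(1) r R] that n(1) by simp
  then have "(\<Sum>i<n. side_length P i) = (\<Sum>i<n. side_length ?R i)"
    using side by (intro sum.cong refl) (metis lessThan_iff)
  then show ?thesis by (simp only: hyp_peri_def n)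
qed

section \<open>Convexity of the perimeter\<close>

text \<open>Half the interior angle of the regular n-gon of area \<open>A\<close>, and its perimeter.\<close>

definition half_angle :: "nat \<Rightarrow> real \<Rightarrow> real" where "half_angle n A = ((real n - 2) * pi - A) / (2 * real n)"

definition regular_peri :: "nat \<Rightarrow> real \<Rightarrow> real" where
  "regular_peri n A = 2 * real n * arcosh (cos (pi / real n) / sin (half_angle n A))"

lemma half_angle_alt: "n > 0 \<Longrightarrow> half_angle n A = pi / 2 - (A / (2 * real n) + pi / real n)"
  by (simp add: half_angle_def field_simps)

text \<open>\<open>isoarea\<close> is solved for the perimeter. With
  \<open>t = A / (2 * n) + pi / n\<close>, the complement of the half angle, the bound reads
  \<open>t \<le> arccos (cos (pi / n) / cosh (L / (2 * n)))\<close>, and \<open>cos\<close> and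
  \<open>arcosh\<close> invert it. The right side is below \<open>pi / 2\<close>, which makes the
  half angle positive.\<close>

lemma isoperimetric_iff:
  assumes n: "n \<ge> 3" and A: "A \<ge> 0" and L: "L \<ge> 0" and le: "A \<le> isoarea n L"
  shows "0 < half_angle n A" "regular_peri n A \<le> L" "L = regular_peri n A \<longleftrightarrow> A = isoarea n L"
proof -
  let ?c = "cosh (L / (2 * real n))" and ?t = "A / (2 * real n) + pi / real n"
  have np: "2 * real n > 0" using n by simp
  have pn: "0 < pi / real n" "pi / real n < pi / 2" using cos_pi_n[OF n] by auto
  have r: "0 < cos (pi / real n) / ?c" "cos (pi / real n) / ?c < 1" using cos_cosh_ratio[OF n] by auto
  have acl: "arccos (cos (pi / real n) / ?c) < pi / 2"
    using arccos_less_arccos[of 0 "cos (pi / real n) / ?c"] r by (simp add: arccos_0)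
  have "A / (2 * real n) \<le> arccos (cos (pi / real n) / ?c) - pi / real n"
    using le unfolding isoarea_def pos_divide_le_eq[OF np] by (simp add: mult.commute)
  then have t3: "?t \<le> arccos (cos (pi / real n) / ?c)" by linarith
  have "A = isoarea n L \<longleftrightarrow> A / (2 * real n) = arccos (cos (pi / real n) / ?c) - pi / real n"
    unfolding isoarea_def using np by (subst nonzero_divide_eq_eq) (auto simp: mult.commute)
  then have iso: "A = isoarea n L \<longleftrightarrow> ?t = arccos (cos (pi / real n) / ?c)" by linarith
  have "0 \<le> A / (2 * real n)" using A np by simp
  then have t: "0 < ?t" "?t < pi / 2" "?t \<le> arccos (cos (pi / real n) / ?c)"
    using t3 pn acl by linarith+
  have ha: "half_angle n A = pi / 2 - ?t" using n by (simp add: half_angle_alt)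
  show h0: "0 < half_angle n A" using t(2) ha by simp
  have sh: "sin (half_angle n A) = cos ?t" unfolding ha by (simp add: cos_sin_eq)
  have cp: "cos ?t > 0" using t by (intro cos_gt_zero_pi) auto
  have ca: "cos (arccos (cos (pi / real n) / ?c)) = cos (pi / real n) / ?c" using r by (intro cos_arccos) auto
  have act: "arccos (cos ?t) = ?t" by (rule arccos_cos) (use t pi_gt_zero in linarith)+
  have ap: "arccos (cos (pi / real n) / ?c) \<le> pi" using acl pi_gt_zero by linarith
  have c1: "cos (pi / real n) / ?c \<le> cos ?t"
    using cos_monotone_0_pi_le[of ?t "arccos (cos (pi / real n) / ?c)"] t ap ca by simp
  have c0: "?c > 0" by simp
  have c2: "cos (pi / real n) / cos ?t \<le> ?c" using c1 cp c0 by (simp add: field_simps)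
  have "cos ?t \<le> cos (pi / real n)" using cos_monotone_0_pi_le[of "pi / real n" ?t] pn t A np by simp
  then have g1: "1 \<le> cos (pi / real n) / cos ?t" using cp by simp
  have aL: "arcosh ?c = L / (2 * real n)" using L np by (intro arcosh_cosh_real) simp
  have "arcosh (cos (pi / real n) / cos ?t) \<le> arcosh ?c"
    using c2 g1 arcosh_less_iff_real[of ?c "cos (pi / real n) / cos ?t"] cosh_real_ge_1[of "L / (2 * real n)"] by (simp add: not_less[symmetric])
  then show "regular_peri n A \<le> L" unfolding regular_peri_def sh aL using np by (simp add: field_simps)
  have "L = regular_peri n A \<longleftrightarrow> arcosh ?c = arcosh (cos (pi / real n) / cos ?t)"
    unfolding regular_peri_def sh aL using np by (auto simp: field_simps)
  also have "\<dots> \<longleftrightarrow> ?c = cos (pi / real n) / cos ?t"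
    using g1 cosh_real_ge_1[of "L / (2 * real n)"] by (metis cosh_arcosh_real)
  also have "\<dots> \<longleftrightarrow> cos (pi / real n) / ?c = cos ?t" using cp c0 by (auto simp: field_simps)
  also have "\<dots> \<longleftrightarrow> ?t = arccos (cos (pi / real n) / ?c)"
    using act ca by metis
  finally show "L = regular_peri n A \<longleftrightarrow> A = isoarea n L" unfolding iso .
qed

text \<open>The mean value theorem on either side of \<open>x\<close>: a strictly increasing
  derivative puts the graph strictly above its tangents, and no second derivative enters.\<close>

lemma strict_tangent:
  fixes f f' :: "real \<Rightarrow> real"
  assumes d: "\<And>x. a < x \<Longrightarrow> x < b \<Longrightarrow> (f has_real_derivative f' x) (at x)"
    and m: "\<And>x y. a < x \<Longrightarrow> x < y \<Longrightarrow> y < b \<Longrightarrow> f' x < f' y"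
    and x: "a < x" "x < b" and y: "a < y" "y < b" "x \<noteq> y"
  shows "f y > f x + f' x * (y - x)"
proof (cases "x < y")
  case True
  obtain z where z: "x < z" "z < y" "f y - f x = (y - x) * f' z"
    using MVT2[OF True, of f f'] d x y by (meson less_le_trans le_less_trans)
  have "(y - x) * f' x < (y - x) * f' z" using True m[of x z] z x y by (intro mult_strict_left_mono) auto
  then show ?thesis using z(3) by (simp add: mult.commute)
next
  case False
  then have yx: "y < x" using y by simp
  obtain z where z: "y < z" "z < x" "f x - f y = (x - y) * f' z"
    using MVT2[OF yx, of f f'] d x y by (meson less_le_trans le_less_trans)
  have "(x - y) * f' z < (x - y) * f' x" using yx m[of z x] z x y by (intro mult_strict_left_mono) auto
  then show ?thesis using z(3) by (simp add: algebra_simps)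
qed

text \<open>Here the threshold arises. With \<open>u = (sin x)^2\<close> the derivative is
  \<open>- c * sqrt (g x)\<close>, where \<open>g x = (1 - u) / (u * (c^2 - u))\<close>. For
  \<open>u < v\<close> the value at \<open>v\<close> is smaller exactly if
  \<open>(1 - u) * (1 - v) > s^2\<close>, and this follows when both are below \<open>1 - s\<close>,
  that is, when both angles are below \<open>\<theta>1\<close>.\<close>

lemma side_function_tangent:
  assumes n: "n \<ge> 3"
  defines "\<theta>1 \<equiv> arcsin (sqrt (1 - sin (pi / real n)))"
  obtains f' where "\<And>x y. 0 < x \<Longrightarrow> x < \<theta>1 \<Longrightarrow> 0 < y \<Longrightarrow> y < \<theta>1 \<Longrightarrow> x \<noteq> y \<Longrightarrow>
    arcosh (cos (pi / real n) / sin y) > arcosh (cos (pi / real n) / sin x) + f' x * (y - x)"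
proof -
  define c where "c = cos (pi / real n)"
  define s where "s = sin (pi / real n)"
  have pn: "0 < pi / real n" "pi / real n < pi / 2" "0 < c" "c < 1" using cos_pi_n[OF n] by (auto simp: c_def)
  have s: "0 < s" unfolding s_def by (intro sin_gt_zero) (use pn pi_gt_zero in linarith)+
  have cs: "c\<^sup>2 = 1 - s\<^sup>2" unfolding c_def s_def by (rule cos_squared_eq)
  have "c\<^sup>2 > 0" using pn by simp
  then have s1: "s < 1" using cs s by (smt (verit) one_le_power)
  have q: "0 \<le> sqrt (1 - s)" "sqrt (1 - s) \<le> 1" using s s1 by auto
  have t1: "\<theta>1 \<le> pi / 2" unfolding \<theta>1_def s_def[symmetric] by (intro arcsin_ubound) (use q in linarith)+
  have st1: "sin \<theta>1 = sqrt (1 - s)" unfolding \<theta>1_def s_def[symmetric] by (intro sin_arcsin) (use q in linarith)+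
  have S: "0 < sin x" "0 < cos x" "(sin x)\<^sup>2 < 1 - s" "(sin x)\<^sup>2 < c\<^sup>2" if x: "0 < x" "x < \<theta>1" for x
  proof -
    show sx: "0 < sin x" using x t1 pi_gt_zero by (intro sin_gt_zero) linarith+
    show "0 < cos x" using x t1 pi_gt_zero by (intro cos_gt_zero_pi) linarith+
    have "sin x < sin \<theta>1" using x t1 by (intro sin_monotone_2pi) auto
    then have "(sin x)\<^sup>2 < (sin \<theta>1)\<^sup>2" using sx by (intro power_strict_mono) auto
    then show a: "(sin x)\<^sup>2 < 1 - s" unfolding st1 using s1 by simp
    have "s\<^sup>2 < s" using s s1 by (simp add: power2_eq_square)
    then show "(sin x)\<^sup>2 < c\<^sup>2" using a cs by linarith
  qed
  have sc: "sin x < c" if x: "0 < x" "x < \<theta>1" for x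
    using S(4)[OF x] pn(3) by (simp add: power_less_imp_less_base)
  define f where "f x = arcosh (c / sin x)" for x
  define g where "g x = (1 - (sin x)\<^sup>2) / ((sin x)\<^sup>2 * (c\<^sup>2 - (sin x)\<^sup>2))" for x
  define f' where "f' x = - c * sqrt (g x)" for x
  have der: "(f has_real_derivative f' x) (at x)" if x: "0 < x" "x < \<theta>1" for x
  proof -
    have sx: "sin x > 0" "cos x > 0" using S[OF x] by auto
    have c1: "c / sin x > 1" using sc[OF x] sx by simp
    have "((\<lambda>x. c / sin x) has_real_derivative - c * cos x / (sin x)\<^sup>2) (at x)"
      using sx by (auto intro!: derivative_eq_intros simp: power2_eq_square)
    then have "(f has_real_derivative (1 / sqrt ((c / sin x)\<^sup>2 - 1)) * (- c * cos x / (sin x)\<^sup>2)) (at x)"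
      unfolding f_def by (rule DERIV_chain2[where f = arcosh and g = "\<lambda>x. c / sin x", OF arcosh_real_has_field_derivative[OF c1]])
    moreover have "(1 / sqrt ((c / sin x)\<^sup>2 - 1)) * (- c * cos x / (sin x)\<^sup>2) = f' x"
    proof -
      have "(c / sin x)\<^sup>2 - 1 = (c\<^sup>2 - (sin x)\<^sup>2) / (sin x)\<^sup>2" using sx by (simp add: power_divide field_simps)
      then have "sqrt ((c / sin x)\<^sup>2 - 1) = sqrt (c\<^sup>2 - (sin x)\<^sup>2) / sin x" using sx by (simp add: real_sqrt_divide)
      moreover have "sqrt (g x) = cos x / (sin x * sqrt (c\<^sup>2 - (sin x)\<^sup>2))"
      proof -
        have "1 - (sin x)\<^sup>2 = (cos x)\<^sup>2" by (simp add: cos_squared_eq)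
        then show ?thesis unfolding g_def using sx by (simp add: real_sqrt_divide real_sqrt_mult)
      qed
      ultimately show ?thesis unfolding f'_def using sx by (simp add: power2_eq_square)
    qed
    ultimately show ?thesis by simp
  qed
  have mono: "f' x < f' y" if xy: "0 < x" "x < y" "y < \<theta>1" for x y
  proof -
    define u v where "u = (sin x)\<^sup>2" and "v = (sin y)\<^sup>2"
    have x1: "x < \<theta>1" and y0: "0 < y" using xy by auto
    have u: "0 < u" "u < 1 - s" "u < c\<^sup>2" using S[OF xy(1) x1] by (auto simp: u_def)
    have v: "0 < v" "v < 1 - s" "v < c\<^sup>2" using S[OF y0 xy(3)] by (auto simp: v_def)
    have "sin x < sin y" using xy t1 by (intro sin_monotone_2pi) auto
    then have uv: "u < v" unfolding u_def v_def using S(1)[OF xy(1) x1] by (intro power_strict_mono) auto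
    have "s * s < (1 - u) * (1 - v)" using u v s by (intro mult_strict_mono) auto
    then have "0 < (v - u) * ((1 - u) * (1 - v) - s\<^sup>2)" using uv by (simp add: power2_eq_square)
    also have "\<dots> = (1 - u) * (v * (c\<^sup>2 - v)) - (1 - v) * (u * (c\<^sup>2 - u))"
      unfolding cs by (simp add: algebra_simps power2_eq_square)
    finally have "(1 - v) * (u * (c\<^sup>2 - u)) < (1 - u) * (v * (c\<^sup>2 - v))" by simp
    moreover have p: "0 < v * (c\<^sup>2 - v)" and q: "0 < u * (c\<^sup>2 - u)" using u v by simp_all
    ultimately have "(1 - v) / (v * (c\<^sup>2 - v)) < (1 - u) / (u * (c\<^sup>2 - u))"
      by (simp only: pos_divide_less_eq[OF p] times_divide_eq_left pos_less_divide_eq[OF q])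
    then have "g y < g x" by (simp add: g_def u_def v_def)
    then show ?thesis unfolding f'_def using pn(3) by simp
  qed
  show thesis
  proof (rule that)
    fix x y assume "0 < x" "x < \<theta>1" "0 < y" "y < \<theta>1" "x \<noteq> y"
    then show "arcosh (cos (pi / real n) / sin x) + f' x * (y - x) < arcosh (cos (pi / real n) / sin y)"
      using strict_tangent[of 0 \<theta>1 f f' x y] der mono unfolding f_def c_def by blast
  qed
qed

text \<open>The half angle is an affine function of the area, so the mean of the half angles belongs
  to the area \<open>T / k\<close>. Summing the tangent inequality at the mean \<open>h0\<close>
  cancels the linear terms, and one index with \<open>h i\<close> different from \<open>h0\<close>
  makes the sum strict.\<close>

lemma jensen_regular_peri:
  fixes A :: "nat \<Rightarrow> real"
  assumes n: "n \<ge> 3" and k: "k \<ge> 1" and T: "(\<Sum>i=1..k. A i) = T"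
    and A: "\<And>i. i \<in> {1..k} \<Longrightarrow> 0 < half_angle n (A i)"
      "\<And>i. i \<in> {1..k} \<Longrightarrow> half_angle n (A i) < arcsin (sqrt (1 - sin (pi / real n)))"
  shows "(\<Sum>i=1..k. regular_peri n (A i)) \<ge> real k * regular_peri n (T / real k)"
    and "(\<Sum>i=1..k. regular_peri n (A i)) = real k * regular_peri n (T / real k) \<Longrightarrow> i \<in> {1..k} \<Longrightarrow> A i = T / real k"
proof -
  define h where "h i = half_angle n (A i)" for i
  define h0 where "h0 = half_angle n (T / real k)"
  define \<theta>1 where "\<theta>1 = arcsin (sqrt (1 - sin (pi / real n)))"
  have kp: "real k > 0" using k by simp
  have np: "2 * real n > 0" using n by simp
  have sumh: "(\<Sum>i=1..k. h i) = real k * h0"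
  proof -
    have "(\<Sum>i=1..k. h i) = (\<Sum>i=1..k. ((real n - 2) * pi - A i)) / (2 * real n)"
      unfolding h_def half_angle_def by (simp add: sum_divide_distrib)
    also have "(\<Sum>i=1..k. ((real n - 2) * pi - A i)) = real k * ((real n - 2) * pi - T / real k)"
      using T kp by (simp add: sum_subtractf right_diff_distrib)
    finally show ?thesis by (simp add: h0_def half_angle_def)
  qed
  have ne: "{1..k} \<noteq> {}" using k by simp
  have "0 < (\<Sum>i=1..k. h i)" using A(1) ne unfolding h_def by (intro sum_pos) auto
  then have h0p: "0 < h0" unfolding sumh using kp by (simp add: zero_less_mult_iff)
  have "(\<Sum>i=1..k. h i) < (\<Sum>i=1..k. \<theta>1)" using A(2) ne unfolding h_def \<theta>1_def by (intro sum_strict_mono) auto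
  then have "real k * h0 < real k * \<theta>1" unfolding sumh by simp
  then have h01: "h0 < \<theta>1" using kp by simp
  obtain f' where f': "\<And>x y. 0 < x \<Longrightarrow> x < \<theta>1 \<Longrightarrow> 0 < y \<Longrightarrow> y < \<theta>1 \<Longrightarrow> x \<noteq> y \<Longrightarrow>
    arcosh (cos (pi / real n) / sin y) > arcosh (cos (pi / real n) / sin x) + f' x * (y - x)"
    using side_function_tangent[OF n] unfolding \<theta>1_def by metis
  define \<phi> where "\<phi> x = arcosh (cos (pi / real n) / sin x)" for x
  have lt: "\<phi> (h i) > \<phi> h0 + f' h0 * (h i - h0)" if "i \<in> {1..k}" "h i \<noteq> h0" for i
    unfolding \<phi>_def using f'[OF h0p h01, of "h i"] A[OF that(1)] that(2) by (auto simp: h_def \<theta>1_def)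
  have le: "\<phi> (h i) \<ge> \<phi> h0 + f' h0 * (h i - h0)" if "i \<in> {1..k}" for i
    using lt[OF that] by (cases "h i = h0") auto
  have lin: "(\<Sum>i=1..k. \<phi> h0 + f' h0 * (h i - h0)) = real k * \<phi> h0"
    using sumh by (simp add: sum.distrib sum_distrib_left[symmetric] sum_subtractf)
  have RP: "(\<Sum>i=1..k. regular_peri n (A i)) = 2 * real n * (\<Sum>i=1..k. \<phi> (h i))"
    unfolding regular_peri_def h_def \<phi>_def by (simp add: sum_distrib_left)
  have R0: "real k * regular_peri n (T / real k) = 2 * real n * (real k * \<phi> h0)"
    unfolding regular_peri_def h0_def \<phi>_def by simp
  have "(\<Sum>i=1..k. \<phi> (h i)) \<ge> real k * \<phi> h0" unfolding lin[symmetric] using le by (intro sum_mono)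
  then show "(\<Sum>i=1..k. regular_peri n (A i)) \<ge> real k * regular_peri n (T / real k)"
    unfolding RP R0 using np by (intro mult_left_mono) auto
  assume eq: "(\<Sum>i=1..k. regular_peri n (A i)) = real k * regular_peri n (T / real k)" and i: "i \<in> {1..k}"
  have "h i = h0"
  proof (rule ccontr)
    assume ne: "h i \<noteq> h0"
    have "(\<Sum>i=1..k. \<phi> h0 + f' h0 * (h i - h0)) < (\<Sum>i=1..k. \<phi> (h i))"
      by (rule sum_strict_mono_ex1) (use le lt[OF i ne] i in auto)
    then show False using eq np unfolding RP R0 lin by simp
  qed
  then show "A i = T / real k" unfolding h_def h0_def half_angle_def using np by (simp add: field_simps)
qed

section \<open>Several polygons of fixed total area\<close>

theorem theorem1p10:
  fixes n k :: nat and P :: "nat \<Rightarrow> (real^2) list" and T :: real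
  assumes "n \<ge> 3" and "k \<ge> 1"
    and "\<And>i. i \<in> {1..k} \<Longrightarrow> hyp_ngon n (P i)"
    and "(\<Sum>i=1..k. hyp_area (P i)) = T"
    and "\<And>i. i \<in> {1..k} \<Longrightarrow>
           hyp_area (P i) > (real n - 2) * pi - 2 * real n * arcsin (sqrt (1 - sin (pi / real n)))"
  shows "(\<Sum>i=1..k. hyp_peri (P i))
           \<ge> 2 * real n * real k *
               arcosh (cos (pi / real n) / sin (((real n - 2) * pi - T / real k) / (2 * real n))) \<and>
         ((\<Sum>i=1..k. hyp_peri (P i))
           = 2 * real n * real k *
               arcosh (cos (pi / real n) / sin (((real n - 2) * pi - T / real k) / (2 * real n)))
          \<longleftrightarrow> (\<exists>Q. regular_ngon n Q \<and> hyp_area Q = T / real k \<and>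
                  (\<forall>i\<in>{1..k}. isometric (P i) Q)))"
proof -
  note n = assms(1) and k = assms(2) and ng = assms(3)
  have np: "2 * real n > 0" using n by simp
  define rhs where "rhs = real k * regular_peri n (T / real k)"
  have rhs: "2 * real n * real k * arcosh (cos (pi / real n) / sin (((real n - 2) * pi - T / real k) / (2 * real n))) = rhs"
    by (simp add: rhs_def regular_peri_def half_angle_def)
  have area: "hyp_area Q \<ge> 0" "hyp_peri Q \<ge> 0" "hyp_area Q \<le> isoarea n (hyp_peri Q)" if Q: "hyp_ngon n Q" for Q
  proof -
    have z: "cmod (pvert Q i) < 1" if "i < n" for i using pvert_bound[OF Q that] .
    show "hyp_area Q \<ge> 0" unfolding hyp_area_eq[OF Q] by simp
    show "hyp_peri Q \<ge> 0" unfolding hyp_peri_eq[OF Q] using z by (rule cyc_sum_pdist_nonneg)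
    have "cyc_sum n parea (pvert Q) \<le> isoarea n (cyc_sum n pdist (pvert Q))" by (rule polygon_area_le[OF n z])
    \<comment> \<open>The bound for the mirror image controls the negative of the signed area, so
      together they bound its absolute value.\<close>
    moreover have "cyc_sum n parea (\<lambda>i. cnj (pvert Q i)) \<le> isoarea n (cyc_sum n pdist (\<lambda>i. cnj (pvert Q i)))"
      by (rule polygon_area_le[OF n]) (use z in simp)
    then have "- cyc_sum n parea (pvert Q) \<le> isoarea n (cyc_sum n pdist (pvert Q))"
      using cyc_sum_cnj[of n "pvert Q"] z n by simp
    ultimately show "hyp_area Q \<le> isoarea n (hyp_peri Q)" unfolding hyp_area_eq[OF Q] hyp_peri_eq[OF Q] by linarith
  qed
  note iso = isoperimetric_iff[OF n area(1) area(2) area(3)]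
  have pos: "0 < half_angle n (hyp_area (P i))" if "i \<in> {1..k}" for i
    using iso(1)[OF ng[OF that] ng[OF that] ng[OF that]] .
  have ge: "regular_peri n (hyp_area (P i)) \<le> hyp_peri (P i)" if "i \<in> {1..k}" for i
    using iso(2)[OF ng[OF that] ng[OF that] ng[OF that]] .
  have up: "half_angle n (hyp_area (P i)) < arcsin (sqrt (1 - sin (pi / real n)))" if "i \<in> {1..k}" for i
    using assms(5)[OF that] unfolding half_angle_def pos_divide_less_eq[OF np] by (simp add: algebra_simps)
  have jensen: "rhs \<le> (\<Sum>i=1..k. regular_peri n (hyp_area (P i)))"
    unfolding rhs_def by (rule jensen_regular_peri(1)[OF n k assms(4) pos up])
  have sum_ge: "(\<Sum>i=1..k. regular_peri n (hyp_area (P i))) \<le> (\<Sum>i=1..k. hyp_peri (P i))"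
    by (rule sum_mono) (rule ge)
  then have bound: "rhs \<le> (\<Sum>i=1..k. hyp_peri (P i))" using jensen by linarith
  have "(\<Sum>i=1..k. hyp_peri (P i)) = rhs \<longleftrightarrow> (\<exists>Q. regular_ngon n Q \<and> hyp_area Q = T / real k \<and> (\<forall>i\<in>{1..k}. isometric (P i) Q))"
  proof
    assume eq: "(\<Sum>i=1..k. hyp_peri (P i)) = rhs"
    \<comment> \<open>Equality squeezes the two inequalities, Jensen's and the isoperimetric one, so
      each of them is tight.\<close>
    have J: "(\<Sum>i=1..k. regular_peri n (hyp_area (P i))) = rhs" using jensen sum_ge eq by linarith
    have A: "hyp_area (P i) = T / real k" if "i \<in> {1..k}" for i by (rule jensen_regular_peri(2)[OF n k assms(4) pos up J[unfolded rhs_def] that])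
    have L: "hyp_peri (P i) = regular_peri n (hyp_area (P i))" if i: "i \<in> {1..k}" for i
    proof (rule ccontr)
      assume "hyp_peri (P i) \<noteq> regular_peri n (hyp_area (P i))"
      then have "regular_peri n (hyp_area (P i)) < hyp_peri (P i)" using ge[OF i] by simp
      then have "(\<Sum>i=1..k. regular_peri n (hyp_area (P i))) < (\<Sum>i=1..k. hyp_peri (P i))"
        using ge i by (intro sum_strict_mono_ex1) auto
      then show False using J eq by simp
    qed
    have ex: "\<exists>f r. hyp_isometry f \<and> 0 < r \<and> r < 1 \<and> map f (P i) = std_ngon n r" if i: "i \<in> {1..k}" for i
    proof -
      have "hyp_area (P i) = isoarea n (hyp_peri (P i))"
        using iso(3)[OF ng[OF i] ng[OF i] ng[OF i]] L[OF i] by blast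
      then show ?thesis using extremal_imp_std[OF ng[OF i]]
        unfolding hyp_area_eq[OF ng[OF i]] hyp_peri_eq[OF ng[OF i]] by metis
    qed
    obtain f r where fr: "\<And>i. i \<in> {1..k} \<Longrightarrow> hyp_isometry (f i)" "\<And>i. i \<in> {1..k} \<Longrightarrow> 0 < r i"
      "\<And>i. i \<in> {1..k} \<Longrightarrow> r i < 1" "\<And>i. i \<in> {1..k} \<Longrightarrow> map (f i) (P i) = std_ngon n (r i)"
      using ex by metis
    have std: "hyp_ngon n (std_ngon n (r i))" "hyp_peri (std_ngon n (r i)) = hyp_peri (P i)"
      "poly_region (std_ngon n (r i)) = f i ` poly_region (P i)" if i: "i \<in> {1..k}" for i
    proof -
      note m = isometry_ngon[OF fr(1)[OF i] ng[OF i], unfolded fr(4)[OF i]]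
      show "hyp_ngon n (std_ngon n (r i))" by (rule m(1))
      show "poly_region (std_ngon n (r i)) = f i ` poly_region (P i)" by (rule m(3))
      have "length (std_ngon n (r i)) = n" "length (P i) = n" using m(1) ng[OF i] by (simp_all add: hyp_ngon_def)
      then show "hyp_peri (std_ngon n (r i)) = hyp_peri (P i)" unfolding hyp_peri_def using m(4) by simp
    qed
    have k1: "1 \<in> {1..k}" using k by simp
    \<comment> \<open>Equal areas and tight perimeters give equal perimeters, hence one radius: the
      same standard polygon works for every index.\<close>
    have req: "r i = r 1" if i: "i \<in> {1..k}" for i
      by (rule std_ngon_inj[OF n fr(2)[OF i] fr(3)[OF i] fr(2)[OF k1] fr(3)[OF k1] std(1)[OF i] std(1)[OF k1]])
        (simp only: std(2)[OF i] std(2)[OF k1] L[OF i] L[OF k1] A[OF i] A[OF k1])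
    have "hyp_area (std_ngon n (r 1)) = T / real k"
    proof -
      have "hyp_area (std_ngon n (r 1)) = isoarea n (hyp_peri (P 1))"
        using std_ngon_area[OF n fr(2)[OF k1] fr(3)[OF k1] std(1)[OF k1]] std(2)[OF k1] by simp
      also have "\<dots> = hyp_area (P 1)" using iso(3)[OF ng[OF k1] ng[OF k1] ng[OF k1]] L[OF k1] by simp
      finally show ?thesis using A[OF k1] by simp
    qed
    moreover have "isometric (P i) (std_ngon n (r 1))" if i: "i \<in> {1..k}" for i
      unfolding isometric_def using fr(1)[OF i] std(3)[OF i] req[OF i] by metis
    moreover have "regular_ngon n (std_ngon n (r 1))"
      by (rule std_ngon_regular[OF n fr(2)[OF k1] fr(3)[OF k1] std(1)[OF k1]])
    ultimately show "\<exists>Q. regular_ngon n Q \<and> hyp_area Q = T / real k \<and> (\<forall>i\<in>{1..k}. isometric (P i) Q)" by blast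
  next
    assume "\<exists>Q. regular_ngon n Q \<and> hyp_area Q = T / real k \<and> (\<forall>i\<in>{1..k}. isometric (P i) Q)"
    then obtain Q where Q: "regular_ngon n Q" "hyp_area Q = T / real k" "\<And>i. i \<in> {1..k} \<Longrightarrow> isometric (P i) Q" by blast
    have Qn: "hyp_ngon n Q" using Q(1) unfolding regular_ngon_def by blast
    have ext: "\<bar>cyc_sum n parea (pvert Q)\<bar> = isoarea n (cyc_sum n pdist (pvert Q))" by (rule regular_imp_extremal[OF Q(1)])
    obtain g r where g: "hyp_isometry g" "0 < r" "r < 1" "map g Q = std_ngon n r"
      using extremal_imp_std[OF Qn ext] by blast
    note m = isometry_ngon[OF g(1) Qn, unfolded g(4)]
    have len: "length (std_ngon n r) = n" "length Q = n" using m(1) Qn by (simp_all add: hyp_ngon_def)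
    have Qp: "hyp_peri (std_ngon n r) = hyp_peri Q" unfolding hyp_peri_def using m(4) len by simp
    have Qr: "hyp_peri Q = regular_peri n (T / real k)"
      using iso(3)[OF Qn Qn Qn] ext Q(2) unfolding hyp_area_eq[OF Qn] hyp_peri_eq[OF Qn] by simp
    have "hyp_peri (P i) = regular_peri n (T / real k)" if i: "i \<in> {1..k}" for i
    proof -
      obtain h where h: "hyp_isometry h" "h ` poly_region (P i) = poly_region Q" using Q(3)[OF i] by (auto simp: isometric_def)
      \<comment> \<open>Composed with the map that standardizes \<open>Q\<close>, the isometry
        carries the region of \<open>P i\<close> to that of a standard polygon, which determines the
        perimeter.\<close>
      define f where "f x = g (h x)" for x
      have f: "hyp_isometry f" unfolding f_def by (rule isometry_comp[OF g(1) h(1)])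
      note mP = isometry_ngon[OF f ng[OF i]]
      have "poly_region (map f (P i)) = poly_region (std_ngon n r)"
        unfolding mP(3) m(3) h(2)[symmetric] f_def by (simp add: image_image)
      then have "hyp_peri (map f (P i)) = hyp_peri (std_ngon n r)"
        by (rule ngon_same_region_std[OF mP(1) m(1) g(2,3)])
      moreover have "length (P i) = n" using ng[OF i] by (simp add: hyp_ngon_def)
      then have "hyp_peri (map f (P i)) = hyp_peri (P i)" unfolding hyp_peri_def using mP(4) by simp
      ultimately show ?thesis using Qp Qr by simp
    qed
    then show "(\<Sum>i=1..k. hyp_peri (P i)) = rhs" by (simp add: rhs_def)
  qed
  with bound show ?thesis unfolding rhs by blast
qed

end
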